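(* Let $\gamma, k\in\mathbb{R}$ and let $g\in C^{1}(\mathbb{R})$ be a nonlinear function with $g(0)=0$ and $g'(0)=k$. For $0<\alpha\le 1$ and $\tau_1,\tau_2\ge 0$ consider the fractional delay differential equation $$D^{\alpha}x(t) = -\gamma x(t) + g\big(x(t-\tau_1)\big) - e^{-\gamma\tau_2}\, g\big(x(t-\tau_1-\tau_2)\big),$$ where $D^\alpha$ is the Caputo fractional derivative, and its equilibrium point $x_*=0$. Then: (i) If $0<\gamma<k$ and $$\tau_2 > -\frac{1}{\gamma}\log\left(\frac{k-\gamma}{k}\right),$$ then the equilibrium $x_*=0$ is unstable for all $\tau_1\ge 0$ and all $0<\alpha\le 1$. (ii) If $\gamma<0<k$ and $$\tau_2 < -\frac{1}{\gamma}\log\left(\frac{k-\gamma}{k}\right),$$ then the equilibrium $x_*=0$ is unstable for all $\tau_1\ge 0$ and all $0<\alpha\le 1$.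
   Context: Caputo derivative: for $0<\alpha<1$, $D^{\alpha}x(t)=\frac{1}{\Gamma(1-\alpha)}\int_0^t (t-s)^{-\alpha}x'(s)\,ds$, and for $\alpha=1$, $D^{1}x(t)=x'(t)$. Initial value problem: the equation is considered for $t\ge 0$ together with $x(t)=\phi(t)$ for $-(\tau_1+\tau_2)\le t\le 0$, where $\phi:[-(\tau_1+\tau_2),0]\to\mathbb{R}$ is continuous. The corresponding solution is denoted $x(t,\phi)$, and $\|\phi\|=\sup_{-(\tau_1+\tau_2)\le t\le 0}|\phi(t)|$. Equilibrium and stability: an equilibrium is a constant solution $x(t)=x_*$; since $g(0)=0$, $x_*=0$ is an equilibrium. An equilibrium $x_*$ is stable if for every $\varepsilon>0$ there exists $\delta>0$ such that $\|\phi-x_*\|<\delta$ implies $|x(t,\phi)-x_*|<\varepsilon$ for all $t\ge 0$. An equilibrium that is not stable is called unstable. Standing convention: the local stability of the nonlinear equation in a neighborhood of $x_*=0$ is taken to coincide with that of its linearization at $0$, $$D^{\alpha}x(t) = -\gamma x(t)+k\,x(t-\tau_1)-k e^{-\gamma\tau_2}\,x(t-\tau_1-\tau_2),$$ whose stability is determined by the roots $\lambda$ of the characteristic equation $$\lambda^{\alpha} = -\gamma + k e^{-\lambda\tau_1} - k e^{-\gamma\tau_2}e^{-\lambda(\tau_1+\tau_2)},$$ the existence of a root with positive real part implying instability. Here $\log$ is the natural logarithm. *)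

theory Defs
  imports "HOL-Analysis.Analysis"
begin

text \<open>
  The value is meaningful only where the derivative and, for \<open>\<alpha> < 1\<close>, the integral exist;
  \<open>caputo_exists\<close> states that they do.
\<close>

definition caputo_exists :: "real \<Rightarrow> (real \<Rightarrow> real) \<Rightarrow> real \<Rightarrow> bool" where
  "caputo_exists \<alpha> x t \<longleftrightarrow>
     (\<forall>s\<in>{0<..t}. x differentiable (at s)) \<and>
     (\<alpha> < 1 \<longrightarrow> (\<lambda>s. (t - s) powr (- \<alpha>) * deriv x s) absolutely_integrable_on {0..t})"

definition caputo_deriv :: "real \<Rightarrow> (real \<Rightarrow> real) \<Rightarrow> real \<Rightarrow> real" where
  "caputo_deriv \<alpha> x t =
     (if \<alpha> = 1 then deriv x t
      else 1 / Gamma (1 - \<alpha>) * integral {0..t} (\<lambda>s. (t - s) powr (- \<alpha>) * deriv x s))"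

definition dde_rhs ::
  "real \<Rightarrow> real \<Rightarrow> real \<Rightarrow> (real \<Rightarrow> real) \<Rightarrow> (real \<Rightarrow> real) \<Rightarrow> real \<Rightarrow> real" where
  "dde_rhs \<gamma> \<tau>\<^sub>1 \<tau>\<^sub>2 g x t =
     - \<gamma> * x t + g (x (t - \<tau>\<^sub>1)) - exp (- \<gamma> * \<tau>\<^sub>2) * g (x (t - \<tau>\<^sub>1 - \<tau>\<^sub>2))"

text \<open>
  \<open>x\<close> solves the initial value problem with history \<open>\<phi>\<close> on \<open>[0, T)\<close>. The equation is imposed
  at \<open>t > 0\<close> only: at \<open>t = 0\<close> the Caputo integral is over a null set (so equals 0 whatever the
  right-hand side is), and for \<open>\<alpha> = 1\<close> the two-sided derivative there would involve the history.
  Such a solution also solves the equation in any weaker (almost everywhere or integrated) sense,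
  so an escaping solution in the sense below is one in the weaker senses too.
\<close>

definition dde_solution ::
  "real \<Rightarrow> real \<Rightarrow> real \<Rightarrow> real \<Rightarrow> (real \<Rightarrow> real) \<Rightarrow> (real \<Rightarrow> real) \<Rightarrow> real \<Rightarrow> (real \<Rightarrow> real) \<Rightarrow> bool" where
  "dde_solution \<alpha> \<gamma> \<tau>\<^sub>1 \<tau>\<^sub>2 g \<phi> T x \<longleftrightarrow>
     continuous_on {- (\<tau>\<^sub>1 + \<tau>\<^sub>2)..<T} x \<and>
     (\<forall>t\<in>{- (\<tau>\<^sub>1 + \<tau>\<^sub>2)..0}. x t = \<phi> t) \<and>
     (\<forall>t\<in>{0<..<T}. caputo_exists \<alpha> x t \<and> caputo_deriv \<alpha> x t = dde_rhs \<gamma> \<tau>\<^sub>1 \<tau>\<^sub>2 g x t)"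

definition history_norm :: "real \<Rightarrow> (real \<Rightarrow> real) \<Rightarrow> real" where
  "history_norm \<tau> \<phi> = (SUP t\<in>{- \<tau>..0}. \<bar>\<phi> t\<bar>)"

definition dde_equilibrium ::
  "real \<Rightarrow> real \<Rightarrow> real \<Rightarrow> real \<Rightarrow> (real \<Rightarrow> real) \<Rightarrow> real \<Rightarrow> bool" where
  "dde_equilibrium \<alpha> \<gamma> \<tau>\<^sub>1 \<tau>\<^sub>2 g x\<^sub>0 \<longleftrightarrow>
     (\<forall>T>0. dde_solution \<alpha> \<gamma> \<tau>\<^sub>1 \<tau>\<^sub>2 g (\<lambda>t. x\<^sub>0) T (\<lambda>t. x\<^sub>0))"

text \<open>
  For \<open>g\<close> merely continuously differentiable a solution can blow up in finite time (if \<open>\<tau>\<^sub>1 = 0\<close>),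
  so the bound in the definition of stability is required at every time up to which the solution
  exists: \<open>T\<close> ranges over all finite horizons. A solution that exists for all \<open>t \<ge> 0\<close> is thereby
  bounded for all \<open>t \<ge> 0\<close>, and one that leaves the \<open>\<epsilon>\<close>-neighbourhood before blowing up violates
  stability.
\<close>

definition dde_stable ::
  "real \<Rightarrow> real \<Rightarrow> real \<Rightarrow> real \<Rightarrow> (real \<Rightarrow> real) \<Rightarrow> real \<Rightarrow> bool" where
  "dde_stable \<alpha> \<gamma> \<tau>\<^sub>1 \<tau>\<^sub>2 g x\<^sub>0 \<longleftrightarrow>
     (\<forall>\<epsilon>>0. \<exists>\<delta>>0. \<forall>\<phi>.
        continuous_on {- (\<tau>\<^sub>1 + \<tau>\<^sub>2)..0} \<phi> \<and> history_norm (\<tau>\<^sub>1 + \<tau>\<^sub>2) (\<lambda>t. \<phi> t - x\<^sub>0) < \<delta> \<longrightarrow>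
        (\<forall>T>0. \<forall>x. dde_solution \<alpha> \<gamma> \<tau>\<^sub>1 \<tau>\<^sub>2 g \<phi> T x \<longrightarrow>
           (\<forall>t\<in>{0..<T}. \<bar>x t - x\<^sub>0\<bar> < \<epsilon>)))"

definition dde_unstable ::
  "real \<Rightarrow> real \<Rightarrow> real \<Rightarrow> real \<Rightarrow> (real \<Rightarrow> real) \<Rightarrow> real \<Rightarrow> bool" where
  "dde_unstable \<alpha> \<gamma> \<tau>\<^sub>1 \<tau>\<^sub>2 g x\<^sub>0 \<longleftrightarrow>
     dde_equilibrium \<alpha> \<gamma> \<tau>\<^sub>1 \<tau>\<^sub>2 g x\<^sub>0 \<and> \<not> dde_stable \<alpha> \<gamma> \<tau>\<^sub>1 \<tau>\<^sub>2 g x\<^sub>0"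

end

theory Submission
  imports Defs "HOL-Probability.Characteristic_Functions" "HOL-Complex_Analysis.Conformal_Mappings"
begin

text \<open>
  Put \<open>c = e\<^bsup>-\<gamma>\<tau>\<^sub>2\<^esup>\<close>. Both hypotheses say \<open>- \<gamma> + k - k c > 0\<close>, so
  \<open>h(s) = s\<^sup>\<alpha> + \<gamma> - k e\<^bsup>-s\<tau>\<^sub>1\<^esup> + k c e\<^bsup>-s(\<tau>\<^sub>1 + \<tau>\<^sub>2)\<^esup>\<close> has a real zero \<open>l > 0\<close>. Other zeros may lie
  further to the right, so no exponential dichotomy is available; and the Caputo derivative does not
  allow restarting a solution.

  Instead, suppose the equilibrium is stable. A solution with a small history of size \<open>d\<close> is bounded,
  hence its Laplace transform \<open>Z\<close> exists in the right half plane and satisfies \<open>h Z = R\<close>, where \<open>R\<close>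
  is the transform of the history plus the nonlinear remainder, the latter being at most \<open>\<eta>\<close> times the
  solution. On a vertical line \<open>Re s = s\<^sub>0\<close> with \<open>0 < s\<^sub>0 < l\<close> without zeros of \<open>h\<close>, Parseval's identity
  bounds the weighted \<open>L\<^sup>2\<close> norm of the solution by a multiple of \<open>d\<close>, however fast unbounded solutions
  might grow. At \<open>s = l\<close> the identity reads \<open>R(l) = 0\<close>; but the history contributes a fixed multiple
  of \<open>d\<close> and the remainder at most \<open>\<eta>\<close> times a multiple of \<open>d\<close>, which is impossible for small \<open>\<eta>\<close>.

  The history is a smooth bump supported in \<open>(-\<tau>\<^sub>1-\<tau>\<^sub>2, -\<tau>\<^sub>1)\<close>: then the solution is continuously
  differentiable, whereas a generic history makes it fail to be differentiable at \<open>t = \<tau>\<^sub>1\<close> for small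
  \<open>\<alpha>\<close>. There is no room for a bump if \<open>\<tau>\<^sub>2 = 0\<close>, but then the delayed terms cancel and the
  solution is a Mittag-Leffler function.
\<close>

section \<open>Fractional integrals\<close>

text \<open>Refuting \<open>dde_stable\<close> requires an actual solution in the pointwise Caputo
  sense. The unknown is \<open>z = x - \<phi>\<close>, which vanishes for t <= 0, so that the
  history enters only as a forcing term \<open>p\<close> and the problem becomes the fixed-point
  equation z = I^\<alpha>(right-hand side). The Caputo equation is recovered from I^(1-\<alpha>)
  I^\<alpha> = I^1. Global existence is obtained from a global Lipschitz constant, so
  \<open>g\<close> is replaced outside a small interval by a function \<open>G\<close> with
  derivative within \<open>e\<close> of \<open>k\<close>. Stability is then used twice: it confines
  the solution to the interval where \<open>G\<close> and \<open>g\<close> agree, and it supplies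
  the boundedness on which the Laplace transform rests. The place of the bump also fixes a sign: the
  history acts only through the second delayed term, so \<open>p\<close> is nonpositive and its
  transform at the root cannot cancel. Finally, every constant in the estimates is chosen before the
  amplitude \<open>d\<close>, and every bound is linear in \<open>d\<close>, so \<open>d\<close>
  drops out of the concluding inequality.\<close>

definition frac_kernel :: "real \<Rightarrow> real \<Rightarrow> real" where
  "frac_kernel a s = (if 0 < s then s powr (a - 1) / Gamma a else 0)"

text \<open>The Riemann-Liouville integral as a convolution over the whole line. The shift sits on
  \<open>f\<close>, so limits and derivatives in t fall on the regular factor and never on the
  singular kernel.\<close>

definition frac_int :: "real \<Rightarrow> (real \<Rightarrow> real) \<Rightarrow> real \<Rightarrow> real" where
  "frac_int a f t = (LINT s|lborel. frac_kernel a s * f (t - s))"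

definition causal :: "(real \<Rightarrow> 'a::zero) \<Rightarrow> bool" where
  "causal f \<longleftrightarrow> (\<forall>t\<le>0. f t = 0)"

lemma DERIV_imp_continuous_on_UNIV:
  fixes f :: "real \<Rightarrow> real"
  shows "(\<And>t. (f has_real_derivative f' t) (at t)) \<Longrightarrow> continuous_on UNIV f"
  by (rule DERIV_continuous_on) simp

section \<open>The Riemann-Liouville kernel and its convolutions\<close>

lemma frac_kernel_nonneg: "0 < a \<Longrightarrow> 0 \<le> frac_kernel a s"
  by (simp add: frac_kernel_def Gamma_real_pos less_imp_le)

lemma frac_kernel_measurable [measurable]: "frac_kernel a \<in> borel_measurable borel"
  unfolding frac_kernel_def by measurable

lemma has_bochner_integral_frac_kernel_exp_1:
  assumes "0 < a"
  shows "has_bochner_integral lborel (\<lambda>s. frac_kernel a s * exp (- s)) 1"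
proof (rule has_bochner_integral_nn_integral)
  have "(\<integral>\<^sup>+ s. ennreal (frac_kernel a s * exp (- s)) \<partial>lborel) =
        (\<integral>\<^sup>+ s. ennreal (inverse (Gamma a)) * ennreal (indicator {0..} s * s powr (a - 1) / exp s) \<partial>lborel)"
    using Gamma_real_pos[OF assms]
    by (intro nn_integral_cong)
       (auto simp: frac_kernel_def indicator_def exp_minus field_simps simp flip: ennreal_mult')
  also have "\<dots> = ennreal (inverse (Gamma a)) * ennreal (Gamma a)"
    by (simp add: nn_integral_cmult Gamma_conv_nn_integral_real[OF assms])
  also have "\<dots> = ennreal 1"
    using Gamma_real_pos[OF assms] by (simp flip: ennreal_mult')
  finally show "(\<integral>\<^sup>+ s. ennreal (frac_kernel a s * exp (- s)) \<partial>lborel) = ennreal 1" .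
qed (use assms frac_kernel_nonneg in auto)

lemma frac_kernel_scale:
  assumes "0 < M"
  shows "frac_kernel a (M * s) = M powr (a - 1) * frac_kernel a s"
  using assms by (auto simp: frac_kernel_def powr_mult zero_less_mult_iff)

lemma has_bochner_integral_frac_kernel_exp:
  assumes "0 < a" "0 < M"
  shows "has_bochner_integral lborel (\<lambda>s. frac_kernel a s * exp (- (M * s))) (M powr (- a))"
proof -
  have "has_bochner_integral lborel (\<lambda>s. frac_kernel a (0 + M * s) * exp (- (0 + M * s))) (1 /\<^sub>R \<bar>M\<bar>)"
    using lborel_has_bochner_integral_real_affine_iff[of M "\<lambda>s. frac_kernel a s * exp (- s)" 1 0]
      has_bochner_integral_frac_kernel_exp_1[OF assms(1)] assms(2) by simp
  then have "has_bochner_integral lborel (\<lambda>s. M powr (1 - a) * (M powr (a - 1) * frac_kernel a s * exp (- (M * s))))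
      (M powr (1 - a) * (1 / M))"
    using assms(2) by (intro has_bochner_integral_mult_right)
      (simp add: frac_kernel_scale divide_inverse)
  moreover have "M powr (1 - a) * (1 / M) = M powr (- a)"
    using assms(2) powr_add[of M "- a" 1] by (simp add: add.commute)
  moreover have "M powr (1 - a) * (M powr (a - 1) * frac_kernel a s * exp (- (M * s))) =
      frac_kernel a s * exp (- (M * s))" for s
    using assms(2) powr_add[of M "1 - a" "a - 1"] by (simp add: mult.assoc[symmetric])
  ultimately show ?thesis by simp
qed

lemma integrable_frac_kernel_exp:
  "0 < a \<Longrightarrow> 0 < M \<Longrightarrow> integrable lborel (\<lambda>s. frac_kernel a s * exp (- (M * s)))"
  and integral_frac_kernel_exp:
  "0 < a \<Longrightarrow> 0 < M \<Longrightarrow> (LINT s|lborel. frac_kernel a s * exp (- (M * s))) = M powr (- a)"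
  using has_bochner_integral_frac_kernel_exp by (auto simp: has_bochner_integral_iff)

lemma causal_continuous_bounded:
  fixes f :: "real \<Rightarrow> real"
  assumes "continuous_on UNIV f" "causal f"
  obtains B where "0 \<le> B" "\<And>t. t \<le> T \<Longrightarrow> \<bar>f t\<bar> \<le> B"
proof -
  have "bounded (f ` {0..T})"
    by (intro compact_imp_bounded compact_continuous_image continuous_on_subset[OF assms(1)]) auto
  then obtain B where B: "\<And>t. t \<in> {0..T} \<Longrightarrow> \<bar>f t\<bar> \<le> B" "0 < B"
    unfolding bounded_pos by (metis imageI real_norm_def)
  have "\<bar>f t\<bar> \<le> B" if "t \<le> T" for t
    using that assms(2) B by (cases "t \<le> 0") (auto simp: causal_def)
  with B(2) that show ?thesis by (metis less_imp_le)
qed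

text \<open>For a <= 1 the kernel is not integrable at infinity, but causality of \<open>f\<close>
  cuts the product off at s = t <= T. There the factor exp(T - s) is at least 1 and can be inserted
  for free, which gives one integrable majorant for all t <= T.\<close>

lemma frac_kernel_bound:
  fixes f :: "real \<Rightarrow> real"
  assumes "0 < a" "causal f" "\<And>u. u \<le> T \<Longrightarrow> \<bar>f u\<bar> \<le> B" "t \<le> T"
  shows "\<bar>frac_kernel a s * f (t - s)\<bar> \<le> B * exp T * (frac_kernel a s * exp (- (1 * s)))"
proof -
  have B: "0 \<le> B" using assms(3)[of t] assms(4) by linarith
  consider "s \<le> 0" | "0 < s" "t \<le> s" | "0 < s" "s < t" by linarith
  then show ?thesis
  proof cases
    case 3
    have "\<bar>f (t - s)\<bar> \<le> B" using 3 assms(4) by (intro assms(3)) auto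
    also have "\<dots> \<le> B * exp (T - s)"
      using mult_left_mono[of 1 "exp (T - s)" B] 3 assms(4) B by simp
    finally have "\<bar>f (t - s)\<bar> \<le> B * exp (T - s)" .
    from mult_left_mono[OF this frac_kernel_nonneg[OF assms(1), of s]] show ?thesis
      using frac_kernel_nonneg[OF assms(1), of s]
      by (simp add: abs_mult exp_diff exp_minus divide_inverse mult_ac)
  qed (use assms B frac_kernel_nonneg[OF assms(1), of s] in \<open>auto simp: frac_kernel_def causal_def\<close>)
qed

lemma integrable_frac_int:
  fixes f :: "real \<Rightarrow> real"
  assumes "0 < a" "continuous_on UNIV f" "causal f"
  shows "integrable lborel (\<lambda>s. frac_kernel a s * f (t - s))"
proof -
  obtain B where B: "\<And>u. u \<le> t \<Longrightarrow> \<bar>f u\<bar> \<le> B"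
    using causal_continuous_bounded[OF assms(2,3)] by blast
  have [measurable]: "f \<in> borel_measurable borel"
    using assms(2) by (simp add: borel_measurable_continuous_onI)
  show ?thesis
    by (rule Bochner_Integration.integrable_bound[OF integrable_mult_right[OF integrable_frac_kernel_exp[of a 1], of "B * exp t"]])
       (use assms frac_kernel_bound[OF assms(1,3) B order_refl] in \<open>auto intro!: AE_I2 order_trans[OF _ abs_ge_self]\<close>)
qed

lemma causal_frac_int: "causal f \<Longrightarrow> causal (frac_int a f)"
  unfolding causal_def frac_int_def
proof (intro allI impI)
  fix t :: real assume *: "\<forall>t\<le>0. f t = 0" "t \<le> 0"
  have "(\<lambda>s. frac_kernel a s * f (t - s)) = (\<lambda>s. 0)"
    using * by (auto simp: frac_kernel_def)
  then show "(LINT s|lborel. frac_kernel a s * f (t - s)) = 0" by simp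
qed

text \<open>In the norm weighted by exp(-M t) the fractional integral has norm at most M^(-a). This
  is the source of the contraction: a large M makes it as small as desired.\<close>

lemma frac_int_bound:
  fixes f :: "real \<Rightarrow> real"
  assumes "0 < a" "0 < M" "continuous_on UNIV f" "causal f" "\<And>u. u \<le> T \<Longrightarrow> \<bar>f u\<bar> \<le> A * exp (M * u)" "t \<le> T"
  shows "\<bar>frac_int a f t\<bar> \<le> A * M powr (- a) * exp (M * t)"
proof -
  have A: "0 \<le> A" using order_trans[OF abs_ge_zero assms(5)[OF assms(6)]] by (simp add: zero_le_mult_iff)
  have "\<bar>frac_int a f t\<bar> \<le> (LINT s|lborel. \<bar>frac_kernel a s * f (t - s)\<bar>)"
    unfolding frac_int_def by (rule integral_abs_bound)
  also have "\<dots> \<le> (LINT s|lborel. A * exp (M * t) * (frac_kernel a s * exp (- (M * s))))"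
  proof (intro integral_mono integrable_abs integrable_frac_int integrable_mult_right integrable_frac_kernel_exp assms)
    fix s
    show "\<bar>frac_kernel a s * f (t - s)\<bar> \<le> A * exp (M * t) * (frac_kernel a s * exp (- (M * s)))"
    proof (cases "0 < s")
      case True
      then have "\<bar>f (t - s)\<bar> \<le> A * exp (M * (t - s))"
        using assms(6) by (intro assms(5)) auto
      from mult_left_mono[OF this frac_kernel_nonneg[OF assms(1), of s]] show ?thesis
        using frac_kernel_nonneg[OF assms(1), of s]
        by (simp add: abs_mult exp_diff exp_minus divide_inverse mult_ac right_diff_distrib)
    qed (simp add: frac_kernel_def)
  qed
  also have "\<dots> = A * M powr (- a) * exp (M * t)"
    by (simp add: integral_frac_kernel_exp[OF assms(1,2)])
  finally show ?thesis .
qed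

lemma frac_int_diff:
  fixes f g :: "real \<Rightarrow> real"
  assumes "0 < a" "continuous_on UNIV f" "causal f" "continuous_on UNIV g" "causal g"
  shows "frac_int a f t - frac_int a g t = frac_int a (\<lambda>s. f s - g s) t"
  unfolding frac_int_def
  by (subst Bochner_Integration.integral_diff[symmetric])
     (use assms in \<open>auto intro: integrable_frac_int simp: right_diff_distrib\<close>)

lemma continuous_frac_int:
  fixes f :: "real \<Rightarrow> real"
  assumes "0 < a" "continuous_on UNIV f" "causal f"
  shows "continuous_on UNIV (frac_int a f)"
proof -
  have [measurable]: "f \<in> borel_measurable borel"
    using assms(2) by (simp add: borel_measurable_continuous_onI)
  have "isCont (frac_int a f) t" for t
  proof (subst continuous_at_sequentially, intro allI impI, unfold comp_def)
    fix S :: "nat \<Rightarrow> real" assume S: "S \<longlonglongrightarrow> t"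
    obtain B where B: "\<And>u. u \<le> t + 1 \<Longrightarrow> \<bar>f u\<bar> \<le> B"
      using causal_continuous_bounded[OF assms(2,3)] by blast
    obtain N where N: "\<And>n. N \<le> n \<Longrightarrow> S n \<le> t + 1"
      using order_tendstoD(2)[OF S, of "t + 1"] unfolding eventually_sequentially
      by (metis less_add_one less_imp_le)
    have "(\<lambda>n. frac_int a f (S (n + N))) \<longlonglongrightarrow> frac_int a f t"
      unfolding frac_int_def
    proof (rule integral_dominated_convergence)
      show "integrable lborel (\<lambda>s. B * exp (t + 1) * (frac_kernel a s * exp (- (1 * s))))"
        by (intro integrable_mult_right integrable_frac_kernel_exp assms) simp
      show "AE s in lborel. norm (frac_kernel a s * f (S (n + N) - s))
          \<le> B * exp (t + 1) * (frac_kernel a s * exp (- (1 * s)))" for n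
        using frac_kernel_bound[OF assms(1,3) B, of "t + 1" "S (n + N)"] N[of "n + N"] by (intro AE_I2) simp
      have "(\<lambda>n. frac_kernel a s * f (S (n + N) - s)) \<longlonglongrightarrow> frac_kernel a s * f (t - s)" for s
        using continuous_on_tendsto_compose[OF assms(2) tendsto_diff[OF LIMSEQ_ignore_initial_segment[OF S, of N] tendsto_const[of s]]]
        by (intro tendsto_intros) simp
      then show "AE s in lborel. (\<lambda>n. frac_kernel a s * f (S (n + N) - s)) \<longlonglongrightarrow> frac_kernel a s * f (t - s)"
        by simp
    qed simp_all
    then show "(\<lambda>n. frac_int a f (S n)) \<longlonglongrightarrow> frac_int a f t"
      by (rule LIMSEQ_offset)
  qed
  then show ?thesis by (simp add: continuous_on_eq_continuous_at)
qed

text \<open>Differentiation under the integral by dominated convergence of difference quotients. No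
  boundary term appears because \<open>f\<close> vanishes at 0 and is differentiable there.\<close>

lemma frac_int_deriv:
  fixes f f' :: "real \<Rightarrow> real"
  assumes "0 < a" "causal f" "causal f'" "continuous_on UNIV f'"
    and der: "\<And>t. (f has_real_derivative f' t) (at t)"
  shows "(frac_int a f has_real_derivative frac_int a f' t) (at t)"
proof -
  have cont: "continuous_on UNIV f"
    using der by (rule DERIV_imp_continuous_on_UNIV)
  have [measurable]: "f \<in> borel_measurable borel" "f' \<in> borel_measurable borel"
    using cont assms(4) by (simp_all add: borel_measurable_continuous_onI)
  show ?thesis
    unfolding DERIV_def
  proof (subst LIMSEQ_SEQ_conv[symmetric], intro allI impI)
    fix S :: "nat \<Rightarrow> real" assume "(\<forall>n. S n \<noteq> 0) \<and> S \<longlonglongrightarrow> 0"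
    then have S: "S n \<noteq> 0" "S \<longlonglongrightarrow> 0" for n by auto
    obtain B where B: "\<And>u. u \<le> t + 1 \<Longrightarrow> \<bar>f' u\<bar> \<le> B"
      using causal_continuous_bounded[OF assms(4,3)] by blast
    obtain N where N: "\<And>n. N \<le> n \<Longrightarrow> \<bar>S n\<bar> < 1"
      using tendstoD[OF S(2), of 1] by (auto simp: eventually_sequentially dist_real_def)
    define q where "q n u = (f (u + S (n + N)) - f u) / S (n + N)" for n u
    have qB: "\<bar>q n u\<bar> \<le> B" if "u \<le> t" for n u
    proof -
      have "norm (f (u + S (n + N)) - f u) \<le> B * norm (u + S (n + N) - u)"
        by (rule field_differentiable_bound[of "{..t + 1}" f f'])
           (use der B that N[of "n + N"] in \<open>auto intro: has_field_derivative_at_within\<close>)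
      then show ?thesis using S(1)[of "n + N"] by (simp add: q_def divide_le_eq)
    qed
    have "(\<lambda>n. LINT s|lborel. frac_kernel a s * q n (t - s)) \<longlonglongrightarrow> frac_int a f' t"
      unfolding frac_int_def
    proof (rule integral_dominated_convergence)
      show "integrable lborel (\<lambda>s. B * exp (t + 1) * (frac_kernel a s * exp (- (1 * s))))"
        by (intro integrable_mult_right integrable_frac_kernel_exp assms) simp
      show "AE s in lborel. norm (frac_kernel a s * q n (t - s))
          \<le> B * exp (t + 1) * (frac_kernel a s * exp (- (1 * s)))" for n
      proof (intro AE_I2)
        fix s
        \<comment> \<open>With an increment below 1 the quotient looks ahead by less than one unit
          of time, so it is causal only after a shift by 1; hence the constant exp(t + 1).\<close>
        have c: "causal (\<lambda>v. q n (v - 1))"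
          using assms(2) N[of "n + N"] by (auto simp: causal_def q_def)
        have "\<bar>frac_kernel a s * q n (t + 1 - s - 1)\<bar> \<le> B * exp (t + 1) * (frac_kernel a s * exp (- (1 * s)))"
          by (rule frac_kernel_bound[OF assms(1) c]) (use qB in auto)
        then show "norm (frac_kernel a s * q n (t - s)) \<le> B * exp (t + 1) * (frac_kernel a s * exp (- (1 * s)))"
          by simp
      qed
      have "(\<lambda>n. q n (t - s)) \<longlonglongrightarrow> f' (t - s)" for s
      proof -
        have "(\<forall>n. S (n + N) \<noteq> 0) \<and> (\<lambda>n. S (n + N)) \<longlonglongrightarrow> 0"
          using LIMSEQ_ignore_initial_segment[OF S(2), of N] S(1) by simp
        with der[of "t - s"] show ?thesis
          unfolding q_def DERIV_def LIMSEQ_SEQ_conv[symmetric] by (elim allE impE)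
      qed
      then show "AE s in lborel. (\<lambda>n. frac_kernel a s * q n (t - s)) \<longlonglongrightarrow> frac_kernel a s * f' (t - s)"
        by (intro AE_I2 tendsto_intros)
    qed (auto simp: q_def)
    moreover have "(LINT s|lborel. frac_kernel a s * q n (t - s)) =
        (frac_int a f (t + S (n + N)) - frac_int a f t) / S (n + N)" for n
    proof -
      have "frac_int a f (t + S (n + N)) - frac_int a f t =
          (LINT s|lborel. frac_kernel a s * f (t + S (n + N) - s) - frac_kernel a s * f (t - s))"
        unfolding frac_int_def
        by (intro Bochner_Integration.integral_diff[symmetric] integrable_frac_int assms cont)
      also have "\<dots> = (LINT s|lborel. S (n + N) * (frac_kernel a s * q n (t - s)))"
        using S(1) by (intro Bochner_Integration.integral_cong) (auto simp: q_def field_simps)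
      finally show ?thesis using S(1)[of "n + N"] by simp
    qed
    ultimately have "(\<lambda>n. (frac_int a f (t + S (n + N)) - frac_int a f t) / S (n + N)) \<longlonglongrightarrow> frac_int a f' t"
      by simp
    then show "(\<lambda>n. (frac_int a f (t + S n) - frac_int a f t) / S n) \<longlonglongrightarrow> frac_int a f' t"
      by (rule LIMSEQ_offset)
  qed
qed

text \<open>The semigroup law at the level of kernels: the substitution u = w t turns the
  convolution into Euler's Beta integral. Integrability is part of the claim because Fubini's
  theorem will ask for it.\<close>

lemma frac_kernel_Beta:
  assumes "0 < a" "0 < b"
  shows "has_bochner_integral lborel (\<lambda>u. frac_kernel a u * frac_kernel b (w - u)) (frac_kernel (a + b) w)"
proof (cases "0 < w")
  case False
  then have "(\<lambda>u. frac_kernel a u * frac_kernel b (w - u)) = (\<lambda>u. 0)"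
    by (auto simp: frac_kernel_def)
  with False show ?thesis
    by (simp add: frac_kernel_def[of _ w] has_bochner_integral_iff)
next
  case True
  define C where "C = w powr (a + b - 1) / (Gamma a * Gamma b)"
  have G: "0 < Gamma a" "0 < Gamma b" "0 < Gamma (a + b)"
    using assms by (auto intro!: Gamma_real_pos)
  have "has_bochner_integral lborel (\<lambda>t. indicator {0..1} t *\<^sub>R (t powr (a - 1) * (1 - t) powr (b - 1))) (Beta a b)"
    using integrable_Beta[OF assms] has_integral_Beta_real[OF assms]
      set_borel_integral_eq_integral(2)[OF integrable_Beta[OF assms]]
    by (simp add: has_bochner_integral_iff set_integrable_def set_lebesgue_integral_def has_integral_iff)
  then have CB: "has_bochner_integral lborel (\<lambda>t. C * (indicator {0..1} t * (t powr (a - 1) * (1 - t) powr (b - 1)))) (C * Beta a b)"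
    by (intro has_bochner_integral_mult_right) simp
  have "w * (frac_kernel a (w * t) * frac_kernel b (w - w * t)) = C * (indicator {0..1} t * (t powr (a - 1) * (1 - t) powr (b - 1)))" for t
  proof (cases "0 < t \<and> t < 1")
    case t: True
    have e: "w - w * t = w * (1 - t)" by (simp add: algebra_simps)
    have "w * (w powr (a - 1) * w powr (b - 1)) = w powr (a + b - 1)"
      using True by (simp add: powr_diff powr_add field_simps)
    then show ?thesis
      using t True G unfolding e frac_kernel_scale[OF True] by (simp add: frac_kernel_def C_def field_simps)
  next
    case False
    then have "t \<le> 0 \<or> 1 \<le> t" by auto
    moreover have "0 < w - w * t \<longleftrightarrow> t < 1" "0 < w * t \<longleftrightarrow> 0 < t"
      using True by (auto simp: zero_less_mult_iff)
    ultimately show ?thesis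
      by (auto simp: frac_kernel_def indicator_def)
  qed
  then have eq: "frac_kernel a (0 + w * t) * frac_kernel b (w - (0 + w * t)) =
      1 / w * (C * (indicator {0..1} t * (t powr (a - 1) * (1 - t) powr (b - 1))))" for t
    using True by (simp add: field_simps)
  have "has_bochner_integral lborel (\<lambda>t. frac_kernel a (0 + w * t) * frac_kernel b (w - (0 + w * t))) (1 / w * (C * Beta a b))"
    unfolding eq by (rule has_bochner_integral_mult_right) (rule CB)
  then have "has_bochner_integral lborel (\<lambda>u. frac_kernel a u * frac_kernel b (w - u)) (C * Beta a b)"
    using lborel_has_bochner_integral_real_affine_iff[of w "\<lambda>u. frac_kernel a u * frac_kernel b (w - u)" "C * Beta a b" 0] True
    by (simp add: divide_inverse mult_ac)
  moreover have "C * Beta a b = frac_kernel (a + b) w"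
    using True G by (simp add: C_def Beta_def frac_kernel_def)
  ultimately show ?thesis by simp
qed

text \<open>Fubini's theorem moves the convolution onto the two kernels. They are nonnegative, so
  the absolute integrability it demands is again the Beta computation.\<close>

lemma frac_int_frac_int:
  fixes f :: "real \<Rightarrow> real"
  assumes "0 < a" "0 < b" "continuous_on UNIV f" "causal f"
  shows "frac_int a (frac_int b f) t = frac_int (a + b) f t"
proof -
  have [measurable]: "f \<in> borel_measurable borel"
    using assms(3) by (simp add: borel_measurable_continuous_onI)
  note B = frac_kernel_Beta[OF assms(1,2), unfolded has_bochner_integral_iff]
  have "integrable (lborel \<Otimes>\<^sub>M lborel) (\<lambda>(w, u). f (t - w) * (frac_kernel a u * frac_kernel b (w - u)))"
  proof (rule lborel_pair.Fubini_integrable)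
    have "integrable lborel (\<lambda>w. \<bar>frac_kernel (a + b) w * f (t - w)\<bar>)"
      using assms by (intro integrable_abs integrable_frac_int) auto
    also have "(\<lambda>w. \<bar>frac_kernel (a + b) w * f (t - w)\<bar>) =
        (\<lambda>w. LINT u|lborel. norm (case (w, u) of (w, u) \<Rightarrow> f (t - w) * (frac_kernel a u * frac_kernel b (w - u))))"
      using assms B frac_kernel_nonneg by (simp add: abs_mult mult.commute)
    finally show "integrable lborel \<dots>" .
  qed (use B in auto)
  from lborel_pair.Fubini_integral[OF this]
  have "(LINT u|lborel. LINT w|lborel. f (t - w) * (frac_kernel a u * frac_kernel b (w - u))) =
      (LINT w|lborel. f (t - w) * frac_kernel (a + b) w)"
    using B by simp
  moreover have "(LINT w|lborel. f (t - w) * (frac_kernel a u * frac_kernel b (w - u))) =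
      frac_kernel a u * frac_int b f (t - u)" for u
    unfolding frac_int_def
    by (subst lborel_integral_real_affine[of 1 _ u], simp)
       (subst Bochner_Integration.integral_mult_right_zero[symmetric],
        auto intro!: Bochner_Integration.integral_cong simp: algebra_simps)
  ultimately show ?thesis
    by (simp add: frac_int_def[of a] frac_int_def[of "a + b"] mult.commute)
qed

lemma frac_int_1_deriv:
  fixes f f' :: "real \<Rightarrow> real"
  assumes "causal f" "causal f'" "continuous_on UNIV f'"
    and der: "\<And>t. (f has_real_derivative f' t) (at t)"
  shows "frac_int 1 f' t = f t"
proof (cases "0 < t")
  case False
  then show ?thesis using assms causal_frac_int[OF assms(2), of 1] by (auto simp: causal_def)
next
  case True
  have "(LINT s|lborel. f' s * indicator {0..t} s) = f t - f 0"
    by (rule integral_FTC_Icc_real)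
       (use True der assms(3) in \<open>auto intro: has_field_derivative_at_within simp: continuous_on_eq_continuous_at\<close>)
  moreover have "frac_int 1 f' t = (LINT s|lborel. frac_kernel 1 (t - s) * f' s)"
    unfolding frac_int_def by (subst lborel_integral_real_affine[of "- 1" _ t]) (auto simp: algebra_simps)
  moreover have "(LINT s|lborel. frac_kernel 1 (t - s) * f' s) = (LINT s|lborel. f' s * indicator {0..t} s)"
  proof (rule integral_cong_AE)
    have [measurable]: "f' \<in> borel_measurable borel"
      using assms(3) by (simp add: borel_measurable_continuous_onI)
    show "(\<lambda>s. frac_kernel 1 (t - s) * f' s) \<in> borel_measurable lborel"
      "(\<lambda>s. f' s * indicator {0..t} s) \<in> borel_measurable lborel" by auto
    \<comment> \<open>The kernel of order 1 is the indicator of the open half line, so the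
      integrands disagree at most at s = t.\<close>
    show "AE s in lborel. frac_kernel 1 (t - s) * f' s = f' s * indicator {0..t} s"
      using AE_lborel_singleton[of t]
      by eventually_elim (use assms(2) in \<open>auto simp: frac_kernel_def indicator_def causal_def\<close>)
  qed
  ultimately show ?thesis using assms(1) by (simp add: causal_def)
qed

text \<open>D^\<alpha> x = I^(1-\<alpha>) x' = I^(1-\<alpha>) I^\<alpha> f' = I^1 f' = f. Only the
  derivative of \<open>x\<close> on s >= 0 is prescribed, which leaves room for a nonzero
  history.\<close>

lemma caputo_frac_int:
  fixes f f' x :: "real \<Rightarrow> real"
  assumes \<alpha>: "0 < \<alpha>" "\<alpha> \<le> 1"
    and f: "causal f" "causal f'" "continuous_on UNIV f'" "\<And>t. (f has_real_derivative f' t) (at t)"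
    and x: "\<And>s. 0 \<le> s \<Longrightarrow> (x has_real_derivative frac_int \<alpha> f' s) (at s)"
    and t: "0 < t"
  shows "caputo_exists \<alpha> x t \<and> caputo_deriv \<alpha> x t = f t"
proof -
  define h where "h = frac_int \<alpha> f'"
  have deriv: "deriv x s = h s" if "0 \<le> s" for s
    using x[OF that] unfolding h_def by (rule DERIV_imp_deriv)
  have diff: "\<forall>s\<in>{0<..t}. x differentiable (at s)"
    using x unfolding real_differentiable_def by (meson greaterThanAtMost_iff less_imp_le)
  show ?thesis
  proof (cases "\<alpha> = 1")
    case True
    then show ?thesis
      using diff deriv[of t] t frac_int_1_deriv[OF f(1,2,3,4), of t]
      by (simp add: caputo_exists_def caputo_deriv_def h_def)
  next
    case False
    with \<alpha> have \<beta>: "0 < 1 - \<alpha>" by simp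
    have G: "0 < Gamma (1 - \<alpha>)" using \<beta> by (rule Gamma_real_pos)
    have h: "causal h" "continuous_on UNIV h"
      unfolding h_def by (rule causal_frac_int[OF f(2)], rule continuous_frac_int[OF \<alpha>(1) f(3,2)])
    define q where "q s = (t - s) powr (- \<alpha>) * deriv x s" for s
    \<comment> \<open>The convention that \<open>0 powr y\<close> is 0 makes both sides vanish at s
      = t; to the left of 0 the causal factor \<open>h\<close> is zero.\<close>
    have q: "indicator {0..t} s *\<^sub>R q s = Gamma (1 - \<alpha>) * (frac_kernel (1 - \<alpha>) (t - s) * h s)" for s
      using G h(1) deriv[of s] t
      by (auto simp: indicator_def q_def frac_kernel_def causal_def)
    have "integrable lborel (\<lambda>u. frac_kernel (1 - \<alpha>) u * h (t - u))"
      by (rule integrable_frac_int[OF \<beta> h(2,1)])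
    from lborel_integrable_real_affine[OF this, of "- 1" t]
    have "integrable lborel (\<lambda>s. indicator {0..t} s *\<^sub>R q s)"
      unfolding q by (intro integrable_mult_right) simp
    then have int: "set_integrable lborel {0..t} q"
      by (simp add: set_integrable_def)
    then have abs: "q absolutely_integrable_on {0..t}"
      unfolding set_integrable_def
      by (subst integrable_completion) (auto dest: borel_measurable_integrable)
    have "integral {0..t} q = (LINT s|lborel. Gamma (1 - \<alpha>) * (frac_kernel (1 - \<alpha>) (t - s) * h s))"
      using set_borel_integral_eq_integral(2)[OF int] unfolding set_lebesgue_integral_def q by simp
    also have "\<dots> = Gamma (1 - \<alpha>) * frac_int (1 - \<alpha>) h t"
      unfolding integral_mult_right_zero frac_int_def
      by (subst lborel_integral_real_affine[of "- 1" _ t]) auto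
    also have "frac_int (1 - \<alpha>) h t = f t"
      using frac_int_frac_int[OF \<beta> \<alpha>(1) f(3,2), of t] frac_int_1_deriv[OF f(1,2,3,4), of t]
      by (simp add: h_def)
    finally show ?thesis
      using False diff abs G
      by (simp add: caputo_exists_def caputo_deriv_def q_def[abs_def])
  qed
qed

section \<open>Existence of continuously differentiable solutions\<close>

text \<open>The problem after subtraction of the history: zero initial data, total second delay
  \<sigma>, the history hidden in \<open>p\<close>. The global bound \<open>K\<close> is what
  truncation of the nonlinearity provides, and requiring \<open>p'\<close> to be causal and
  continuous makes solutions continuously differentiable across t = 0.\<close>

locale delay_problem =
  fixes \<alpha> \<gamma> c \<tau> \<sigma> K P :: real and G G' p p' :: "real \<Rightarrow> real"
  assumes alpha_pos: "0 < \<alpha>"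
    and delay_nonneg: "0 \<le> \<tau>" "0 \<le> \<sigma>"
    and G_0: "G 0 = 0"
    and G_deriv: "\<And>u. (G has_real_derivative G' u) (at u)"
    and G'_cont: "continuous_on UNIV G'"
    and G'_bound: "\<And>u. \<bar>G' u\<bar> \<le> K"
    and p_causal: "causal p" "causal p'"
    and p_deriv: "\<And>t. (p has_real_derivative p' t) (at t)"
    and p'_cont: "continuous_on UNIV p'"
    and p_bound: "\<And>t. \<bar>p t\<bar> \<le> P" "\<And>t. \<bar>p' t\<bar> \<le> P"
begin

definition rhs :: "(real \<Rightarrow> real) \<Rightarrow> real \<Rightarrow> real" where
  "rhs z t = - \<gamma> * z t + G (z (t - \<tau>)) - c * G (z (t - \<sigma>)) + p t"

text \<open>The derivative of \<open>rhs z\<close> when \<open>y\<close> is the derivative of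
  \<open>z\<close>; the two are kept separate so that iterates and their derivatives can be iterated
  side by side.\<close>

definition rhs' :: "(real \<Rightarrow> real) \<Rightarrow> (real \<Rightarrow> real) \<Rightarrow> real \<Rightarrow> real" where
  "rhs' z y t = - \<gamma> * y t + G' (z (t - \<tau>)) * y (t - \<tau>) - c * (G' (z (t - \<sigma>)) * y (t - \<sigma>)) + p' t"

definition L :: real where "L = \<bar>\<gamma>\<bar> + K + \<bar>c\<bar> * K"

text \<open>The weight for which M^(-\<alpha>) = 1 / (2 L + 1), so that the Lipschitz constant
  \<open>L\<close> of \<open>rhs\<close> becomes a contraction factor of at most 1/2 after the
  fractional integral.\<close>

definition M :: real where "M = (2 * L + 1) powr (1 / \<alpha>)"

lemma K_nonneg: "0 \<le> K" and P_nonneg: "0 \<le> P"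
  using G'_bound[of 0] p_bound(1)[of 0] by linarith+

lemma L_nonneg: "0 \<le> L"
  using K_nonneg by (simp add: L_def)

lemma M_pos: "0 < M" and M_powr: "L * M powr (- \<alpha>) \<le> 1 / 2" "M powr (- \<alpha>) \<le> 1"
proof -
  show "0 < M" using L_nonneg by (simp add: M_def)
  have "M powr (- \<alpha>) = 1 / (2 * L + 1)"
    using L_nonneg alpha_pos by (simp add: M_def powr_powr powr_minus divide_inverse)
  then show "L * M powr (- \<alpha>) \<le> 1 / 2" "M powr (- \<alpha>) \<le> 1"
    using L_nonneg by (simp_all only:) (simp_all add: divide_simps)
qed

lemma G_cont: "continuous_on UNIV G"
  using G_deriv by (rule DERIV_imp_continuous_on_UNIV)

lemma p_cont: "continuous_on UNIV p"
  using p_deriv by (rule DERIV_imp_continuous_on_UNIV)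

lemma G_Lipschitz: "\<bar>G u - G v\<bar> \<le> K * \<bar>u - v\<bar>"
  using field_differentiable_bound[of UNIV G G' K u v] G_deriv G'_bound by auto

lemma causal_rhs: "causal z \<Longrightarrow> causal (rhs z)"
  using delay_nonneg G_0 p_causal by (simp add: causal_def rhs_def)

lemma causal_rhs': "causal y \<Longrightarrow> causal (rhs' z y)"
  using delay_nonneg p_causal by (simp add: causal_def rhs'_def)

lemma continuous_shift: "continuous_on UNIV z \<Longrightarrow> continuous_on UNIV (\<lambda>t::real. z (t - r) :: real)"
  by (rule continuous_on_compose2[of UNIV z]) (auto intro!: continuous_intros)

lemma continuous_rhs:
  assumes "continuous_on UNIV z"
  shows "continuous_on UNIV (rhs z)"
  unfolding rhs_def
  by (intro continuous_on_add continuous_on_diff continuous_on_mult continuous_on_const assms p_cont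
      continuous_on_compose2[OF G_cont continuous_shift] subset_UNIV)

lemma continuous_rhs':
  assumes "continuous_on UNIV z" "continuous_on UNIV y"
  shows "continuous_on UNIV (rhs' z y)"
  unfolding rhs'_def
  by (intro continuous_on_add continuous_on_diff continuous_on_mult continuous_on_const assms p'_cont
      continuous_on_compose2[OF G'_cont continuous_shift] continuous_shift subset_UNIV)

lemma deriv_rhs:
  assumes "\<And>t. (z has_real_derivative y t) (at t)"
  shows "(rhs z has_real_derivative rhs' z y t) (at t)"
proof -
  have "((\<lambda>t. z (t - r)) has_real_derivative y (t - r)) (at t)" for r
    using DERIV_shift[of z "y (t - r)" t "- r"] assms[of "t - r"] by simp
  from DERIV_chain2[OF G_deriv this] show ?thesis
    unfolding rhs_def rhs'_def
    by (intro DERIV_add DERIV_diff DERIV_cmult assms p_deriv)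
qed

section \<open>Bounds for the right-hand side in the exponentially weighted norm\<close>

lemma exp_delay: "0 \<le> A \<Longrightarrow> 0 \<le> r \<Longrightarrow> A * exp (M * (t - r)) \<le> A * exp (M * t)"
  using M_pos by (intro mult_left_mono) (auto intro!: mult_left_mono)

lemma weighted_delay:
  assumes "\<And>t. t \<le> T \<Longrightarrow> \<bar>f t\<bar> \<le> A * exp (M * t)" "t \<le> T" "0 \<le> r"
  shows "\<bar>f (t - r)\<bar> \<le> A * exp (M * t)"
proof -
  have "0 \<le> A" using order_trans[OF abs_ge_zero assms(1)[OF assms(2)]] by (simp add: zero_le_mult_iff)
  then show ?thesis
    using assms(1)[of "t - r"] exp_delay[of A r t] assms(2,3) by linarith
qed

lemma forcing_weighted:
  assumes "causal f" "\<And>t. \<bar>f t\<bar> \<le> P"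
  shows "\<bar>f t\<bar> \<le> P * exp (M * t)"
proof (cases "t \<le> 0")
  case True
  then show ?thesis using assms(1) P_nonneg by (simp add: causal_def)
next
  case False
  then have "P * 1 \<le> P * exp (M * t)"
    using P_nonneg M_pos by (intro mult_left_mono) auto
  then show ?thesis using assms(2)[of t] by linarith
qed

lemma rhs_diff_bound:
  assumes "\<And>t. t \<le> T \<Longrightarrow> \<bar>z t - w t\<bar> \<le> A * exp (M * t)" "t \<le> T"
  shows "\<bar>rhs z t - rhs w t\<bar> \<le> L * A * exp (M * t)"
proof -
  have G: "\<bar>G (z (t - r)) - G (w (t - r))\<bar> \<le> K * (A * exp (M * t))" if "0 \<le> r" for r
    using G_Lipschitz[of "z (t - r)" "w (t - r)"] weighted_delay[of T "\<lambda>t. z t - w t", OF assms that] K_nonneg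
    by (meson mult_left_mono order_trans)
  have "rhs z t - rhs w t = - \<gamma> * (z t - w t) + (G (z (t - \<tau>)) - G (w (t - \<tau>)))
      - c * (G (z (t - \<sigma>)) - G (w (t - \<sigma>)))"
    by (simp add: rhs_def algebra_simps)
  also have "\<bar>\<dots>\<bar> \<le> \<bar>\<gamma>\<bar> * (A * exp (M * t)) + K * (A * exp (M * t)) + \<bar>c\<bar> * (K * (A * exp (M * t)))"
    using mult_left_mono[OF assms(1)[OF assms(2)] abs_ge_zero[of \<gamma>]]
      mult_left_mono[OF G[OF delay_nonneg(2)] abs_ge_zero[of c]] G[OF delay_nonneg(1)]
    unfolding abs_mult[symmetric] by (simp add: abs_le_iff algebra_simps)
  finally show ?thesis by (simp add: L_def algebra_simps)
qed

lemma rhs_bound: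
  assumes "\<And>t. t \<le> T \<Longrightarrow> \<bar>z t\<bar> \<le> A * exp (M * t)" "t \<le> T"
  shows "\<bar>rhs z t\<bar> \<le> (L * A + P) * exp (M * t)"
proof -
  have "rhs (\<lambda>t. 0) t = p t" by (simp add: rhs_def G_0)
  then show ?thesis
    using rhs_diff_bound[of T z "\<lambda>t. 0" A, OF _ assms(2)] assms(1) forcing_weighted[OF p_causal(1) p_bound(1), of t]
    by (simp add: algebra_simps)
qed

lemma rhs'_bound:
  assumes "\<And>t. t \<le> T \<Longrightarrow> \<bar>y t\<bar> \<le> A * exp (M * t)" "t \<le> T"
  shows "\<bar>rhs' z y t\<bar> \<le> (L * A + P) * exp (M * t)"
proof -
  have G: "\<bar>G' (z (t - r)) * y (t - r)\<bar> \<le> K * (A * exp (M * t))" if "0 \<le> r" for r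
    unfolding abs_mult
    using weighted_delay[of T y, OF assms that] K_nonneg by (intro mult_mono G'_bound) auto
  have "\<bar>rhs' z y t\<bar> \<le> \<bar>\<gamma>\<bar> * (A * exp (M * t)) + K * (A * exp (M * t)) + \<bar>c\<bar> * (K * (A * exp (M * t)))
      + P * exp (M * t)"
    using mult_left_mono[OF assms(1)[OF assms(2)] abs_ge_zero[of \<gamma>]]
      mult_left_mono[OF G[OF delay_nonneg(2)] abs_ge_zero[of c]] G[OF delay_nonneg(1)]
      forcing_weighted[OF p_causal(2) p_bound(2), of t]
    unfolding abs_mult[symmetric] rhs'_def by (simp add: abs_le_iff algebra_simps)
  then show ?thesis by (simp add: L_def algebra_simps)
qed

text \<open>\<open>G'\<close> is only continuous, so its increments are not controlled by a multiple
  of |z - w|; they enter through the separate modulus \<zeta>, multiplied by the bound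
  \<open>B\<close> on the derivative.\<close>

lemma rhs'_diff_bound:
  assumes "\<And>t. t \<le> T \<Longrightarrow> \<bar>y t - x t\<bar> \<le> A * exp (M * t)" "\<And>t. t \<le> T \<Longrightarrow> \<bar>x t\<bar> \<le> B * exp (M * t)"
    "\<And>t. t \<le> T \<Longrightarrow> \<bar>G' (z t) - G' (w t)\<bar> \<le> \<zeta>" "t \<le> T"
  shows "\<bar>rhs' z y t - rhs' w x t\<bar> \<le> (L * A + (1 + \<bar>c\<bar>) * (\<zeta> * B)) * exp (M * t)"
proof -
  have 1: "\<bar>G' (z (t - r)) * (y (t - r) - x (t - r))\<bar> \<le> K * (A * exp (M * t))" if "0 \<le> r" for r
    unfolding abs_mult
    using weighted_delay[of T "\<lambda>t. y t - x t", OF assms(1,4) that] K_nonneg by (intro mult_mono G'_bound) auto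
  have 2: "\<bar>(G' (z (t - r)) - G' (w (t - r))) * x (t - r)\<bar> \<le> \<zeta> * (B * exp (M * t))" if "0 \<le> r" for r
    unfolding abs_mult
    using weighted_delay[of T x, OF assms(2,4) that] that assms(4) order_trans[OF abs_ge_zero assms(3)[OF assms(4)]]
    by (intro mult_mono assms(3)) auto
  have G: "\<bar>G' (z (t - r)) * y (t - r) - G' (w (t - r)) * x (t - r)\<bar>
      \<le> K * (A * exp (M * t)) + \<zeta> * (B * exp (M * t))" if "0 \<le> r" for r
    using 1[OF that] 2[OF that] by (simp add: algebra_simps abs_le_iff)
  have "rhs' z y t - rhs' w x t = - \<gamma> * (y t - x t) + (G' (z (t - \<tau>)) * y (t - \<tau>) - G' (w (t - \<tau>)) * x (t - \<tau>))
      - c * (G' (z (t - \<sigma>)) * y (t - \<sigma>) - G' (w (t - \<sigma>)) * x (t - \<sigma>))"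
    by (simp add: rhs'_def algebra_simps)
  also have "\<bar>\<dots>\<bar> \<le> \<bar>\<gamma>\<bar> * (A * exp (M * t)) + (K * (A * exp (M * t)) + \<zeta> * (B * exp (M * t)))
      + \<bar>c\<bar> * (K * (A * exp (M * t)) + \<zeta> * (B * exp (M * t)))"
    using mult_left_mono[OF assms(1)[OF assms(4)] abs_ge_zero[of \<gamma>]]
      mult_left_mono[OF G[OF delay_nonneg(2)] abs_ge_zero[of c]] G[OF delay_nonneg(1)]
    unfolding abs_mult[symmetric] by (simp only: abs_le_iff) linarith
  finally show ?thesis by (simp add: L_def algebra_simps)
qed

section \<open>Picard iteration for the solution and its derivative\<close>

primrec picard :: "nat \<Rightarrow> real \<Rightarrow> real" where
  "picard 0 = (\<lambda>t. 0)"
| "picard (Suc n) = frac_int \<alpha> (rhs (picard n))"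

primrec picard' :: "nat \<Rightarrow> real \<Rightarrow> real" where
  "picard' 0 = (\<lambda>t. 0)"
| "picard' (Suc n) = frac_int \<alpha> (rhs' (picard n) (picard' n))"

lemma picard_regular:
  "causal (picard n) \<and> causal (picard' n) \<and> continuous_on UNIV (picard' n) \<and>
   (\<forall>t. (picard n has_real_derivative picard' n t) (at t))"
proof (induction n)
  case 0
  then show ?case by (simp add: causal_def)
next
  case (Suc n)
  then have "continuous_on UNIV (picard n)"
    by (intro DERIV_imp_continuous_on_UNIV) blast
  with Suc show ?case
    by (simp add: causal_frac_int causal_rhs causal_rhs' continuous_frac_int continuous_rhs' alpha_pos
        frac_int_deriv deriv_rhs)
qed

lemma picard_causal: "causal (picard n)" "causal (picard' n)"
  and picard_deriv: "(picard n has_real_derivative picard' n t) (at t)"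
  using picard_regular[of n] by blast+

lemma picard_cont: "continuous_on UNIV (picard n)" "continuous_on UNIV (picard' n)"
  using picard_regular[of n] DERIV_imp_continuous_on_UNIV[OF picard_deriv] by blast+

text \<open>The feedback part is halved and the forcing part does not grow, so a weighted bound A
  passes to A / 2 + B. The bound 2 P used for all iterates is the fixed point of this map for B =
  P.\<close>

lemma frac_int_weighted:
  assumes "continuous_on UNIV f" "causal f" "\<And>t. t \<le> T \<Longrightarrow> \<bar>f t\<bar> \<le> (L * A + B) * exp (M * t)" "t \<le> T" "0 \<le> B"  "0 \<le> A"
  shows "\<bar>frac_int \<alpha> f t\<bar> \<le> (A / 2 + B) * exp (M * t)"
proof -
  have "(L * A + B) * M powr (- \<alpha>) = (L * M powr (- \<alpha>)) * A + B * M powr (- \<alpha>)"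
    by (simp add: algebra_simps)
  also have "\<dots> \<le> 1 / 2 * A + B * 1"
    using M_powr assms(5,6) by (intro add_mono mult_right_mono mult_left_mono)
  finally have "(L * A + B) * M powr (- \<alpha>) * exp (M * t) \<le> (A / 2 + B) * exp (M * t)"
    by (intro mult_right_mono) auto
  moreover have "\<bar>frac_int \<alpha> f t\<bar> \<le> (L * A + B) * M powr (- \<alpha>) * exp (M * t)"
    by (rule frac_int_bound[OF alpha_pos M_pos assms(1-4)])
  ultimately show ?thesis by linarith
qed

lemma picard_bound: "\<bar>picard n t\<bar> \<le> 2 * P * exp (M * t)"
proof (induction n arbitrary: t)
  case (Suc n)
  have "\<bar>frac_int \<alpha> (rhs (picard n)) t\<bar> \<le> (2 * P / 2 + P) * exp (M * t)"
    by (rule frac_int_weighted[of _ t])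
       (use P_nonneg Suc in \<open>auto intro!: continuous_rhs causal_rhs picard_causal picard_cont rhs_bound\<close>)
  then show ?case by simp
qed (simp add: P_nonneg)

lemma picard'_bound: "\<bar>picard' n t\<bar> \<le> 2 * P * exp (M * t)"
proof (induction n arbitrary: t)
  case (Suc n)
  have "\<bar>frac_int \<alpha> (rhs' (picard n) (picard' n)) t\<bar> \<le> (2 * P / 2 + P) * exp (M * t)"
    by (rule frac_int_weighted[of _ t])
       (use P_nonneg Suc in \<open>auto intro!: continuous_rhs' causal_rhs' picard_causal picard_cont rhs'_bound\<close>)
  then show ?case by simp
qed (simp add: P_nonneg)

lemma frac_int_rhs_diff:
  assumes "continuous_on UNIV z" "causal z" "continuous_on UNIV w" "causal w"
    "\<And>t. \<bar>z t - w t\<bar> \<le> A * exp (M * t)"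
  shows "\<bar>frac_int \<alpha> (rhs z) t - frac_int \<alpha> (rhs w) t\<bar> \<le> A / 2 * exp (M * t)"
proof -
  have A: "0 \<le> A" using order_trans[OF abs_ge_zero assms(5)[of 0]] by simp
  have "\<bar>frac_int \<alpha> (\<lambda>s. rhs z s - rhs w s) t\<bar> \<le> (A / 2 + 0) * exp (M * t)"
  proof (rule frac_int_weighted[of _ t])
    show "continuous_on UNIV (\<lambda>s. rhs z s - rhs w s)"
      by (intro continuous_intros continuous_rhs assms)
    show "causal (\<lambda>s. rhs z s - rhs w s)"
      using causal_rhs[OF assms(2)] causal_rhs[OF assms(4)] by (simp add: causal_def)
  qed (use A assms(5) rhs_diff_bound in auto)
  then show ?thesis
    by (simp add: frac_int_diff alpha_pos continuous_rhs causal_rhs assms)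
qed

lemma picard_Cauchy:
  "N \<le> n \<Longrightarrow> N \<le> m \<Longrightarrow> \<bar>picard n t - picard m t\<bar> \<le> 4 * P * (1 / 2) ^ N * exp (M * t)"
proof (induction N arbitrary: n m t)
  case 0
  show ?case using picard_bound[of n t] picard_bound[of m t] by simp
next
  case (Suc N)
  then obtain n' m' where [simp]: "n = Suc n'" "m = Suc m'"
    by (metis Suc_le_D)
  from Suc show ?case
    using frac_int_rhs_diff[of "picard n'" "picard m'" "4 * P * (1 / 2) ^ N" t]
    by (simp add: picard_cont picard_causal)
qed

text \<open>
  As \<open>G'\<close> is merely continuous, the derivatives of the iterates contract only up to an error, which
  vanishes as the iterates converge; the factor \<open>3 / 4\<close> leaves room for it.
\<close>

lemma picard'_contract:
  assumes "0 < e" "\<And>n m t. N \<le> n \<Longrightarrow> N \<le> m \<Longrightarrow> t \<le> T \<Longrightarrow> \<bar>picard' n t - picard' m t\<bar> \<le> e * exp (M * t)"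
  shows "\<exists>N. \<forall>n\<ge>N. \<forall>m\<ge>N. \<forall>t\<le>T. \<bar>picard' n t - picard' m t\<bar> \<le> 3 / 4 * e * exp (M * t)"
proof -
  \<comment> \<open>\<open>R\<close> encloses all iterates up to time T, which makes
    \<open>G'\<close> uniformly continuous on their range. \<zeta> is tuned so that the error from
    \<open>G'\<close> costs at most e / 4 on top of the contracted e / 2; the summand 1 in
    \<open>D\<close> guards the division.\<close>
  define R where "R = 2 * P * exp (M * T)"
  define D where "D = (1 + \<bar>c\<bar>) * (2 * P) + 1"
  define \<zeta> where "\<zeta> = e / (4 * D)"
  have D: "0 < D"
    using P_nonneg mult_nonneg_nonneg[of "1 + \<bar>c\<bar>" "2 * P"] unfolding D_def by linarith
  have zeta: "0 < \<zeta>" using D assms(1) by (simp add: \<zeta>_def)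
  have "(1 + \<bar>c\<bar>) * (\<zeta> * (2 * P)) = \<zeta> * ((1 + \<bar>c\<bar>) * (2 * P))" by simp
  also have "\<dots> \<le> \<zeta> * D" using zeta by (intro mult_left_mono) (auto simp: D_def)
  also have "\<dots> = e / 4" using D by (simp add: \<zeta>_def)
  finally have zeta_e: "(1 + \<bar>c\<bar>) * (\<zeta> * (2 * P)) \<le> e / 4" .
  have bR: "picard n t \<in> {- R..R}" if "t \<le> T" for n t
  proof -
    have "2 * P * exp (M * t) \<le> R"
      unfolding R_def using that M_pos P_nonneg by (intro mult_left_mono) auto
    then show ?thesis using picard_bound[of n t] by auto
  qed
  have "uniformly_continuous_on {- R..R} G'"
    by (intro compact_uniformly_continuous continuous_on_subset[OF G'_cont]) auto
  then obtain d where d: "0 < d" "\<And>u v. u \<in> {- R..R} \<Longrightarrow> v \<in> {- R..R} \<Longrightarrow> \<bar>u - v\<bar> < d \<Longrightarrow> \<bar>G' u - G' v\<bar> < \<zeta>"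
    using zeta unfolding uniformly_continuous_on_def dist_real_def by metis
  have "(\<lambda>N. 4 * P * (1 / 2) ^ N * exp (M * T)) \<longlonglongrightarrow> 4 * P * 0 * exp (M * T)"
    by (intro tendsto_intros LIMSEQ_power_zero) auto
  then have "eventually (\<lambda>N. 4 * P * (1 / 2) ^ N * exp (M * T) < d) sequentially"
    using d(1) by (intro order_tendstoD(2)[where y = "4 * P * 0 * exp (M * T)"]) auto
  then obtain N' where N': "4 * P * (1 / 2) ^ N' * exp (M * T) < d"
    by (auto simp: eventually_sequentially)
  have G': "\<bar>G' (picard n t) - G' (picard m t)\<bar> \<le> \<zeta>" if "N' \<le> n" "N' \<le> m" "t \<le> T" for n m t
  proof -
    have "4 * P * (1 / 2) ^ N' * exp (M * t) \<le> 4 * P * (1 / 2) ^ N' * exp (M * T)"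
      using that M_pos P_nonneg by (intro mult_left_mono) auto
    then have "\<bar>picard n t - picard m t\<bar> < d"
      using picard_Cauchy[OF that(1,2), of t] N' by linarith
    then show ?thesis
      using d(2)[OF bR[OF that(3)] bR[OF that(3)]] by (simp add: less_imp_le)
  qed
  have step: "\<bar>picard' (Suc n) t - picard' (Suc m) t\<bar> \<le> 3 / 4 * e * exp (M * t)"
    if "max N N' \<le> n" "max N N' \<le> m" "t \<le> T" for n m t
  proof -
    have "\<bar>frac_int \<alpha> (\<lambda>s. rhs' (picard n) (picard' n) s - rhs' (picard m) (picard' m) s) t\<bar> \<le> (e / 2 + e / 4) * exp (M * t)"
    proof (rule frac_int_weighted[of _ T])
      show "continuous_on UNIV (\<lambda>s. rhs' (picard n) (picard' n) s - rhs' (picard m) (picard' m) s)"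
        by (intro continuous_intros continuous_rhs' picard_cont)
      show "causal (\<lambda>s. rhs' (picard n) (picard' n) s - rhs' (picard m) (picard' m) s)"
        using causal_rhs'[OF picard_causal(2)] by (simp add: causal_def)
      fix s assume s: "s \<le> T"
      have "\<bar>rhs' (picard n) (picard' n) s - rhs' (picard m) (picard' m) s\<bar>
          \<le> (L * e + (1 + \<bar>c\<bar>) * (\<zeta> * (2 * P))) * exp (M * s)"
        by (rule rhs'_diff_bound[OF _ _ _ s]) (use that assms(2) picard'_bound G' in auto)
      also have "\<dots> \<le> (L * e + e / 4) * exp (M * s)"
        using zeta_e by (intro mult_right_mono) auto
      finally show "\<bar>rhs' (picard n) (picard' n) s - rhs' (picard m) (picard' m) s\<bar> \<le> (L * e + e / 4) * exp (M * s)" .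
    qed (use assms that in auto)
    then show ?thesis
      by (simp add: frac_int_diff alpha_pos continuous_rhs' causal_rhs' picard_cont picard_causal)
  qed
  have "\<bar>picard' n t - picard' m t\<bar> \<le> 3 / 4 * e * exp (M * t)"
    if "Suc (max N N') \<le> n" "Suc (max N N') \<le> m" "t \<le> T" for n m t
    using step[of "n - 1" "m - 1" t] that by (cases n; cases m) auto
  then show ?thesis by blast
qed

lemma picard'_Cauchy:
  assumes "0 < e"
  shows "\<exists>N. \<forall>n\<ge>N. \<forall>m\<ge>N. \<forall>t\<le>T. \<bar>picard' n t - picard' m t\<bar> \<le> e"
proof -
  \<comment> \<open>The sum of two bounds 2 P, enlarged by 1 so that it is positive and the
    contraction step applies even if \<open>P\<close> is 0.\<close>
  define E where "E = 4 * P + 1"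
  have E: "0 < E" using P_nonneg by (simp add: E_def)
  have *: "\<exists>N. \<forall>n\<ge>N. \<forall>m\<ge>N. \<forall>t\<le>T. \<bar>picard' n t - picard' m t\<bar> \<le> E * (3 / 4) ^ j * exp (M * t)" for j
  proof (induction j)
    case 0
    have "\<bar>picard' n t - picard' m t\<bar> \<le> E * exp (M * t)" for n m t
    proof -
      have "E * exp (M * t) = 2 * P * exp (M * t) + 2 * P * exp (M * t) + exp (M * t)"
        by (simp add: E_def algebra_simps)
      then show ?thesis
        using picard'_bound[of n t] picard'_bound[of m t] exp_ge_zero[of "M * t"] by linarith
    qed
    then show ?case by simp
  next
    case (Suc j)
    then obtain N where "\<forall>n\<ge>N. \<forall>m\<ge>N. \<forall>t\<le>T. \<bar>picard' n t - picard' m t\<bar> \<le> E * (3 / 4) ^ j * exp (M * t)" ..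
    with picard'_contract[of "E * (3 / 4) ^ j" N T] E show ?case by (simp add: mult_ac)
  qed
  have "(\<lambda>j. E * (3 / 4) ^ j * exp (M * T)) \<longlonglongrightarrow> E * 0 * exp (M * T)"
    by (intro tendsto_intros LIMSEQ_power_zero) auto
  then have "eventually (\<lambda>j. E * (3 / 4) ^ j * exp (M * T) < e) sequentially"
    using assms by (intro order_tendstoD(2)[where y = "E * 0 * exp (M * T)"]) auto
  then obtain j where j: "E * (3 / 4) ^ j * exp (M * T) < e"
    by (auto simp: eventually_sequentially)
  obtain N where N: "\<forall>n\<ge>N. \<forall>m\<ge>N. \<forall>t\<le>T. \<bar>picard' n t - picard' m t\<bar> \<le> E * (3 / 4) ^ j * exp (M * t)"
    using * by blast
  have "E * (3 / 4) ^ j * exp (M * t) \<le> e" if "t \<le> T" for t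
  proof -
    have "E * (3 / 4) ^ j * exp (M * t) \<le> E * (3 / 4) ^ j * exp (M * T)"
      using that M_pos E by (intro mult_left_mono) auto
    with j show ?thesis by linarith
  qed
  with N show ?thesis by (meson order_trans)
qed

text \<open>The derivatives of the iterates converge uniformly on each half line up to T, and
  continuity and differentiability are local, so this suffices for the limit to be continuously
  differentiable. The contraction estimate carries the fixed-point equation to the limit.\<close>

theorem exists_solution:
  obtains z z' where "causal z" "causal z'" "continuous_on UNIV z'"
    "\<And>t. (z has_real_derivative z' t) (at t)" "z = frac_int \<alpha> (rhs z)"
proof -
  define z where "z t = lim (\<lambda>n. picard n t)" for t
  define z' where "z' t = lim (\<lambda>n. picard' n t)" for t
  have half: "(\<lambda>N. 4 * P * (1 / 2) ^ N * E) \<longlonglongrightarrow> 0" for E :: real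
    using tendsto_mult[OF tendsto_mult[OF tendsto_const[of "4 * P"] LIMSEQ_power_zero[of "1 / 2 :: real"]] tendsto_const[of E]]
    by simp
  have z: "(\<lambda>n. picard n t) \<longlonglongrightarrow> z t" for t
  proof -
    have "Cauchy (\<lambda>n. picard n t)"
    proof (rule metric_CauchyI)
      fix e :: real assume "0 < e"
      then have "eventually (\<lambda>N. 4 * P * (1 / 2) ^ N * exp (M * t) < e) sequentially"
        by (intro order_tendstoD(2)[OF half])
      then obtain N where "4 * P * (1 / 2) ^ N * exp (M * t) < e" by (auto simp: eventually_sequentially)
      then show "\<exists>N. \<forall>m\<ge>N. \<forall>n\<ge>N. dist (picard m t) (picard n t) < e"
        using picard_Cauchy[of N _ _ t] unfolding dist_real_def by (meson le_less_trans)
    qed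
    then show ?thesis unfolding z_def by (simp add: Cauchy_convergent_iff convergent_LIMSEQ_iff)
  qed
  have z': "(\<lambda>n. picard' n t) \<longlonglongrightarrow> z' t" for t
  proof -
    have "Cauchy (\<lambda>n. picard' n t)"
    proof (rule metric_CauchyI)
      fix e :: real assume "0 < e"
      then obtain N where "\<forall>n\<ge>N. \<forall>m\<ge>N. \<forall>s\<le>t. \<bar>picard' n s - picard' m s\<bar> \<le> e / 2"
        using picard'_Cauchy[of "e / 2" t] by auto
      moreover have "e / 2 < e" using \<open>0 < e\<close> by simp
      ultimately have "dist (picard' m t) (picard' n t) < e" if "N \<le> m" "N \<le> n" for m n
        using that unfolding dist_real_def by (meson le_less_trans order_refl)
      then show "\<exists>N. \<forall>m\<ge>N. \<forall>n\<ge>N. dist (picard' m t) (picard' n t) < e" by blast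
    qed
    then show ?thesis unfolding z'_def by (simp add: Cauchy_convergent_iff convergent_LIMSEQ_iff)
  qed
  have zdist: "\<bar>picard n t - z t\<bar> \<le> 4 * P * (1 / 2) ^ n * exp (M * t)" for n t
  proof (rule tendsto_upperbound)
    show "(\<lambda>m. \<bar>picard n t - picard m t\<bar>) \<longlonglongrightarrow> \<bar>picard n t - z t\<bar>"
      by (intro tendsto_intros z)
    show "eventually (\<lambda>m. \<bar>picard n t - picard m t\<bar> \<le> 4 * P * (1 / 2) ^ n * exp (M * t)) sequentially"
      using eventually_ge_at_top[of n] by eventually_elim (intro picard_Cauchy order_refl)
  qed simp
  have unif: "\<exists>N. \<forall>n\<ge>N. \<forall>t\<le>T. \<bar>picard' n t - z' t\<bar> \<le> e" if e: "0 < e" for e T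
  proof -
    obtain N where N: "\<forall>n\<ge>N. \<forall>m\<ge>N. \<forall>s\<le>T. \<bar>picard' n s - picard' m s\<bar> \<le> e"
      using picard'_Cauchy[OF e, of T] by blast
    have "\<bar>picard' n t - z' t\<bar> \<le> e" if "N \<le> n" "t \<le> T" for n t
    proof (rule tendsto_upperbound)
      show "(\<lambda>m. \<bar>picard' n t - picard' m t\<bar>) \<longlonglongrightarrow> \<bar>picard' n t - z' t\<bar>"
        by (intro tendsto_intros z')
      show "eventually (\<lambda>m. \<bar>picard' n t - picard' m t\<bar> \<le> e) sequentially"
        using eventually_ge_at_top[of N] by eventually_elim (use N that in auto)
    qed simp
    then show ?thesis by blast
  qed
  have causal: "causal z" "causal z'"
    using picard_causal by (auto simp: causal_def z_def z'_def lim_const)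
  have z'_cont: "continuous_on UNIV z'"
  proof -
    have "continuous_on {..<T} z'" for T
    proof (rule uniform_limit_theorem)
      show "uniform_limit {..<T} picard' z' sequentially"
      proof (rule uniform_limitI)
        fix e :: real assume "0 < e"
        then obtain N where "\<forall>n\<ge>N. \<forall>t\<le>T. \<bar>picard' n t - z' t\<bar> \<le> e / 2"
          using unif[of "e / 2" T] by auto
        moreover have "e / 2 < e" using \<open>0 < e\<close> by simp
        ultimately have "\<forall>x\<in>{..<T}. dist (picard' n x) (z' x) < e" if "N \<le> n" for n
          using that unfolding dist_real_def by (meson le_less_trans lessThan_iff less_imp_le)
        then show "\<forall>\<^sub>F n in sequentially. \<forall>x\<in>{..<T}. dist (picard' n x) (z' x) < e"
          unfolding eventually_sequentially by blast
      qed
    qed (auto intro!: always_eventually continuous_on_subset[OF picard_cont(2)])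
    then have "isCont z' t" for t
      by (meson continuous_on_eq_continuous_at less_add_one lessThan_iff open_lessThan)
    then show ?thesis by (simp add: continuous_on_eq_continuous_at)
  qed
  have z_deriv: "(z has_real_derivative z' t) (at t)" for t
  proof -
    have "\<exists>g. \<forall>x\<in>{..<t + 1}. (\<lambda>n. picard n x) \<longlonglongrightarrow> g x \<and> (g has_derivative (\<lambda>h. z' x * h)) (at x within {..<t + 1})"
    proof (rule has_derivative_sequence[where f' = "\<lambda>n x h. picard' n x * h" and ?x0.0 = t])
      fix n x assume "x \<in> {..<t + 1}"
      then show "(picard n has_derivative (*) (picard' n x)) (at x within {..<t + 1})"
        using picard_deriv[of n x] has_derivative_at_withinI unfolding has_field_derivative_def by blast
    next
      fix e :: real assume "0 < e"
      then obtain N where "\<forall>n\<ge>N. \<forall>s\<le>t + 1. \<bar>picard' n s - z' s\<bar> \<le> e" using unif by blast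
      then show "\<forall>\<^sub>F n in sequentially. \<forall>x\<in>{..<t + 1}. \<forall>h. norm (picard' n x * h - z' x * h) \<le> e * norm h"
        unfolding eventually_sequentially
        by (auto simp: left_diff_distrib[symmetric] abs_mult intro!: mult_right_mono exI[of _ N])
    qed (use z in auto)
    \<comment> \<open>The theorem on differentiating sequences supplies its own limit function; by
      uniqueness of limits it coincides with \<open>z\<close> near t.\<close>
    then obtain g where g: "\<And>x. x \<in> {..<t + 1} \<Longrightarrow> (\<lambda>n. picard n x) \<longlonglongrightarrow> g x"
      "\<And>x. x \<in> {..<t + 1} \<Longrightarrow> (g has_derivative (\<lambda>h. z' x * h)) (at x within {..<t + 1})" by blast
    have g_t: "(g has_derivative (\<lambda>h. z' t * h)) (at t)"
      using g(2)[of t] at_within_open[of t "{..<t + 1}"] by simp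
    have "g x = z x" if "x \<in> {..<t + 1}" for x
      using LIMSEQ_unique g(1)[OF that] z by blast
    from has_derivative_transform_within_open[OF g_t open_lessThan[of "t + 1"] _ this] show ?thesis
      unfolding has_field_derivative_def by simp
  qed
  have z_cont: "continuous_on UNIV z"
    using z_deriv by (rule DERIV_imp_continuous_on_UNIV)
  have "z t = frac_int \<alpha> (rhs z) t" for t
  proof (rule LIMSEQ_unique)
    show "(\<lambda>n. picard (Suc n) t) \<longlonglongrightarrow> z t" using z by (rule LIMSEQ_Suc)
    have "(\<lambda>n. picard (Suc n) t - frac_int \<alpha> (rhs z) t) \<longlonglongrightarrow> 0"
    proof (rule tendsto_0_le[OF half[of "exp (M * t)"], where K = 1], intro always_eventually allI)
      fix n
      have "\<bar>frac_int \<alpha> (rhs (picard n)) t - frac_int \<alpha> (rhs z) t\<bar> \<le> 4 * P * (1 / 2) ^ n / 2 * exp (M * t)"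
        by (rule frac_int_rhs_diff) (use picard_cont picard_causal causal z_cont zdist in auto)
      also have "\<dots> \<le> 4 * P * (1 / 2) ^ n * exp (M * t)"
        using P_nonneg by (intro mult_right_mono) auto
      finally show "norm (picard (Suc n) t - frac_int \<alpha> (rhs z) t) \<le> norm (4 * P * (1 / 2) ^ n * exp (M * t)) * 1"
        using P_nonneg by (simp add: abs_mult)
    qed
    then show "(\<lambda>n. picard (Suc n) t) \<longlonglongrightarrow> frac_int \<alpha> (rhs z) t"
      by (simp add: LIM_zero_iff)
  qed
  then have "z = frac_int \<alpha> (rhs z)" by auto
  from that[OF causal z'_cont z_deriv this] show ?thesis .
qed

end

section \<open>Truncation of the nonlinearity and a bump for the history\<close>

lemma truncated_nonlinearity:
  fixes g D :: "real \<Rightarrow> real"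
  assumes g: "g 0 = 0" "\<And>u. (g has_real_derivative D u) (at u)" and D: "continuous_on UNIV D" and e: "0 < e"
  obtains \<rho> G G' where "0 < \<rho>" "G 0 = 0" "\<And>u. (G has_real_derivative G' u) (at u)" "continuous_on UNIV G'"
    "\<And>u. \<bar>G' u - D 0\<bar> \<le> e" "\<And>u. \<bar>u\<bar> \<le> \<rho> \<Longrightarrow> G u = g u"
proof -
  have "isCont D 0" using D by (simp add: continuous_on_eq_continuous_at)
  then obtain d where d: "0 < d" "\<And>u. \<bar>u\<bar> < d \<Longrightarrow> \<bar>D u - D 0\<bar> < e"
    using e unfolding continuous_at_eps_delta dist_real_def by (metis diff_zero)
  define \<rho> where "\<rho> = d / 2"
  have \<rho>: "0 < \<rho>" "\<rho> < d" using d by (auto simp: \<rho>_def)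
  \<comment> \<open>The derivative is truncated rather than the function: clamping its argument
    keeps it continuous and everywhere close to \<open>D 0\<close>, and the antiderivative agrees
    with \<open>g\<close> on the clamped interval.\<close>
  define G' where "G' u = D (max (- \<rho>) (min \<rho> u))" for u
  have G'_cont: "continuous_on UNIV G'"
    unfolding G'_def
    by (rule continuous_on_compose2[OF D]) (auto intro!: continuous_intros)
  have "\<exists>F. \<forall>x :: real. - \<infinity> < ereal x \<longrightarrow> ereal x < \<infinity> \<longrightarrow> (F has_vector_derivative G' x) (at x)"
    by (rule einterval_antiderivative) (use G'_cont in \<open>auto simp: continuous_on_eq_continuous_at\<close>)
  then obtain F where F: "\<And>x. (F has_real_derivative G' x) (at x)"
    by (auto simp: has_real_derivative_iff_has_vector_derivative)
  define G where "G u = F u - F 0" for u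
  have G: "(G has_real_derivative G' u) (at u)" for u
    unfolding G_def using DERIV_diff[OF F DERIV_const[of "F 0"], of u] by simp
  have "G u = g u" if "\<bar>u\<bar> \<le> \<rho>" for u
  proof -
    have "norm ((G u - g u) - (G 0 - g 0)) \<le> 0 * norm (u - 0)"
    proof (rule field_differentiable_bound[of "{- \<rho>..\<rho>}" "\<lambda>u. G u - g u" "\<lambda>u. G' u - D u"])
      fix v assume v: "v \<in> {- \<rho>..\<rho>}"
      show "((\<lambda>u. G u - g u) has_field_derivative G' v - D v) (at v within {- \<rho>..\<rho>})"
        by (intro DERIV_diff has_field_derivative_at_within[OF G] has_field_derivative_at_within[OF g(2)])
      show "norm (G' v - D v) \<le> 0" using v by (simp add: G'_def)
    qed (use that \<rho> in auto)
    then show ?thesis using g(1) by (simp add: G_def)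
  qed
  moreover have "\<bar>G' u - D 0\<bar> \<le> e" for u
  proof -
    have "\<bar>max (- \<rho>) (min \<rho> u)\<bar> < d" using \<rho> by linarith
    then show ?thesis unfolding G'_def using d(2) less_imp_le by blast
  qed
  ultimately show ?thesis
    using that[OF \<rho>(1) _ G G'_cont] by (simp add: G_def)
qed

text \<open>The positive part of a parabola has corners at 0 and r; squaring it removes them and
  leaves a continuously differentiable function with explicit bounds.\<close>

definition bump :: "real \<Rightarrow> real \<Rightarrow> real" where
  "bump r t = (max 0 (t * (r - t)))\<^sup>2"

definition bump' :: "real \<Rightarrow> real \<Rightarrow> real" where
  "bump' r t = 2 * max 0 (t * (r - t)) * (r - 2 * t)"

lemma max_0_square_deriv: "((\<lambda>u. (max 0 u)\<^sup>2) has_real_derivative 2 * max 0 u) (at (u::real))"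
proof -
  consider "0 < u" | "u < 0" | "u = 0" by linarith
  then show ?thesis
  proof cases
    case 1
    have "((\<lambda>u. u\<^sup>2) has_real_derivative 2 * max 0 u) (at u)"
      using 1 by (auto intro!: derivative_eq_intros)
    then show ?thesis
      by (rule has_field_derivative_transform_within_open[of _ _ _ "{0<..}"]) (use 1 in auto)
  next
    case 2
    have "((\<lambda>u. 0) has_real_derivative 2 * max 0 u) (at u)" using 2 by simp
    then show ?thesis
      by (rule has_field_derivative_transform_within_open[of _ _ _ "{..<0}"]) (use 2 in auto)
  next
    case 3
    have "(\<lambda>h::real. (max 0 (0 + h))\<^sup>2 / h) \<midarrow>0\<rightarrow> 0"
    proof (rule tendsto_0_le[where K = 1])
      show "((\<lambda>h::real. h) \<longlongrightarrow> 0) (at 0)" by (rule tendsto_ident_at)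
      show "\<forall>\<^sub>F h in at 0. norm ((max 0 (0 + h))\<^sup>2 / h) \<le> norm (h::real) * 1"
        by (intro always_eventually) (auto simp: max_def power2_eq_square)
    qed
    then show ?thesis using 3 by (simp add: DERIV_def)
  qed
qed

lemma bump_deriv: "(bump r has_real_derivative bump' r t) (at t)"
proof -
  have "((\<lambda>t. t * (r - t)) has_real_derivative r - 2 * t) (at t)"
    by (auto intro!: derivative_eq_intros)
  from DERIV_chain2[OF max_0_square_deriv this] show ?thesis
    by (simp add: bump_def[abs_def] bump'_def)
qed

lemma continuous_bump': "continuous_on UNIV (bump' r)"
  unfolding bump'_def by (intro continuous_intros)

lemma continuous_bump: "continuous_on UNIV (bump r)"
  unfolding bump_def by (intro continuous_intros)

lemma bump_outside: "t \<le> 0 \<or> r \<le> t \<Longrightarrow> 0 \<le> r \<Longrightarrow> bump r t = 0 \<and> bump' r t = 0"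
  by (auto simp: bump_def bump'_def mult_le_0_iff max_absorb1)

lemma bump_nonneg: "0 \<le> bump r t"
  by (simp add: bump_def)

lemma bump_bound:
  assumes "0 < r"
  shows "bump r t \<le> (r * r)\<^sup>2" "\<bar>bump' r t\<bar> \<le> 2 * (r * r) * r"
proof -
  have m: "max 0 (t * (r - t)) \<le> r * r"
  proof (cases "0 < t \<and> t < r")
    case True
    then show ?thesis by (auto intro!: mult_mono)
  next
    case False
    then have "0 \<le> t \<and> r - t \<le> 0 \<or> t \<le> 0 \<and> 0 \<le> r - t" using assms by linarith
    then have "t * (r - t) \<le> 0" by (simp only: mult_le_0_iff)
    then show ?thesis using assms by simp
  qed
  then show "bump r t \<le> (r * r)\<^sup>2"
    unfolding bump_def by (intro power_mono) auto
  show "\<bar>bump' r t\<bar> \<le> 2 * (r * r) * r"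
  proof (cases "0 < t \<and> t < r")
    case True
    then have "\<bar>r - 2 * t\<bar> \<le> r" by linarith
    then have "2 * max 0 (t * (r - t)) * \<bar>r - 2 * t\<bar> \<le> 2 * (r * r) * r"
      using m assms by (intro mult_mono) auto
    then show ?thesis by (simp add: bump'_def abs_mult)
  next
    case False
    then have "bump' r t = 0" using bump_outside[of t r] assms by auto
    then show ?thesis using assms by simp
  qed
qed

lemma integral_bump_pos:
  assumes "0 < r" "0 < l"
  shows "0 < (LINT t|lborel. exp (- (l * t)) * bump r t)"
proof -
  \<comment> \<open>A lower bound for the integrand on [r / 4, r / 2], where t >= r / 4 and r - t >=
    r / 2.\<close>
  define e where "e = exp (- (l * r)) * (r * r / 8)\<^sup>2"
  have i: "integrable lborel (\<lambda>t. exp (- (l * t)) * bump r t)"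
  proof -
    have "set_integrable lborel {0..r} (\<lambda>t. exp (- (l * t)) * bump r t)"
      by (intro borel_integrable_atLeastAtMost' continuous_intros continuous_on_subset[OF continuous_bump]) auto
    moreover have "(\<lambda>t. indicator {0..r} t *\<^sub>R (exp (- (l * t)) * bump r t)) = (\<lambda>t. exp (- (l * t)) * bump r t)"
    proof
      fix t
      show "indicator {0..r} t *\<^sub>R (exp (- (l * t)) * bump r t) = exp (- (l * t)) * bump r t"
        using bump_outside[of t r] assms by (cases "t \<in> {0..r}") auto
    qed
    ultimately show ?thesis by (simp add: set_integrable_def)
  qed
  have "0 < e * (r / 2 - r / 4)" using assms by (simp add: e_def)
  also have "\<dots> = (LINT t|lborel. e * indicator {r / 4..r / 2} t)" using assms by simp
  also have "\<dots> \<le> (LINT t|lborel. exp (- (l * t)) * bump r t)"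
  proof (rule integral_mono)
    show "integrable lborel (\<lambda>t. e * indicator {r / 4..r / 2} t)"
      using assms by (intro integrable_mult_right integrable_real_indicator) (auto simp: emeasure_lborel_Icc_eq)
    fix t
    show "e * indicator {r / 4..r / 2} t \<le> exp (- (l * t)) * bump r t"
    proof (cases "t \<in> {r / 4..r / 2}")
      case True
      have "r / 4 * (r / 2) \<le> t * (r - t)" using True assms by (intro mult_mono) auto
      then have "(r * r / 8)\<^sup>2 \<le> bump r t"
        unfolding bump_def by (intro power_mono) auto
      moreover have "exp (- (l * r)) \<le> exp (- (l * t))"
        using True assms by (auto intro!: mult_left_mono)
      ultimately show ?thesis using True by (auto simp: e_def intro!: mult_mono)
    qed (simp add: bump_nonneg)
  qed (use i in auto)
  finally show ?thesis .
qed

section \<open>Laplace transforms\<close>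

definition laplace :: "(real \<Rightarrow> real) \<Rightarrow> complex \<Rightarrow> complex" where
  "laplace f s = (CLINT t|lborel. exp (- s * of_real t) * of_real (f t))"

text \<open>Moments of a kernel are kernels of higher order, so each term of the exponential series
  can be integrated by the known real Laplace transform.\<close>

lemma frac_kernel_times_power:
  assumes "0 < a"
  shows "frac_kernel a t * t ^ n = pochhammer a n * frac_kernel (a + real n) t"
  using Gamma_real_pos[OF assms, THEN less_imp_neq] assms
    Gamma_real_pos[OF add_pos_nonneg[OF assms of_nat_0_le_iff[of n]], THEN less_imp_neq]
    pochhammer_Gamma[of a n]
  by (auto simp: frac_kernel_def powr_add[symmetric] powr_realpow[symmetric] nonpos_Ints_def algebra_simps)

text \<open>
  A point \<open>s\<close> of the right half plane lies in the disc around \<open>r\<close> of radius \<open>r = \<bar>s\<bar>\<^sup>2 / Re s\<close>; expanding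
  \<open>exp (-s t)\<close> in powers of \<open>s - r\<close> gives the binomial series.
\<close>

lemma laplace_frac_kernel:
  assumes a: "0 < a" and s: "0 < Re s"
  shows "laplace (frac_kernel a) s = s powr (- of_real a)"
proof -
  define r where "r = (cmod s)\<^sup>2 / Re s"
  define w where "w = (s - of_real r) / of_real r"
  have s0: "s \<noteq> 0" using s by auto
  have r: "0 < r" using s s0 by (simp add: r_def)
  have "(cmod (s - of_real r))\<^sup>2 = (cmod s)\<^sup>2 - 2 * r * Re s + r\<^sup>2"
    by (simp only: cmod_power2) (simp add: power2_eq_square algebra_simps)
  also have "r * Re s = (cmod s)\<^sup>2" using s by (simp add: r_def)
  then have "(cmod s)\<^sup>2 - 2 * r * Re s + r\<^sup>2 = r\<^sup>2 - (cmod s)\<^sup>2" by simp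
  also have "\<dots> < r\<^sup>2" using s0 by simp
  finally have "cmod (s - of_real r) < r"
    using r by (rule power_less_imp_less_base[OF _ less_imp_le])
  then have w1: "cmod w < 1" using r by (simp add: w_def norm_divide)
  have rw: "s - of_real r = of_real r * w" using r by (simp add: w_def)
  define f where "f n t = (- (s - of_real r) * of_real t) ^ n /\<^sub>R fact n * of_real (frac_kernel a t * exp (- (r * t)))" for n t
  have f_eq: "f n t = (- (s - of_real r)) ^ n / fact n * of_real (pochhammer a n) * of_real (frac_kernel (a + real n) t * exp (- (r * t)))" for n t
  proof -
    have "f n t = (- (s - of_real r)) ^ n / fact n * of_real (frac_kernel a t * t ^ n * exp (- (r * t)))"
      by (simp only: f_def power_mult_distrib scaleR_conv_of_real divide_inverse of_real_mult of_real_power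
          of_real_inverse of_real_fact mult_ac)
    then show ?thesis
      unfolding frac_kernel_times_power[OF a] by (simp only: of_real_mult mult_ac)
  qed
  have int: "integrable lborel (f n)" for n
    unfolding f_eq using a r
    by (intro integrable_mult_right integrable_of_real integrable_frac_kernel_exp) (auto intro: add_pos_nonneg)
  have ival: "(LINT t|lborel. f n t) = of_real (r powr (- a)) * ((- of_real a gchoose n) * w ^ n)" for n
  proof -
    have "(LINT t|lborel. f n t) = (- (s - of_real r)) ^ n / fact n * of_real (pochhammer a n) * of_real (r powr (- (a + real n)))"
      unfolding f_eq integral_mult_right_zero integral_complex_of_real
      using integral_frac_kernel_exp[of "a + real n" r] a r by simp
    also have "r powr (- (a + real n)) = r powr (- a) / r ^ n"
      using r by (simp add: powr_diff powr_realpow)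
    finally have *: "(LINT t|lborel. f n t) = (- (of_real r * w)) ^ n / fact n * of_real (pochhammer a n) * of_real (r powr (- a) / r ^ n)"
      by (simp only: rw)
    have "(- (of_real r * w)) ^ n = (- 1) ^ n * of_real r ^ n * w ^ n"
      using power_minus[of "of_real r * w" n] by (simp only: power_mult_distrib mult.assoc)
    then show ?thesis
      using r unfolding * by (simp add: gbinomial_pochhammer pochhammer_of_real)
  qed
  \<comment> \<open>The absolute integrals form the binomial series of (1 - |w|)^(-a), which
    converges because |w| < 1; this licenses exchanging sum and integral.\<close>
  have nval: "(LINT t|lborel. norm (f n t)) = r powr (- a) * ((- a gchoose n) * (- cmod w) ^ n)" for n
  proof -
    have "norm (f n t) = cmod (s - of_real r) ^ n / fact n * pochhammer a n * (frac_kernel (a + real n) t * exp (- (r * t)))" for t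
      using a frac_kernel_nonneg[of "a + real n" t] pochhammer_pos[OF a, of n]
      unfolding f_eq norm_mult norm_divide norm_power norm_minus_cancel by (simp add: norm_mult)
    then have "(LINT t|lborel. norm (f n t)) = cmod (s - of_real r) ^ n / fact n * pochhammer a n * r powr (- (a + real n))"
      using integral_frac_kernel_exp[of "a + real n" r] a r by simp
    also have "r powr (- (a + real n)) = r powr (- a) / r ^ n"
      using r by (simp add: powr_diff powr_realpow)
    finally have *: "(LINT t|lborel. norm (f n t)) = (r * cmod w) ^ n / fact n * pochhammer a n * (r powr (- a) / r ^ n)"
      using r by (simp only: rw norm_mult norm_of_real abs_of_pos)
    have "(- 1 :: real) ^ n * (- cmod w) ^ n = cmod w ^ n"
      by (simp flip: power_mult_distrib)
    then have "(- a gchoose n) * (- cmod w) ^ n = pochhammer a n / fact n * cmod w ^ n"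
      by (simp add: gbinomial_pochhammer)
    then show ?thesis
      using r unfolding * by (simp add: power_mult_distrib)
  qed
  have summ: "summable (\<lambda>n. LINT t|lborel. norm (f n t))"
    unfolding nval using gen_binomial_real[of "- cmod w" "- a"] w1
    by (intro summable_mult) (auto simp: sums_iff)
  have pt: "(\<lambda>n. f n t) sums (exp (- (s - of_real r) * of_real t) * of_real (frac_kernel a t * exp (- (r * t))))" for t
    unfolding f_def by (intro sums_mult2 exp_converges)
  have "summable (\<lambda>n. norm (f n t))" for t
  proof -
    have "summable (\<lambda>n. norm ((- (s - of_real r) * of_real t) ^ n /\<^sub>R fact n) * norm (of_real (frac_kernel a t * exp (- (r * t))) :: complex))"
      by (intro summable_mult2 summable_norm_exp)
    then show ?thesis by (simp only: f_def norm_mult)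
  qed
  then have "(\<lambda>n. LINT t|lborel. f n t) sums (LINT t|lborel. (\<Sum>n. f n t))"
    by (intro sums_integral int summ) simp
  moreover have "(\<Sum>n. f n t) = exp (- s * of_real t) * of_real (frac_kernel a t)" for t
    using sums_unique[OF pt, of t]
    by (simp add: exp_of_real[symmetric] mult_ac exp_add[symmetric] algebra_simps flip: mult.assoc)
  moreover have "(\<lambda>n. LINT t|lborel. f n t) sums (of_real (r powr (- a)) * (1 + w) powr (- of_real a))"
    unfolding ival by (intro sums_mult gen_binomial_complex w1)
  ultimately have "laplace (frac_kernel a) s = of_real (r powr (- a)) * (1 + w) powr (- of_real a)"
    unfolding laplace_def using sums_unique2 by fastforce
  \<comment> \<open>Complex powers are not multiplicative in general; here one factor is a positive
    real, so the argument and hence the branch is unchanged.\<close>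
  also have "of_real (r powr (- a)) * (1 + w) powr (- of_real a) = (of_real r * (1 + w)) powr (- of_real a)"
    using r powr_times_real[of "of_real r" "1 + w" "- of_real a"] by (simp add: powr_of_real[symmetric] powr_times_real_left)
  also have "of_real r * (1 + w) = s" using r by (simp add: w_def field_simps)
  finally show ?thesis .
qed

lemma integrable_exp_causal:
  fixes f :: "real \<Rightarrow> real"
  assumes "continuous_on UNIV f" "causal f" "\<And>t. \<bar>f t\<bar> \<le> B" "0 < M"
  shows "integrable lborel (\<lambda>t. exp (- (M * t)) * f t)"
proof (rule Bochner_Integration.integrable_bound[OF integrable_mult_right[OF integrable_frac_kernel_exp[of 1 M], of B]])
  have [measurable]: "f \<in> borel_measurable borel"
    using assms(1) by (simp add: borel_measurable_continuous_onI)
  show "(\<lambda>t. exp (- (M * t)) * f t) \<in> borel_measurable lborel"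
    by measurable
  have "norm (exp (- (M * t)) * f t) \<le> norm (B * (frac_kernel 1 t * exp (- (M * t))))" for t
    using assms(2) assms(3)[of t] order_trans[OF abs_ge_zero assms(3)]
    by (auto simp: causal_def frac_kernel_def abs_mult)
  then show "AE t in lborel. norm (exp (- (M * t)) * f t) \<le> norm (B * (frac_kernel 1 t * exp (- (M * t))))"
    by simp
qed (use assms in auto)

lemma integrable_laplace:
  fixes f :: "real \<Rightarrow> real"
  assumes "continuous_on UNIV f" "causal f" "\<And>t. \<bar>f t\<bar> \<le> B" "0 < Re s"
  shows "integrable lborel (\<lambda>t. exp (- s * of_real t) * of_real (f t) :: complex)"
proof (rule Bochner_Integration.integrable_bound[OF integrable_exp_causal[OF assms]])
  have [measurable]: "f \<in> borel_measurable borel"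
    using assms(1) by (simp add: borel_measurable_continuous_onI)
  show "(\<lambda>t. exp (- s * of_real t) * of_real (f t) :: complex) \<in> borel_measurable lborel"
    by measurable
qed (simp add: norm_mult)

lemma laplace_shift: "laplace (\<lambda>t. f (t - r)) s = exp (- s * of_real r) * laplace f s"
proof -
  have "laplace (\<lambda>t. f (t - r)) s = (CLINT t|lborel. exp (- s * of_real (r + t)) * of_real (f t))"
    unfolding laplace_def by (subst lborel_integral_real_affine[of 1 _ r]) auto
  also have "\<dots> = (CLINT t|lborel. exp (- s * of_real r) * (exp (- s * of_real t) * of_real (f t)))"
    by (simp add: exp_add[symmetric] algebra_simps flip: mult.assoc)
  finally show ?thesis by (simp add: laplace_def)
qed

text \<open>The convolution theorem. Tonelli applies since the norm integral factors into the
  transforms of the kernel and of |f| at \<open>Re s\<close>.\<close>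

lemma laplace_frac_int:
  fixes f :: "real \<Rightarrow> real"
  assumes a: "0 < a" and f: "continuous_on UNIV f" "causal f" "\<And>t. \<bar>f t\<bar> \<le> B" and s: "0 < Re s"
  shows "laplace (frac_int a f) s = s powr (- of_real a) * laplace f s"
proof -
  have [measurable]: "f \<in> borel_measurable borel"
    using f(1) by (simp add: borel_measurable_continuous_onI)
  define g where "g u t = exp (- s * of_real t) * of_real (frac_kernel a u * f (t - u))" for u t
  have i: "integrable lborel (g u)" for u
  proof -
    have "integrable lborel (\<lambda>t. exp (- s * of_real u) * (exp (- s * of_real t) * of_real (f t)) :: complex)"
      by (intro integrable_mult_right integrable_laplace[OF f s])
    from lborel_integrable_real_affine[OF this, of 1 "- u"]
    have "integrable lborel (\<lambda>t. exp (- s * of_real t) * of_real (f (t - u)) :: complex)"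
      by (simp add: exp_add[symmetric] algebra_simps flip: mult.assoc)
    from integrable_mult_right[OF this, of "of_real (frac_kernel a u)"] show ?thesis
      by (simp add: g_def[abs_def] mult_ac)
  qed
  have "integrable (lborel \<Otimes>\<^sub>M lborel) (\<lambda>(u, t). g u t)"
  proof (rule lborel_pair.Fubini_integrable)
    show "(\<lambda>(u, t). g u t) \<in> borel_measurable (lborel \<Otimes>\<^sub>M lborel)"
      unfolding g_def by measurable
    have "(LINT t|lborel. norm (g u t)) = (LINT t|lborel. exp (- (Re s * t)) * \<bar>f t\<bar>) * (frac_kernel a u * exp (- (Re s * u)))" for u
    proof -
      have "(LINT t|lborel. norm (g u t)) = (LINT t|lborel. exp (- (Re s * (u + t))) * (frac_kernel a u * \<bar>f t\<bar>))"
        by (subst lborel_integral_real_affine[of 1 _ u])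
           (use frac_kernel_nonneg[OF a, of u] in \<open>auto simp: g_def norm_mult abs_mult\<close>)
      also have "\<dots> = (LINT t|lborel. (exp (- (Re s * t)) * \<bar>f t\<bar>) * (frac_kernel a u * exp (- (Re s * u))))"
        by (simp add: distrib_left exp_add[symmetric] exp_diff exp_minus divide_inverse mult_ac)
      finally show ?thesis by simp
    qed
    then show "integrable lborel (\<lambda>u. LINT t|lborel. norm (case (u, t) of (u, t) \<Rightarrow> g u t))"
      using integrable_frac_kernel_exp[OF a s] by simp
  qed (use i in simp)
  from lborel_pair.Fubini_integral[OF this]
  have swap: "(CLINT t|lborel. CLINT u|lborel. g u t) = (CLINT u|lborel. CLINT t|lborel. g u t)" .
  have inner1: "(CLINT u|lborel. g u t) = exp (- s * of_real t) * of_real (frac_int a f t)" for t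
    by (simp only: g_def integral_mult_right_zero integral_complex_of_real frac_int_def)
  have inner2: "(CLINT t|lborel. g u t) = exp (- s * of_real u) * of_real (frac_kernel a u) * laplace f s" for u
  proof -
    have "(CLINT t|lborel. g u t) = of_real (frac_kernel a u) * laplace (\<lambda>t. f (t - u)) s"
      unfolding laplace_def g_def
      by (subst integral_mult_right_zero[symmetric]) (simp add: mult_ac)
    then show ?thesis by (simp add: laplace_shift)
  qed
  have "laplace (frac_int a f) s = laplace (frac_kernel a) s * laplace f s"
    using swap unfolding inner1 inner2 by (simp only: laplace_def[of "frac_int a f"] laplace_def[of "frac_kernel a"] integral_mult_left_zero)
  then show ?thesis by (simp add: laplace_frac_kernel[OF a s])
qed

text \<open>The transform of a bounded integrable \<open>f\<close> need not be assumed integrable.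
  Its squared modulus is averaged against ever wider Gaussians instead: by Fubini's theorem each
  average pairs \<open>f\<close> with a mollified copy of itself, and the mollifier shrinks to a
  point mass.\<close>

lemma Gaussian_Parseval:
  fixes f :: "real \<Rightarrow> real"
  assumes cont: "continuous_on UNIV f" and int: "integrable lborel f" and bd: "\<And>t. \<bar>f t\<bar> \<le> B"
  shows "(\<lambda>n. real (Suc n) * (LINT w|std_normal_distribution.
            (cmod (CLINT t|lborel. of_real (f t) * iexp (real (Suc n) * w * t)))\<^sup>2))
          \<longlonglongrightarrow> sqrt (2 * pi) * (LINT t|lborel. (f t)\<^sup>2)"
proof -
  interpret N: prob_space std_normal_distribution
    by (rule prob_space_normal_density) simp
  interpret P: pair_sigma_finite std_normal_distribution lborel ..
  have [measurable]: "f \<in> borel_measurable borel"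
    using cont by (simp add: borel_measurable_continuous_onI)
  have B: "0 \<le> B" using bd[of 0] by linarith
  define A where "A = (LINT t|lborel. \<bar>f t\<bar>)"
  define F where "F v = (CLINT t|lborel. of_real (f t) * iexp (v * t))" for v
  have [measurable]: "F \<in> borel_measurable borel"
    unfolding F_def by measurable
  have [measurable]: "cnj \<in> borel_measurable borel"
    by (intro borel_measurable_continuous_onI continuous_intros)
  have F_bound: "cmod (F v) \<le> A" for v
    unfolding F_def A_def
    by (rule order_trans[OF integral_norm_bound]) (simp add: norm_mult)
  have prod_int: "integrable (std_normal_distribution \<Otimes>\<^sub>M lborel) (\<lambda>(w, t). of_real (f t) * g w t)"
    if [measurable]: "(\<lambda>(w, t). g w t) \<in> borel_measurable (std_normal_distribution \<Otimes>\<^sub>M lborel)"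
      and g: "\<And>w t. cmod (g w t) \<le> C" for g :: "real \<Rightarrow> real \<Rightarrow> complex" and C
  proof (rule P.Fubini_integrable)
    have i: "integrable lborel (\<lambda>t. of_real (f t) * g w t)" for w
    proof (rule Bochner_Integration.integrable_bound[of _ "\<lambda>t. C * \<bar>f t\<bar>"])
      have "(\<lambda>t. (w, t)) \<in> lborel \<rightarrow>\<^sub>M std_normal_distribution \<Otimes>\<^sub>M lborel" by simp
      from measurable_compose[OF this that(1)] show "(\<lambda>t. of_real (f t) * g w t) \<in> borel_measurable lborel" by simp
      show "AE t in lborel. norm (of_real (f t) * g w t) \<le> norm (C * \<bar>f t\<bar>)"
        using g order_trans[OF norm_ge_zero g]
        by (intro AE_I2) (simp add: norm_mult abs_mult mult.commute[of C] mult_left_mono)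
    qed (use int in auto)
    then show "AE w in std_normal_distribution. integrable lborel (\<lambda>t. case (w, t) of (w, t) \<Rightarrow> of_real (f t) * g w t)"
      by simp
    show "integrable std_normal_distribution (\<lambda>w. LINT t|lborel. norm (case (w, t) of (w, t) \<Rightarrow> of_real (f t) * g w t))"
    proof (rule N.integrable_const_bound[where B = "C * A"])
      have "norm (LINT t|lborel. norm (of_real (f t) * g w t)) \<le> C * A" for w
      proof -
        have "(LINT t|lborel. norm (of_real (f t) * g w t)) \<le> (LINT t|lborel. C * \<bar>f t\<bar>)"
          using g by (intro integral_mono integrable_norm i integrable_mult_right integrable_abs int)
            (simp add: norm_mult mult.commute[of C] mult_left_mono)
        then show ?thesis by (simp add: A_def)
      qed
      then show "AE w in std_normal_distribution.
          norm (LINT t|lborel. norm (case (w, t) of (w, t) \<Rightarrow> of_real (f t) * g w t)) \<le> C * A" by simp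
    qed simp
  qed simp
  \<comment> \<open>\<open>f\<close> averaged against a Gaussian of standard deviation 1 / (n +
    1).\<close>
  define h where "h n t = (LINT u|std_normal_distribution. f (t + u / real (Suc n)))" for n t
  have h_bound: "\<bar>h n t\<bar> \<le> B" for n t
  proof -
    have "\<bar>h n t\<bar> \<le> (LINT u|std_normal_distribution. \<bar>f (t + u / real (Suc n))\<bar>)"
      unfolding h_def by (rule integral_abs_bound)
    also have "\<dots> \<le> (LINT u|std_normal_distribution. B)"
      by (intro integral_mono integrable_abs N.integrable_const_bound[where B = B]) (use bd B in auto)
    finally show ?thesis using N.prob_space by simp
  qed
  have [measurable]: "h n \<in> borel_measurable borel" for n
    unfolding h_def by measurable
  \<comment> \<open>Integrating first over w replaces the Gaussian weight by its characteristic
    function, again a Gaussian. Rescaling s to width 1 / (n + 1) yields the factor that the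
    prefactor cancels.\<close>
  have inner: "real (Suc n) * (CLINT w|std_normal_distribution. iexp (real (Suc n) * w * t) * cnj (F (real (Suc n) * w)))
      = of_real (sqrt (2 * pi) * h n t)" for n t
  proof -
    let ?n = "real (Suc n)"
    have "(CLINT w|std_normal_distribution. iexp (?n * w * t) * cnj (F (?n * w))) =
        (CLINT w|std_normal_distribution. CLINT s|lborel. of_real (f s) * iexp (?n * w * (t - s)))"
    proof (intro Bochner_Integration.integral_cong refl)
      fix w
      define v where "v = ?n * w"
      have "iexp (v * t) * cnj (F v) = iexp (v * t) * (CLINT s|lborel. cnj (of_real (f s) * iexp (v * s)))"
        by (simp only: F_def Bochner_Integration.integral_cnj)
      also have "\<dots> = (CLINT s|lborel. iexp (v * t) * cnj (of_real (f s) * iexp (v * s)))"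
        by (simp only: integral_mult_right_zero)
      also have "\<dots> = (CLINT s|lborel. of_real (f s) * iexp (v * (t - s)))"
        by (intro Bochner_Integration.integral_cong refl)
           (simp add: exp_cnj exp_add[symmetric] exp_diff exp_minus field_simps)
      finally show "iexp (?n * w * t) * cnj (F (?n * w)) = (CLINT s|lborel. of_real (f s) * iexp (?n * w * (t - s)))"
        by (simp only: v_def)
    qed
    also have "\<dots> = (CLINT s|lborel. CLINT w|std_normal_distribution. of_real (f s) * iexp (?n * w * (t - s)))"
      by (rule P.Fubini_integral[symmetric], rule prod_int[of _ 1]) auto
    also have "\<dots> = (CLINT s|lborel. of_real (f s) * char std_normal_distribution (?n * (t - s)))"
      by (simp add: char_def mult_ac)
    also have "\<dots> = (CLINT s|lborel. of_real (f s * exp (- (?n * (t - s))\<^sup>2 / 2)))"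
      by (simp add: char_std_normal_distribution)
    also have "\<dots> = of_real (LINT s|lborel. f s * exp (- (?n * (t - s))\<^sup>2 / 2))"
      by (rule integral_complex_of_real)
    also have "(LINT s|lborel. f s * exp (- (?n * (t - s))\<^sup>2 / 2)) =
        1 / ?n * (LINT u|lborel. f (t + u / ?n) * exp (- u\<^sup>2 / 2))"
      by (subst lborel_integral_real_affine[of "1 / ?n" _ t]) auto
    also have "(LINT u|lborel. f (t + u / ?n) * exp (- u\<^sup>2 / 2)) = sqrt (2 * pi) * h n t"
    proof -
      have "h n t = (LINT u|lborel. std_normal_density u * f (t + u / ?n))"
        unfolding h_def by (subst integral_density) auto
      also have "\<dots> = (LINT u|lborel. 1 / sqrt (2 * pi) * (f (t + u / ?n) * exp (- u\<^sup>2 / 2)))"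
        by (simp add: std_normal_density_def mult_ac)
      finally show ?thesis by (simp only: integral_mult_right_zero) simp
    qed
    finally show ?thesis by (simp del: of_nat_Suc)
  qed
  have main: "real (Suc n) * (LINT w|std_normal_distribution. (cmod (F (real (Suc n) * w)))\<^sup>2) =
      sqrt (2 * pi) * (LINT t|lborel. f t * h n t)" for n
  proof -
    let ?n = "real (Suc n)"
    have "of_real (LINT w|std_normal_distribution. (cmod (F (?n * w)))\<^sup>2) =
        (CLINT w|std_normal_distribution. F (?n * w) * cnj (F (?n * w)))"
      by (simp only: complex_norm_square[symmetric] integral_complex_of_real)
    also have "\<dots> = (CLINT w|std_normal_distribution. CLINT t|lborel. of_real (f t) * (iexp (?n * w * t) * cnj (F (?n * w))))"
      by (intro Bochner_Integration.integral_cong refl, subst F_def)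
         (simp add: mult.assoc[symmetric])
    also have "\<dots> = (CLINT t|lborel. CLINT w|std_normal_distribution. of_real (f t) * (iexp (?n * w * t) * cnj (F (?n * w))))"
      by (rule P.Fubini_integral[symmetric], rule prod_int[of _ A]) (auto simp: norm_mult F_bound)
    finally have 1: "of_real (LINT w|std_normal_distribution. (cmod (F (?n * w)))\<^sup>2) =
        (CLINT t|lborel. CLINT w|std_normal_distribution. of_real (f t) * (iexp (?n * w * t) * cnj (F (?n * w))))" .
    have "of_real (?n * (LINT w|std_normal_distribution. (cmod (F (?n * w)))\<^sup>2)) =
        (CLINT t|lborel. of_real (f t) * (of_real ?n * (CLINT w|std_normal_distribution. iexp (?n * w * t) * cnj (F (?n * w)))))"
      unfolding of_real_mult 1
      by (simp only: integral_mult_right_zero mult.left_commute[of _ "complex_of_real ?n"])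
    also have "\<dots> = (CLINT t|lborel. of_real (sqrt (2 * pi) * (f t * h n t)))"
      unfolding inner by (simp add: mult_ac)
    also have "\<dots> = of_real (sqrt (2 * pi) * (LINT t|lborel. f t * h n t))"
      by (simp only: integral_complex_of_real integral_mult_right_zero)
    finally show ?thesis
      by (simp only: of_real_eq_iff)
  qed
  have h_lim: "(\<lambda>n. h n t) \<longlonglongrightarrow> f t" for t
  proof -
    have "(\<lambda>n. h n t) \<longlonglongrightarrow> (LINT u|std_normal_distribution. f t)"
      unfolding h_def
    proof (rule integral_dominated_convergence[where w = "\<lambda>u. B"])
      have "(\<lambda>n. t + u * inverse (real (Suc n))) \<longlonglongrightarrow> t + u * 0" for u
        by (intro tendsto_intros LIMSEQ_inverse_real_of_nat)
      then have "(\<lambda>n. f (t + u / real (Suc n))) \<longlonglongrightarrow> f t" for u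
        using continuous_on_tendsto_compose[OF cont, of "\<lambda>n. t + u / real (Suc n)" t sequentially]
        by (simp add: divide_inverse)
      then show "AE u in std_normal_distribution. (\<lambda>n. f (t + u / real (Suc n))) \<longlonglongrightarrow> f t" by simp
    qed (use bd in auto)
    then show ?thesis using N.prob_space by simp
  qed
  have "(\<lambda>n. LINT t|lborel. f t * h n t) \<longlonglongrightarrow> (LINT t|lborel. f t * f t)"
  proof (rule integral_dominated_convergence[where w = "\<lambda>t. B * \<bar>f t\<bar>"])
    show "AE t in lborel. norm (f t * h n t) \<le> B * \<bar>f t\<bar>" for n
      using h_bound[of n] by (intro AE_I2) (simp add: abs_mult mult.commute[of B] mult_left_mono)
    show "AE t in lborel. (\<lambda>n. f t * h n t) \<longlonglongrightarrow> f t * f t"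
      by (intro AE_I2 tendsto_intros h_lim)
  qed (use int in auto)
  then have "(\<lambda>n. sqrt (2 * pi) * (LINT t|lborel. f t * h n t)) \<longlonglongrightarrow> sqrt (2 * pi) * (LINT t|lborel. (f t)\<^sup>2)"
    by (intro tendsto_intros) (simp add: power2_eq_square)
  then show ?thesis
    unfolding main[symmetric] F_def .
qed

text \<open>Pointwise domination of the transforms passes to every Gaussian average and then to the
  limit, so the averaged form of Parseval's identity is enough.\<close>

lemma Fourier_comparison:
  fixes f g :: "real \<Rightarrow> real"
  assumes f: "continuous_on UNIV f" "integrable lborel f" "\<And>t. \<bar>f t\<bar> \<le> B"
    and g: "continuous_on UNIV g" "integrable lborel g" "\<And>t. \<bar>g t\<bar> \<le> B'"
    and m: "0 \<le> m"
    and le: "\<And>v. m * cmod (CLINT t|lborel. of_real (f t) * iexp (v * t)) \<le> cmod (CLINT t|lborel. of_real (g t) * iexp (v * t))"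
  shows "m\<^sup>2 * (LINT t|lborel. (f t)\<^sup>2) \<le> (LINT t|lborel. (g t)\<^sup>2)"
proof -
  interpret N: prob_space std_normal_distribution
    by (rule prob_space_normal_density) simp
  define F where "F h v = (CLINT t|lborel. of_real (h t) * iexp (v * t))" for h :: "real \<Rightarrow> real" and v
  have int: "integrable std_normal_distribution (\<lambda>w. (cmod (F h (c * w)))\<^sup>2)"
    if "continuous_on UNIV h" for h :: "real \<Rightarrow> real" and c
  proof (rule N.integrable_const_bound[where B = "(LINT t|lborel. \<bar>h t\<bar>)\<^sup>2"])
    have [measurable]: "h \<in> borel_measurable borel"
      using that by (simp add: borel_measurable_continuous_onI)
    have "cmod (F h v) \<le> (LINT t|lborel. \<bar>h t\<bar>)" for v
      unfolding F_def by (rule order_trans[OF integral_norm_bound]) (simp add: norm_mult)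
    then show "AE w in std_normal_distribution. norm ((cmod (F h (c * w)))\<^sup>2) \<le> (LINT t|lborel. \<bar>h t\<bar>)\<^sup>2"
      by (auto intro!: power_mono)
    show "(\<lambda>w. (cmod (F h (c * w)))\<^sup>2) \<in> borel_measurable std_normal_distribution"
      unfolding F_def by measurable
  qed
  define I where "I h n = real (Suc n) * (LINT w|std_normal_distribution. (cmod (F h (real (Suc n) * w)))\<^sup>2)" for h n
  have lim: "(\<lambda>n. m\<^sup>2 * I f n) \<longlonglongrightarrow> m\<^sup>2 * (sqrt (2 * pi) * (LINT t|lborel. (f t)\<^sup>2))"
    "I g \<longlonglongrightarrow> sqrt (2 * pi) * (LINT t|lborel. (g t)\<^sup>2)"
    using Gaussian_Parseval[OF f] Gaussian_Parseval[OF g]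
    by (auto simp: I_def[abs_def] F_def intro!: tendsto_intros)
  have "m\<^sup>2 * I f n \<le> I g n" for n
  proof -
    have "m * cmod (F f v) \<le> cmod (F g v)" for v
      using le by (simp add: F_def)
    then have "m\<^sup>2 * (cmod (F f v))\<^sup>2 \<le> (cmod (F g v))\<^sup>2" for v
      using m by (simp add: power_mult_distrib[symmetric] power_mono)
    then have "(LINT w|std_normal_distribution. m\<^sup>2 * (cmod (F f (real (Suc n) * w)))\<^sup>2)
        \<le> (LINT w|std_normal_distribution. (cmod (F g (real (Suc n) * w)))\<^sup>2)"
      by (intro integral_mono integrable_mult_right int f g)
    from mult_left_mono[OF this, of "real (Suc n)"] show ?thesis
      by (simp add: I_def mult_ac)
  qed
  with lim have "m\<^sup>2 * (sqrt (2 * pi) * (LINT t|lborel. (f t)\<^sup>2)) \<le> sqrt (2 * pi) * (LINT t|lborel. (g t)\<^sup>2)"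
    by (meson LIMSEQ_le)
  then have "sqrt (2 * pi) * (m\<^sup>2 * (LINT t|lborel. (f t)\<^sup>2)) \<le> sqrt (2 * pi) * (LINT t|lborel. (g t)\<^sup>2)"
    by (simp only: mult_ac)
  then show ?thesis
    by (rule mult_left_le_imp_le) simp
qed

section \<open>The characteristic function\<close>

definition char_fun :: "real \<Rightarrow> real \<Rightarrow> real \<Rightarrow> real \<Rightarrow> real \<Rightarrow> real \<Rightarrow> complex \<Rightarrow> complex" where
  "char_fun \<alpha> \<gamma> k c \<tau> \<sigma> s =
     s powr (of_real \<alpha>) - (of_real (- \<gamma>) + of_real k * exp (- s * of_real \<tau>) - of_real (k * c) * exp (- s * of_real \<sigma>))"

lemma char_fun_of_real:
  assumes "0 \<le> x"
  shows "char_fun \<alpha> \<gamma> k c \<tau> \<sigma> (of_real x) =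
    of_real (x powr \<alpha> - (- \<gamma> + k * exp (- (x * \<tau>)) - k * c * exp (- (x * \<sigma>))))"
  using assms by (simp add: char_fun_def powr_of_real exp_of_real[symmetric])

lemma delayed_part_bound:
  assumes "0 \<le> \<tau>" "0 \<le> \<sigma>" "0 \<le> Re s"
  shows "cmod (of_real (- \<gamma>) + of_real k * exp (- s * of_real \<tau>) - of_real (k * c) * exp (- s * of_real \<sigma>))
    \<le> \<bar>\<gamma>\<bar> + \<bar>k\<bar> + \<bar>k * c\<bar>"
proof -
  have e: "cmod (exp (- s * of_real r)) \<le> 1" if "0 \<le> r" for r
    using that assms(3) by simp
  have "cmod (of_real (- \<gamma>) + of_real k * exp (- s * of_real \<tau>) - of_real (k * c) * exp (- s * of_real \<sigma>))
      \<le> cmod (of_real (- \<gamma>)) + cmod (of_real k * exp (- s * of_real \<tau>)) + cmod (of_real (k * c) * exp (- s * of_real \<sigma>))"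
    by (meson norm_triangle_ineq norm_triangle_ineq4 add_right_mono order_trans)
  also have "\<dots> \<le> \<bar>\<gamma>\<bar> + \<bar>k\<bar> * 1 + \<bar>k * c\<bar> * 1"
    unfolding norm_mult norm_of_real using e assms(1,2)
    by (intro add_mono mult_left_mono) auto
  finally show ?thesis by simp
qed

text \<open>Beyond this radius |s|^\<alpha> exceeds the bounded delayed part by at least 1. The same
  radius serves as the right end in the search for a real root and as the height above which a
  vertical line needs no compactness argument.\<close>

lemma char_fun_large:
  assumes "0 < \<alpha>" "0 \<le> \<tau>" "0 \<le> \<sigma>" "0 \<le> Re s" "(\<bar>\<gamma>\<bar> + \<bar>k\<bar> + \<bar>k * c\<bar> + 1) powr (1 / \<alpha>) \<le> cmod s"
  shows "1 \<le> cmod (char_fun \<alpha> \<gamma> k c \<tau> \<sigma> s)"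
proof -
  have "((\<bar>\<gamma>\<bar> + \<bar>k\<bar> + \<bar>k * c\<bar> + 1) powr (1 / \<alpha>)) powr \<alpha> \<le> cmod s powr \<alpha>"
    using assms by (intro powr_mono2) auto
  then have "\<bar>\<gamma>\<bar> + \<bar>k\<bar> + \<bar>k * c\<bar> + 1 \<le> cmod (s powr (of_real \<alpha>))"
    using assms(1) by (simp add: powr_powr norm_powr_real_powr')
  then show ?thesis
    unfolding char_fun_def
    using delayed_part_bound[OF assms(2,3,4), of \<gamma> k c]
      norm_triangle_ineq2[of "s powr (of_real \<alpha>)" "of_real (- \<gamma>) + of_real k * exp (- s * of_real \<tau>) - of_real (k * c) * exp (- s * of_real \<sigma>)"]
    by linarith
qed

lemma char_fun_real_root:
  assumes "0 < \<alpha>" "0 \<le> \<tau>" "0 \<le> \<sigma>" "0 < - \<gamma> + k - k * c"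
  obtains l where "0 < l" "char_fun \<alpha> \<gamma> k c \<tau> \<sigma> (of_real l) = 0"
proof -
  define f where "f x = x powr \<alpha> - (- \<gamma> + k * exp (- (x * \<tau>)) - k * c * exp (- (x * \<sigma>)))" for x
  define b where "b = (\<bar>\<gamma>\<bar> + \<bar>k\<bar> + \<bar>k * c\<bar> + 1) powr (1 / \<alpha>)"
  have b: "0 < b" "b powr \<alpha> = \<bar>\<gamma>\<bar> + \<bar>k\<bar> + \<bar>k * c\<bar> + 1"
    using assms(1) by (auto simp: b_def powr_powr)
  \<comment> \<open>Since \<open>0 powr \<alpha>\<close> is 0, the value at 0 is minus the assumed
    positive quantity.\<close>
  have "f 0 < 0" using assms by (simp add: f_def)
  moreover have "0 \<le> f b"
  proof -
    have "cmod (of_real (- \<gamma> + k * exp (- (b * \<tau>)) - k * c * exp (- (b * \<sigma>)))) \<le> \<bar>\<gamma>\<bar> + \<bar>k\<bar> + \<bar>k * c\<bar>"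
      using delayed_part_bound[OF assms(2,3), of "of_real b" \<gamma> k c] b(1) by (simp add: exp_of_real[symmetric])
    then have "- \<gamma> + k * exp (- (b * \<tau>)) - k * c * exp (- (b * \<sigma>)) \<le> \<bar>\<gamma>\<bar> + \<bar>k\<bar> + \<bar>k * c\<bar>"
      unfolding norm_of_real by linarith
    then show ?thesis using b(2) by (simp add: f_def)
  qed
  moreover have "continuous_on {0..b} f"
    unfolding f_def using assms(1)
    by (intro continuous_on_diff continuous_on_powr') (auto intro!: continuous_intros)
  ultimately obtain l where "0 \<le> l" "l \<le> b" "f l = 0"
    using IVT'[of f 0 0 b] b(1) by auto
  moreover from this \<open>f 0 < 0\<close> have "0 < l" by (cases "l = 0") auto
  ultimately show ?thesis
    using that[of l] by (simp add: char_fun_of_real f_def)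
qed

lemma char_fun_holomorphic: "char_fun \<alpha> \<gamma> k c \<tau> \<sigma> holomorphic_on {s. 0 < Re s}"
  unfolding char_fun_def by (intro holomorphic_intros) (auto simp: complex_nonpos_Reals_iff)

text \<open>
  The zeros of the characteristic function in the right half plane are countable, so some vertical
  line to the left of the real root carries none.
\<close>

lemma zero_free_line:
  assumes "0 < \<alpha>" "0 \<le> \<tau>" "0 \<le> \<sigma>" "0 < l" and root: "char_fun \<alpha> \<gamma> k c \<tau> \<sigma> (of_real l) = 0"
  obtains s\<^sub>0 m where "0 < s\<^sub>0" "s\<^sub>0 < l" "0 < m" "\<And>v. m \<le> cmod (char_fun \<alpha> \<gamma> k c \<tau> \<sigma> (Complex s\<^sub>0 v))"
proof -
  let ?h = "char_fun \<alpha> \<gamma> k c \<tau> \<sigma>"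
  define H where "H = {s. 0 < Re s}"
  define b where "b = (\<bar>\<gamma>\<bar> + \<bar>k\<bar> + \<bar>k * c\<bar> + 1) powr (1 / \<alpha>)"
  have b: "0 < b" by (auto simp: b_def)
  have open_H: "open H" unfolding H_def by (rule open_halfspace_Re_gt)
  have conn_H: "connected H" unfolding H_def
    by (intro convex_connected convex_halfspace_Re_gt)
  have fsigma_H: "fsigma H"
  proof -
    have "H = (\<Union>n::nat. {s. inverse (real (Suc n)) \<le> Re s})"
    proof (intro set_eqI iffI)
      fix s assume "s \<in> H"
      then obtain n where "inverse (real (Suc n)) < Re s" using reals_Archimedean[of "Re s"] by (auto simp: H_def)
      then show "s \<in> (\<Union>n::nat. {s. inverse (real (Suc n)) \<le> Re s})" by (auto intro: less_imp_le)
    next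
      fix s assume "s \<in> (\<Union>n::nat. {s. inverse (real (Suc n)) \<le> Re s})"
      then obtain n where n: "inverse (real (Suc n)) \<le> Re s" by auto
      have "0 < inverse (real (Suc n))" by simp
      with n have "0 < Re s" by linarith
      then show "s \<in> H" by (simp add: H_def)
    qed
    then show ?thesis
      using fsigma.intros[of "\<lambda>n::nat. {s. inverse (real (Suc n)) \<le> Re s}"] by (simp add: closed_halfspace_Re_ge)
  qed
  \<comment> \<open>Countability of the zeros needs nonconstancy: the function vanishes at l but has
    modulus at least 1 at b.\<close>
  have "\<not> ?h constant_on H"
  proof
    assume "?h constant_on H"
    then obtain y where y: "\<And>s. s \<in> H \<Longrightarrow> ?h s = y" by (auto simp: constant_on_def)
    have "?h (of_real b) = ?h (of_real l)"
      using y[of "of_real b"] y[of "of_real l"] b assms(4) by (simp add: H_def)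
    moreover have "1 \<le> cmod (?h (of_real b))"
      using b by (intro char_fun_large assms) (auto simp: b_def)
    ultimately show False using root by simp
  qed
  then have "countable {s \<in> H. ?h s = 0}"
    using holomorphic_countable_zeros[OF char_fun_holomorphic[folded H_def] open_H conn_H fsigma_H] by blast
  then have "countable (Re ` {s \<in> H. ?h s = 0})" by (rule countable_image)
  moreover have "uncountable {0<..<l}" using assms(4) by (simp add: uncountable_open_interval)
  ultimately have "\<not> {0<..<l} \<subseteq> Re ` {s \<in> H. ?h s = 0}"
    using countable_subset by blast
  then obtain s\<^sub>0 where s0: "0 < s\<^sub>0" "s\<^sub>0 < l" "s\<^sub>0 \<notin> Re ` {s \<in> H. ?h s = 0}"
    unfolding subset_iff greaterThanLessThan_iff by blast
  have nz: "?h (Complex s\<^sub>0 v) \<noteq> 0" for v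
    using s0(1,3) by (auto simp: H_def image_iff dest: spec[of _ "Complex s\<^sub>0 v"])
  \<comment> \<open>Absence of zeros gives a positive minimum on the compact segment |v| <= b, and
    above it the modulus is at least 1. Together they give one constant for the whole line.\<close>
  define K where "K = (\<lambda>v. Complex s\<^sub>0 v) ` {- b..b}"
  have cK: "compact K"
    unfolding K_def by (intro compact_continuous_image continuous_intros) auto
  have "K \<subseteq> H" using s0(1) by (auto simp: K_def H_def)
  then have "continuous_on K (\<lambda>s. cmod (?h s))"
    using holomorphic_on_imp_continuous_on[OF char_fun_holomorphic[folded H_def]] continuous_on_subset
    by (intro continuous_intros) blast
  moreover have "K \<noteq> {}" using b by (auto simp: K_def)
  ultimately obtain s where s: "s \<in> K" "\<And>w. w \<in> K \<Longrightarrow> cmod (?h s) \<le> cmod (?h w)"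
    using continuous_attains_inf[OF cK] by blast
  define m where "m = min 1 (cmod (?h s))"
  have "0 < m" using s(1) nz by (auto simp: m_def K_def)
  moreover have "m \<le> cmod (?h (Complex s\<^sub>0 v))" for v
  proof (cases "v \<in> {- b..b}")
    case True
    then show ?thesis using s(2)[of "Complex s\<^sub>0 v"] by (auto simp: m_def K_def)
  next
    case False
    then have "b \<le> \<bar>v\<bar>" by auto
    also have "\<bar>v\<bar> \<le> cmod (Complex s\<^sub>0 v)" using abs_Im_le_cmod[of "Complex s\<^sub>0 v"] by simp
    finally have "1 \<le> cmod (?h (Complex s\<^sub>0 v))"
      using s0(1) by (intro char_fun_large assms) (auto simp: b_def)
    then show ?thesis by (simp add: m_def)
  qed
  ultimately show ?thesis using that s0(1,2) by blast
qed

section \<open>Weighted estimates for bounded solutions\<close>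

text \<open>Boundedness puts the transform of \<open>z\<close> on the entire right half plane, hence
  also at zeros of the characteristic function and to the left of them. No initial-value term
  appears, since \<open>z\<close> is causal and the equation is in integrated form.\<close>

lemma laplace_bounded_solution:
  fixes z r :: "real \<Rightarrow> real"
  assumes "0 < \<alpha>" "0 \<le> \<tau>" "0 \<le> \<sigma>"
    and z: "continuous_on UNIV z" "causal z" "\<And>t. \<bar>z t\<bar> \<le> B"
    and r: "continuous_on UNIV r" "causal r" "\<And>t. \<bar>r t\<bar> \<le> C"
    and eq: "z = frac_int \<alpha> (\<lambda>t. - \<gamma> * z t + k * z (t - \<tau>) - k * c * z (t - \<sigma>) + r t)"
    and s: "0 < Re s"
  shows "char_fun \<alpha> \<gamma> k c \<tau> \<sigma> s * laplace z s = laplace r s"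
proof -
  define f where "f t = - \<gamma> * z t + k * z (t - \<tau>) - k * c * z (t - \<sigma>) + r t" for t
  have shift: "continuous_on UNIV (\<lambda>t. z (t - d))" for d
    by (rule continuous_on_compose2[OF z(1)]) (auto intro!: continuous_intros)
  have f: "continuous_on UNIV f" "causal f"
    unfolding f_def using z(2) r(2) assms(2,3)
    by (auto intro!: continuous_intros shift z r simp: causal_def)
  have fB: "\<bar>f t\<bar> \<le> \<bar>\<gamma>\<bar> * B + \<bar>k\<bar> * B + \<bar>k * c\<bar> * B + C" for t
  proof -
    have "\<bar>a * z u\<bar> \<le> \<bar>a\<bar> * B" for a u
      unfolding abs_mult by (intro mult_left_mono z) auto
    from this[of "- \<gamma>" t] this[of k "t - \<tau>"] this[of "k * c" "t - \<sigma>"] r(3)[of t]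
    show ?thesis unfolding f_def abs_minus_cancel by linarith
  qed
  have i: "integrable lborel (\<lambda>t. exp (- s * of_real t) * of_real (z (t - d)) :: complex)" if "0 \<le> d" for d
    by (rule integrable_laplace[of _ B]) (use shift z s that in \<open>auto simp: causal_def\<close>)
  have i0: "integrable lborel (\<lambda>t. exp (- s * of_real t) * of_real (z t) :: complex)"
    using i[of 0] by simp
  have ir: "integrable lborel (\<lambda>t. exp (- s * of_real t) * of_real (r t) :: complex)"
    by (rule integrable_laplace[OF r s])
  define q where "q = of_real (- \<gamma>) + of_real k * exp (- s * of_real \<tau>) - of_real (k * c) * exp (- s * of_real \<sigma>)"
  have "laplace f s = (CLINT t|lborel. of_real (- \<gamma>) * (exp (- s * of_real t) * of_real (z t))
      + of_real k * (exp (- s * of_real t) * of_real (z (t - \<tau>)))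
      - of_real (k * c) * (exp (- s * of_real t) * of_real (z (t - \<sigma>)))
      + exp (- s * of_real t) * of_real (r t))"
    unfolding laplace_def f_def
    by (intro Bochner_Integration.integral_cong refl) (simp add: algebra_simps)
  also have "\<dots> = of_real (- \<gamma>) * laplace z s + of_real k * laplace (\<lambda>t. z (t - \<tau>)) s
      - of_real (k * c) * laplace (\<lambda>t. z (t - \<sigma>)) s + laplace r s"
    unfolding laplace_def integral_mult_right_zero[symmetric]
    by (subst Bochner_Integration.integral_add, (intro Bochner_Integration.integrable_add Bochner_Integration.integrable_diff integrable_mult_right i i0 ir assms)+)
       (subst Bochner_Integration.integral_diff, (intro Bochner_Integration.integrable_add Bochner_Integration.integrable_diff integrable_mult_right i i0 ir assms)+,
        subst Bochner_Integration.integral_add, (intro Bochner_Integration.integrable_add Bochner_Integration.integrable_diff integrable_mult_right i i0 ir assms)+, rule refl)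
  finally have F: "laplace f s = q * laplace z s + laplace r s"
    unfolding laplace_shift q_def by (simp only: algebra_simps)
  have "laplace z s = s powr (- of_real \<alpha>) * laplace f s"
    using laplace_frac_int[OF assms(1) f fB s] eq unfolding f_def[abs_def, symmetric] by simp
  moreover have "s powr (of_real \<alpha>) * s powr (- of_real \<alpha>) = 1"
  proof -
    have "s \<noteq> 0" using s by auto
    then show ?thesis by (simp add: powr_minus)
  qed
  ultimately have "s powr (of_real \<alpha>) * laplace z s = laplace f s"
    by (metis mult.assoc mult_1)
  then show ?thesis
    using F unfolding char_fun_def q_def[symmetric] left_diff_distrib by simp
qed

lemma laplace_line_estimate:
  fixes z r :: "real \<Rightarrow> real"
  assumes z: "continuous_on UNIV z" "causal z" "\<And>t. \<bar>z t\<bar> \<le> B"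
    and r: "continuous_on UNIV r" "causal r" "\<And>t. \<bar>r t\<bar> \<le> C"
    and s: "0 < s\<^sub>0" and m: "0 \<le> m" "\<And>v. m \<le> cmod (h (Complex s\<^sub>0 v))"
    and eq: "\<And>s. 0 < Re s \<Longrightarrow> h s * laplace z s = laplace r s"
  shows "m\<^sup>2 * (LINT t|lborel. (exp (- (s\<^sub>0 * t)) * z t)\<^sup>2) \<le> (LINT t|lborel. (exp (- (s\<^sub>0 * t)) * r t)\<^sup>2)"
proof -
  \<comment> \<open>On a vertical line the Laplace transform is the Fourier transform of the damped
    function; the sign of v is reversed because the two exponentials have opposite signs.\<close>
  have transform: "(CLINT t|lborel. of_real (exp (- (s\<^sub>0 * t)) * f t) * iexp (v * t)) = laplace f (Complex s\<^sub>0 (- v))"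
    for f :: "real \<Rightarrow> real" and v
    unfolding laplace_def
  proof (intro Bochner_Integration.integral_cong refl)
    fix t
    have "exp (- Complex s\<^sub>0 (- v) * of_real t) = of_real (exp (- (s\<^sub>0 * t))) * iexp (v * t)"
      by (simp add: exp_of_real[symmetric] exp_add[symmetric] Complex_eq algebra_simps)
    then show "of_real (exp (- (s\<^sub>0 * t)) * f t) * iexp (v * t) = exp (- Complex s\<^sub>0 (- v) * of_real t) * of_real (f t)"
      by simp
  qed
  have bd: "\<bar>exp (- (s\<^sub>0 * t)) * f t\<bar> \<le> b" if "causal f" "\<And>t. \<bar>f t\<bar> \<le> b" for f :: "real \<Rightarrow> real" and b t
  proof (cases "t \<le> 0")
    case True
    then show ?thesis using that(1) that(2)[of t] by (simp add: causal_def)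
  next
    case False
    then have "exp (- (s\<^sub>0 * t)) * \<bar>f t\<bar> \<le> 1 * b" using s that(2) by (intro mult_mono) auto
    then show ?thesis by (simp add: abs_mult)
  qed
  show ?thesis
  proof (rule Fourier_comparison[where B = B and B' = C])
    show "continuous_on UNIV (\<lambda>t. exp (- (s\<^sub>0 * t)) * z t)" "continuous_on UNIV (\<lambda>t. exp (- (s\<^sub>0 * t)) * r t)"
      by (intro continuous_intros z r)+
    show "integrable lborel (\<lambda>t. exp (- (s\<^sub>0 * t)) * z t)" "integrable lborel (\<lambda>t. exp (- (s\<^sub>0 * t)) * r t)"
      by (rule integrable_exp_causal[OF z s], rule integrable_exp_causal[OF r s])
    show "m * cmod (CLINT t|lborel. of_real (exp (- (s\<^sub>0 * t)) * z t) * iexp (v * t))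
        \<le> cmod (CLINT t|lborel. of_real (exp (- (s\<^sub>0 * t)) * r t) * iexp (v * t))" for v
      unfolding transform using eq[of "Complex s\<^sub>0 (- v)", symmetric] s m(2)[of "- v"]
      by (simp add: norm_mult mult_right_mono)
  qed (use bd[OF z(2,3)] bd[OF r(2,3)] m in auto)
qed

lemma laplace_of_real: "laplace f (of_real x) = of_real (LINT t|lborel. exp (- (x * t)) * f t)"
proof -
  have "exp (- of_real x * of_real t) * of_real (f t) = complex_of_real (exp (- (x * t)) * f t)" for t
    by (simp add: exp_of_real[symmetric])
  then show ?thesis unfolding laplace_def by (simp only: integral_complex_of_real)
qed

lemma integrable_weighted_square:
  fixes f :: "real \<Rightarrow> real"
  assumes "continuous_on UNIV f" "causal f" "\<And>t. \<bar>f t\<bar> \<le> B" "0 < s"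
  shows "integrable lborel (\<lambda>t. (exp (- (s * t)) * f t)\<^sup>2)"
proof -
  have "integrable lborel (\<lambda>t. exp (- (2 * s * t)) * (f t)\<^sup>2)"
  proof (rule integrable_exp_causal[where B = "B\<^sup>2"])
    show "\<bar>(f t)\<^sup>2\<bar> \<le> B\<^sup>2" for t
      using power_mono[OF assms(3)[of t], of 2] by simp
  qed (use assms in \<open>auto intro!: continuous_intros simp: causal_def\<close>)
  moreover have "exp (- (2 * s * t)) * (f t)\<^sup>2 = (exp (- (s * t)) * f t)\<^sup>2" for t
    by (simp add: power_mult_distrib exp_double[symmetric] mult.assoc)
  ultimately show ?thesis by simp
qed

lemma weighted_integral_shift:
  fixes f :: "real \<Rightarrow> real"
  assumes "0 \<le> d" "0 < s" "\<And>t. 0 \<le> f t"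
  shows "(LINT t|lborel. exp (- (s * t)) * f (t - d)) \<le> (LINT t|lborel. exp (- (s * t)) * f t)"
proof -
  have "(LINT t|lborel. exp (- (s * t)) * f (t - d)) = (LINT t|lborel. exp (- (s * d)) * (exp (- (s * t)) * f t))"
    by (subst lborel_integral_real_affine[of 1 _ d]) (auto simp: exp_add[symmetric] algebra_simps simp flip: mult.assoc)
  also have "\<dots> = exp (- (s * d)) * (LINT t|lborel. exp (- (s * t)) * f t)" by simp
  also have "\<dots> \<le> 1 * (LINT t|lborel. exp (- (s * t)) * f t)"
    using assms by (intro mult_right_mono Bochner_Integration.integral_nonneg) auto
  finally show ?thesis by simp
qed

text \<open>Absorption: \<open>r\<close> contains delayed copies of \<open>z\<close>, but with
  coefficients so small that their share is at most half of the left-hand side. The factor 3 comes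
  from squaring three summands, and 6 from moving the absorbed half across.\<close>

lemma weighted_square_estimate:
  fixes z r \<beta> :: "real \<Rightarrow> real"
  assumes z: "continuous_on UNIV z" "causal z" "\<And>t. \<bar>z t\<bar> \<le> B"
    and r: "continuous_on UNIV r" "causal r" "\<And>t. \<bar>r t\<bar> \<le> C"
    and \<beta>: "continuous_on UNIV \<beta>" "causal \<beta>" "\<And>t. \<bar>\<beta> t\<bar> \<le> D"
    and s: "0 < s" and delays: "0 \<le> \<tau>" "0 \<le> \<sigma>"
    and le: "\<And>t. \<bar>r t\<bar> \<le> a * \<beta> t + e * \<bar>z (t - \<tau>)\<bar> + c * e * \<bar>z (t - \<sigma>)\<bar>"
    and m: "0 < m" "m\<^sup>2 * (LINT t|lborel. (exp (- (s * t)) * z t)\<^sup>2) \<le> (LINT t|lborel. (exp (- (s * t)) * r t)\<^sup>2)"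
    and e: "3 * e\<^sup>2 * (1 + c\<^sup>2) \<le> m\<^sup>2 / 2"
  shows "(LINT t|lborel. (exp (- (s * t)) * z t)\<^sup>2) \<le> 6 * a\<^sup>2 / m\<^sup>2 * (LINT t|lborel. (exp (- (s * t)) * \<beta> t)\<^sup>2)"
proof -
  define J where "J = (LINT t|lborel. (exp (- (s * t)) * z t)\<^sup>2)"
  define S where "S = (LINT t|lborel. (exp (- (s * t)) * \<beta> t)\<^sup>2)"
  have J: "0 \<le> J" unfolding J_def by (rule Bochner_Integration.integral_nonneg) simp
  have shift: "continuous_on UNIV (\<lambda>t. z (t - d))" for d
    by (rule continuous_on_compose2[OF z(1)]) (auto intro!: continuous_intros)
  have i: "integrable lborel (\<lambda>t. (exp (- (s * t)) * z (t - d))\<^sup>2)" if "0 \<le> d" for d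
    by (rule integrable_weighted_square[where B = B]) (use shift z s that in \<open>auto simp: causal_def\<close>)
  have i\<beta>: "integrable lborel (\<lambda>t. (exp (- (s * t)) * \<beta> t)\<^sup>2)"
    by (rule integrable_weighted_square[OF \<beta> s])
  have sq: "(exp (- (s * t)) * y)\<^sup>2 = exp (- (2 * s * t)) * y\<^sup>2" for y t
    by (simp add: power_mult_distrib exp_double[symmetric] mult.assoc)
  have zd: "(LINT t|lborel. (exp (- (s * t)) * z (t - d))\<^sup>2) \<le> J" if "0 \<le> d" for d
    unfolding J_def sq using weighted_integral_shift[OF that, of "2 * s" "\<lambda>t. (z t)\<^sup>2"] s by simp
  have three: "(x + y + w)\<^sup>2 \<le> 3 * x\<^sup>2 + 3 * y\<^sup>2 + 3 * w\<^sup>2" for x y w :: real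
    using sum_squares_ge_zero[of "x - y" "y - w"] zero_le_power2[of "x - w"]
    by (simp add: power2_eq_square algebra_simps)
  have "(exp (- (s * t)) * r t)\<^sup>2 \<le> 3 * a\<^sup>2 * (exp (- (s * t)) * \<beta> t)\<^sup>2
      + 3 * e\<^sup>2 * (exp (- (s * t)) * z (t - \<tau>))\<^sup>2 + 3 * e\<^sup>2 * c\<^sup>2 * (exp (- (s * t)) * z (t - \<sigma>))\<^sup>2" for t
  proof -
    have "(r t)\<^sup>2 \<le> (a * \<beta> t + e * \<bar>z (t - \<tau>)\<bar> + c * e * \<bar>z (t - \<sigma>)\<bar>)\<^sup>2"
      using power_mono[OF le[of t], of 2] by simp
    also have "\<dots> \<le> 3 * (a * \<beta> t)\<^sup>2 + 3 * (e * \<bar>z (t - \<tau>)\<bar>)\<^sup>2 + 3 * (c * e * \<bar>z (t - \<sigma>)\<bar>)\<^sup>2"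
      by (rule three)
    also have "\<dots> = 3 * a\<^sup>2 * (\<beta> t)\<^sup>2 + 3 * e\<^sup>2 * (z (t - \<tau>))\<^sup>2 + 3 * e\<^sup>2 * c\<^sup>2 * (z (t - \<sigma>))\<^sup>2"
      by (simp add: power_mult_distrib)
    finally have "exp (- (2 * s * t)) * (r t)\<^sup>2 \<le> exp (- (2 * s * t)) *
        (3 * a\<^sup>2 * (\<beta> t)\<^sup>2 + 3 * e\<^sup>2 * (z (t - \<tau>))\<^sup>2 + 3 * e\<^sup>2 * c\<^sup>2 * (z (t - \<sigma>))\<^sup>2)"
      by (intro mult_left_mono) auto
    then show ?thesis
      unfolding sq by (simp add: algebra_simps)
  qed
  then have "(LINT t|lborel. (exp (- (s * t)) * r t)\<^sup>2) \<le> (LINT t|lborel. 3 * a\<^sup>2 * (exp (- (s * t)) * \<beta> t)\<^sup>2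
      + 3 * e\<^sup>2 * (exp (- (s * t)) * z (t - \<tau>))\<^sup>2 + 3 * e\<^sup>2 * c\<^sup>2 * (exp (- (s * t)) * z (t - \<sigma>))\<^sup>2)"
    by (intro integral_mono Bochner_Integration.integrable_add integrable_mult_right i i\<beta> delays
        integrable_weighted_square[OF r s])
  also have "\<dots> = 3 * a\<^sup>2 * S + 3 * e\<^sup>2 * (LINT t|lborel. (exp (- (s * t)) * z (t - \<tau>))\<^sup>2)
      + 3 * e\<^sup>2 * c\<^sup>2 * (LINT t|lborel. (exp (- (s * t)) * z (t - \<sigma>))\<^sup>2)"
    by (subst Bochner_Integration.integral_add,
        (intro Bochner_Integration.integrable_add integrable_mult_right i i\<beta> delays)+)+
       (simp add: S_def)
  also have "\<dots> \<le> 3 * a\<^sup>2 * S + 3 * e\<^sup>2 * J + 3 * e\<^sup>2 * c\<^sup>2 * J"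
    using zd delays by (intro add_mono mult_left_mono order_refl) auto
  also have "\<dots> = 3 * a\<^sup>2 * S + 3 * e\<^sup>2 * (1 + c\<^sup>2) * J"
    by (simp add: algebra_simps)
  also have "\<dots> \<le> 3 * a\<^sup>2 * S + m\<^sup>2 / 2 * J"
    using e J by (intro add_left_mono mult_right_mono)
  finally have "m\<^sup>2 * J \<le> 3 * a\<^sup>2 * S + m\<^sup>2 / 2 * J"
    using m(2) unfolding J_def by linarith
  then have "m\<^sup>2 * J \<le> 6 * a\<^sup>2 * S" by (simp add: algebra_simps)
  then show ?thesis
    using m(1) unfolding J_def[symmetric] S_def[symmetric] by (simp add: field_simps)
qed

text \<open>Split exp(-l t) into exp(-s t) and exp(-(l - s) t) and use a b <= a^2 / (2 d) + d b^2 /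
  2. When the square integral is of order d^2, choosing the amplitude \<open>d\<close> as the weight
  makes both terms of order d.\<close>

lemma weighted_abs_estimate:
  fixes z :: "real \<Rightarrow> real"
  assumes z: "continuous_on UNIV z" "causal z" "\<And>t. \<bar>z t\<bar> \<le> B"
    and s: "0 < s" "s < l" and d: "0 < d"
  shows "(LINT t|lborel. exp (- (l * t)) * \<bar>z t\<bar>)
    \<le> (LINT t|lborel. (exp (- (s * t)) * z t)\<^sup>2) / (2 * d) + d / (4 * (l - s))"
proof -
  have "exp (- (l * t)) * \<bar>z t\<bar> \<le> (exp (- (s * t)) * z t)\<^sup>2 / (2 * d)
      + d / 2 * (frac_kernel 1 t * exp (- (2 * (l - s) * t)))" for t
  proof (cases "0 < t")
    case False
    then show ?thesis using z(2) by (simp add: causal_def frac_kernel_def)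
  next
    case True
    define a where "a = exp (- (s * t)) * \<bar>z t\<bar>"
    define b where "b = exp (- ((l - s) * t))"
    have "exp (- (l * t)) * \<bar>z t\<bar> = a * b"
      by (simp add: a_def b_def exp_add[symmetric] algebra_simps flip: mult.assoc)
    also have "\<dots> \<le> a\<^sup>2 / (2 * d) + d / 2 * b\<^sup>2"
      using zero_le_power2[of "a - d * b"] d by (simp add: field_simps power2_eq_square)
    also have "b\<^sup>2 = exp (- (2 * (l - s) * t))"
      by (simp add: b_def exp_double[symmetric] mult.assoc)
    also have "a\<^sup>2 = (exp (- (s * t)) * z t)\<^sup>2"
      by (simp add: a_def power_mult_distrib)
    finally show ?thesis using True by (simp add: frac_kernel_def)
  qed
  moreover have "integrable lborel (\<lambda>t. exp (- (l * t)) * \<bar>z t\<bar>)"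
    by (rule integrable_exp_causal[where B = B]) (use z s in \<open>auto intro!: continuous_intros simp: causal_def\<close>)
  moreover have i1: "integrable lborel (\<lambda>t. (exp (- (s * t)) * z t)\<^sup>2 / (2 * d))"
    by (intro integrable_divide integrable_weighted_square[OF z s(1)])
  moreover have i2: "integrable lborel (\<lambda>t. d / 2 * (frac_kernel 1 t * exp (- (2 * (l - s) * t))))"
    using s by (intro integrable_mult_right integrable_frac_kernel_exp) auto
  ultimately have "(LINT t|lborel. exp (- (l * t)) * \<bar>z t\<bar>) \<le> (LINT t|lborel. (exp (- (s * t)) * z t)\<^sup>2 / (2 * d)
      + d / 2 * (frac_kernel 1 t * exp (- (2 * (l - s) * t))))"
    by (intro integral_mono Bochner_Integration.integrable_add) auto
  also have "\<dots> = (LINT t|lborel. (exp (- (s * t)) * z t)\<^sup>2) / (2 * d) + d / 2 * (2 * (l - s)) powr (- 1)"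
    unfolding Bochner_Integration.integral_add[OF i1 i2]
    using integral_frac_kernel_exp[of 1 "2 * (l - s)"] s by simp
  also have "\<dots> = (LINT t|lborel. (exp (- (s * t)) * z t)\<^sup>2) / (2 * d) + d / (4 * (l - s))"
    using s by (simp add: powr_minus_divide)
  finally show ?thesis .
qed

section \<open>Instability for a positive second delay\<close>

text \<open>The conditions on \<open>e\<close> serve in turn to keep \<open>G'\<close> between k / 2
  and 3 k / 2, to absorb the remainder in the square estimate, and to make the remainder lose
  against the history at the root.\<close>

lemma small_eta:
  fixes m c k A C :: real
  assumes "0 < m" "0 < c" "0 < k" "0 < A" "0 \<le> C"
  obtains e where "0 < e" "e \<le> k / 2" "3 * e\<^sup>2 * (1 + c\<^sup>2) \<le> m\<^sup>2 / 2" "e * (1 + c) * C < c * k / 2 * A"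
proof -
  have "((\<lambda>e. 3 * e\<^sup>2 * (1 + c\<^sup>2)) \<longlongrightarrow> 3 * 0\<^sup>2 * (1 + c\<^sup>2)) (at_right 0)"
    by (intro tendsto_intros)
  then have "\<forall>\<^sub>F e in at_right 0. 3 * e\<^sup>2 * (1 + c\<^sup>2) < m\<^sup>2 / 2"
    by (rule order_tendstoD(2)) (use assms in simp)
  moreover have "((\<lambda>e. e * (1 + c) * C) \<longlongrightarrow> 0 * (1 + c) * C) (at_right 0)"
    by (intro tendsto_intros)
  then have "\<forall>\<^sub>F e in at_right 0. e * (1 + c) * C < c * k / 2 * A"
    by (rule order_tendstoD(2)) (use assms in simp)
  moreover have "((\<lambda>e. e) \<longlongrightarrow> 0) (at_right (0::real))"
    by (intro tendsto_intros)
  then have "\<forall>\<^sub>F e in at_right 0. e < k / 2"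
    by (rule order_tendstoD(2)) (use assms in simp)
  moreover have "\<forall>\<^sub>F e in at_right (0::real). 0 < e" by (simp add: eventually_at_right_less)
  ultimately have "\<forall>\<^sub>F e in at_right (0::real). 0 < e \<and> e \<le> k / 2 \<and> 3 * e\<^sup>2 * (1 + c\<^sup>2) \<le> m\<^sup>2 / 2 \<and> e * (1 + c) * C < c * k / 2 * A"
    by eventually_elim auto
  then show ?thesis using that eventually_happens' trivial_limit_at_right_real by blast
qed

text \<open>A continuation argument: the hypothesis improves the bound R to R / 2 only strictly
  before T, and continuity prevents a jump from there to R.\<close>

lemma first_exit_bound:
  fixes z :: "real \<Rightarrow> real"
  assumes "continuous_on UNIV z" "causal z" "0 < R"
    and step: "\<And>T. 0 < T \<Longrightarrow> (\<And>t. t < T \<Longrightarrow> \<bar>z t\<bar> \<le> R) \<Longrightarrow> (\<And>t. 0 \<le> t \<Longrightarrow> t < T \<Longrightarrow> \<bar>z t\<bar> < R / 2)"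
  shows "\<bar>z t\<bar> \<le> R"
proof (rule ccontr)
  assume "\<not> \<bar>z t\<bar> \<le> R"
  define E where "E = {t. R \<le> \<bar>z t\<bar>}"
  have E: "t \<in> E" using \<open>\<not> \<bar>z t\<bar> \<le> R\<close> by (simp add: E_def)
  have pos: "0 < u" if "u \<in> E" for u
    using that assms(2,3) by (auto simp: E_def causal_def intro: ccontr)
  have "closed E"
    unfolding E_def using assms(1) by (intro closed_Collect_le continuous_intros)
  moreover have bdd: "bdd_below E" using pos by (intro bdd_belowI[of _ 0]) (auto intro: less_imp_le)
  ultimately have T: "Inf E \<in> E" using E closed_contains_Inf[of E] by blast
  define T where "T = Inf E"
  have T: "0 < T" "R \<le> \<bar>z T\<bar>" using T pos by (auto simp: T_def E_def)
  have less: "\<bar>z u\<bar> < R" if "u < T" for u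
    using cInf_lower[OF _ bdd, of u] that by (force simp: T_def E_def)
  \<comment> \<open>Any level strictly between R / 2 and R would contradict the improved bound
    before the first exit.\<close>
  have "\<exists>u. 0 \<le> u \<and> u \<le> T \<and> \<bar>z u\<bar> = 3 / 4 * R"
    by (rule IVT') (use assms T in \<open>auto simp: causal_def intro!: continuous_intros intro: continuous_on_subset\<close>)
  then obtain u where u: "0 \<le> u" "u \<le> T" "\<bar>z u\<bar> = 3 / 4 * R" by blast
  with T assms(3) have "u < T" by (cases "u = T") auto
  with step[OF T(1), of u] less u assms(3) show False by (force intro: less_imp_le)
qed

lemma unstable_positive_delay:
  fixes g D :: "real \<Rightarrow> real"
  assumes g: "g 0 = 0" "\<And>u. (g has_real_derivative D u) (at u)" "continuous_on UNIV D" "D 0 = k"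
    and \<alpha>: "0 < \<alpha>" "\<alpha> \<le> 1" and \<tau>: "0 \<le> \<tau>\<^sub>1" "0 < \<tau>\<^sub>2" and k: "0 < k"
    and gap: "0 < - \<gamma> + k - k * exp (- \<gamma> * \<tau>\<^sub>2)"
  shows "\<not> dde_stable \<alpha> \<gamma> \<tau>\<^sub>1 \<tau>\<^sub>2 g 0"
proof
  assume stable: "dde_stable \<alpha> \<gamma> \<tau>\<^sub>1 \<tau>\<^sub>2 g 0"
  define c where "c = exp (- \<gamma> * \<tau>\<^sub>2)"
  define \<sigma> where "\<sigma> = \<tau>\<^sub>1 + \<tau>\<^sub>2"
  have c: "0 < c" by (simp add: c_def)
  have \<sigma>: "0 \<le> \<sigma>" "0 < \<sigma>" using \<tau> by (auto simp: \<sigma>_def)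
  let ?h = "char_fun \<alpha> \<gamma> k c \<tau>\<^sub>1 \<sigma>"
  obtain l where l: "0 < l" "?h (of_real l) = 0"
    using char_fun_real_root[OF \<alpha>(1) \<tau>(1) \<sigma>(1), of \<gamma> k c] gap by (auto simp: c_def)
  obtain s m where s: "0 < s" "s < l" and m: "0 < m" "\<And>v. m \<le> cmod (?h (Complex s v))"
    using zero_free_line[OF \<alpha>(1) \<tau>(1) \<sigma>(1) l] by metis
  define \<beta> where "\<beta> = bump \<tau>\<^sub>2"
  define N where "N = (\<tau>\<^sub>2 * \<tau>\<^sub>2)\<^sup>2"
  have \<beta>: "continuous_on UNIV \<beta>" "causal \<beta>" "\<bar>\<beta> t\<bar> \<le> N" "0 \<le> \<beta> t" "\<tau>\<^sub>2 \<le> t \<Longrightarrow> \<beta> t = 0" "t \<le> 0 \<Longrightarrow> \<beta> t = 0" for t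
    using bump_outside[of _ \<tau>\<^sub>2] bump_bound[OF \<tau>(2), of t] bump_nonneg[of \<tau>\<^sub>2 t] \<tau>(2)
    by (auto simp: \<beta>_def N_def continuous_bump causal_def)
  define A where "A = (LINT t|lborel. exp (- (l * t)) * \<beta> t)"
  have A: "0 < A" unfolding A_def \<beta>_def by (rule integral_bump_pos[OF \<tau>(2) l(1)])
  define S where "S = (LINT t|lborel. (exp (- (s * t)) * \<beta> t)\<^sup>2)"
  have S: "0 \<le> S" unfolding S_def by (rule Bochner_Integration.integral_nonneg) simp
  \<comment> \<open>\<open>K\<close> bounds |G'| once e <= k / 2. \<open>C\<close> collects the
    coefficients of the two estimates so that the weighted integral of |z| will be at most d C; it
    depends neither on \<open>e\<close> nor on \<open>d\<close>.\<close>
  define K where "K = 3 / 2 * k"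
  define C where "C = 6 * (c * K)\<^sup>2 / m\<^sup>2 * S / 2 + 1 / (4 * (l - s))"
  have C: "0 \<le> C" unfolding C_def using S s m by (intro add_nonneg_nonneg divide_nonneg_nonneg mult_nonneg_nonneg) auto
  obtain e where e: "0 < e" "e \<le> k / 2" "3 * e\<^sup>2 * (1 + c\<^sup>2) \<le> m\<^sup>2 / 2" "e * (1 + c) * C < c * k / 2 * A"
    using small_eta[OF m(1) c k A C] by metis
  obtain R G G' where R: "0 < R" and G: "G 0 = 0" "\<And>u. (G has_real_derivative G' u) (at u)" "continuous_on UNIV G'"
    "\<And>u. \<bar>G' u - k\<bar> \<le> e" "\<And>u. \<bar>u\<bar> \<le> R \<Longrightarrow> G u = g u"
    using truncated_nonlinearity[OF g(1,2,3) e(1)] unfolding g(4) by metis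
  have G_lin: "\<bar>G u - k * u\<bar> \<le> e * \<bar>u\<bar>" for u
  proof -
    have "norm ((G u - k * u) - (G 0 - k * 0)) \<le> e * norm (u - 0)"
      by (rule field_differentiable_bound[of UNIV "\<lambda>u. G u - k * u" "\<lambda>u. G' u - k"])
         (use G(4) in \<open>auto intro!: derivative_eq_intros G(2)\<close>)
    then show ?thesis using G(1) by simp
  qed
  have G'K: "\<bar>G' u\<bar> \<le> K" for u using G(4)[of u] e(2) by (auto simp: K_def)
  \<comment> \<open>Stability is invoked with half the truncation radius, as the exit argument
    demands.\<close>
  obtain \<delta> where \<delta>: "0 < \<delta>" and escape: "\<And>\<phi> T x t. continuous_on {- (\<tau>\<^sub>1 + \<tau>\<^sub>2)..0} \<phi> \<Longrightarrow>
      history_norm (\<tau>\<^sub>1 + \<tau>\<^sub>2) (\<lambda>t. \<phi> t - 0) < \<delta> \<Longrightarrow> 0 < T \<Longrightarrow> dde_solution \<alpha> \<gamma> \<tau>\<^sub>1 \<tau>\<^sub>2 g \<phi> T x \<Longrightarrow>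
      t \<in> {0..<T} \<Longrightarrow> \<bar>x t - 0\<bar> < R / 2"
    using stable half_gt_zero[OF R] unfolding dde_stable_def by metis
  define d where "d = min \<delta> R / (N + 1)"
  have N: "0 \<le> N" by (simp add: N_def)
  have d: "0 < d" using \<delta> R N by (simp add: d_def)
  have dN: "d * N < \<delta>" "d * N \<le> R"
  proof -
    have "d * N < d * (N + 1)" using d by simp
    also have "\<dots> = min \<delta> R" using N by (simp add: d_def)
    finally show "d * N < \<delta>" "d * N \<le> R" by auto
  qed
  have d\<beta>: "\<bar>d * \<beta> t\<bar> \<le> d * N" for t
    unfolding abs_mult using d \<beta>(3) by (auto intro!: mult_mono)
  \<comment> \<open>The history seen by the second delayed term: for t <= \<sigma> the shifted
    history at t - \<sigma> is d \<beta>(t), which is zero from \<open>\<tau>\<^sub>2\<close>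
    on.\<close>
  define p where "p t = - c * G (d * \<beta> t)" for t
  define p' where "p' t = - c * (G' (d * \<beta> t) * (d * bump' \<tau>\<^sub>2 t))" for t
  define P where "P = max (c * (K * (d * N))) (c * (K * (d * (2 * (\<tau>\<^sub>2 * \<tau>\<^sub>2) * \<tau>\<^sub>2))))"
  have G_K: "\<bar>G u\<bar> \<le> K * \<bar>u\<bar>" for u
    using field_differentiable_bound[of UNIV G G' K u 0] G(1,2) G'K by simp
  have p_le: "\<bar>p t\<bar> \<le> c * K * d * \<beta> t" for t
    using mult_left_mono[OF G_K[of "d * \<beta> t"], of c] c d \<beta>(4)[of t] by (simp add: p_def abs_mult mult_ac)
  interpret delay_problem \<alpha> \<gamma> c \<tau>\<^sub>1 \<sigma> K P G G' p p'
  proof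
    show "(p has_real_derivative p' t) (at t)" for t
    proof -
      have "((\<lambda>t. d * \<beta> t) has_real_derivative d * bump' \<tau>\<^sub>2 t) (at t)"
        unfolding \<beta>_def by (intro DERIV_cmult bump_deriv)
      from DERIV_cmult[OF DERIV_chain2[OF G(2) this], of "- c"] show ?thesis
        unfolding p_def[abs_def] p'_def by simp
    qed
    show "continuous_on UNIV p'"
      unfolding p'_def
      by (intro continuous_intros continuous_on_compose2[OF G(3)] \<beta>(1) continuous_bump') auto
    show "causal p" "causal p'"
      using \<beta>(6) G(1) bump_outside[of _ \<tau>\<^sub>2] \<tau>(2) by (auto simp: causal_def p_def p'_def)
    show "\<bar>p t\<bar> \<le> P" for t
    proof -
      have "c * K * d * \<beta> t \<le> c * K * d * N"
        using c k d \<beta>(3)[of t] by (intro mult_left_mono) (auto simp: K_def)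
      then show ?thesis using p_le[of t] by (auto simp: P_def mult_ac)
    qed
    show "\<bar>p' t\<bar> \<le> P" for t
    proof -
      have "\<bar>p' t\<bar> = c * (\<bar>G' (d * \<beta> t)\<bar> * (d * \<bar>bump' \<tau>\<^sub>2 t\<bar>))"
        using c d by (simp add: p'_def abs_mult)
      also have "\<dots> \<le> c * (K * (d * (2 * (\<tau>\<^sub>2 * \<tau>\<^sub>2) * \<tau>\<^sub>2)))"
        using c d k bump_bound(2)[OF \<tau>(2), of t] G'K by (intro mult_left_mono mult_mono) (auto simp: K_def)
      finally show ?thesis by (simp add: P_def)
    qed
  qed (use \<alpha> \<tau> \<sigma> G G'K in auto)
  obtain z z' where z: "causal z" "causal z'" "continuous_on UNIV z'" "\<And>t. (z has_real_derivative z' t) (at t)"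
    and z_eq: "z = frac_int \<alpha> (rhs z)"
    using exists_solution by metis
  have z_cont: "continuous_on UNIV z" using z(4) by (rule DERIV_imp_continuous_on_UNIV)
  \<comment> \<open>Differentiating the fixed-point equation writes \<open>z'\<close> as a
    fractional integral, the form from which the Caputo derivative is computed.\<close>
  have z'_eq: "z' t = frac_int \<alpha> (rhs' z z') t" for t
  proof (rule DERIV_unique[OF z(4)])
    have "(frac_int \<alpha> (rhs z) has_real_derivative frac_int \<alpha> (rhs' z z') t) (at t)"
      by (intro frac_int_deriv \<alpha> causal_rhs causal_rhs' continuous_rhs' deriv_rhs z z_cont)
    then show "(z has_real_derivative frac_int \<alpha> (rhs' z z') t) (at t)"
      using z_eq by simp
  qed
  \<comment> \<open>The shift by \<sigma> places the bump between -\<sigma> and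
    \<open>- \<tau>\<^sub>1\<close>, so \<phi> and its derivative vanish for t >= 0 and the first
    delayed term never meets the history.\<close>
  define \<phi> where "\<phi> t = d * \<beta> (t + \<sigma>)" for t
  define x where "x t = z t + \<phi> t" for t
  have \<phi>_0: "\<phi> t = 0" if "- \<tau>\<^sub>1 \<le> t" for t using that \<beta>(5)[of "t + \<sigma>"] by (simp add: \<phi>_def \<sigma>_def)
  have \<phi>_cont: "continuous_on UNIV \<phi>"
    unfolding \<phi>_def by (intro continuous_intros continuous_on_compose2[OF \<beta>(1)]) auto
  have x_deriv: "(x has_real_derivative frac_int \<alpha> (rhs' z z') t) (at t)" if "0 \<le> t" for t
  proof -
    have "((\<lambda>t. \<beta> (t + \<sigma>)) has_real_derivative bump' \<tau>\<^sub>2 (t + \<sigma>)) (at t)"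
      using DERIV_shift[of \<beta> "bump' \<tau>\<^sub>2 (t + \<sigma>)" t \<sigma>] bump_deriv by (simp add: \<beta>_def)
    moreover have "bump' \<tau>\<^sub>2 (t + \<sigma>) = 0"
      using bump_outside[of "t + \<sigma>" \<tau>\<^sub>2] that \<tau> by (simp add: \<sigma>_def)
    ultimately have "(\<phi> has_real_derivative 0) (at t)"
      unfolding \<phi>_def using DERIV_cmult[of "\<lambda>t. \<beta> (t + \<sigma>)" 0 t UNIV d] by simp
    from DERIV_add[OF z(4)[of t] this] show ?thesis
      unfolding x_def z'_eq[symmetric] by simp
  qed
  have caputo: "caputo_exists \<alpha> x t \<and> caputo_deriv \<alpha> x t = rhs z t" if "0 < t" for t
    by (rule caputo_frac_int[OF \<alpha>, where f' = "rhs' z z'"])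
       (use that in \<open>auto intro: causal_rhs causal_rhs' continuous_rhs' deriv_rhs z z_cont x_deriv\<close>)
  have rhs_eq: "rhs z t = dde_rhs \<gamma> \<tau>\<^sub>1 \<tau>\<^sub>2 g x t" if t: "0 < t" and bd: "\<And>u. u \<le> t \<Longrightarrow> \<bar>z u\<bar> \<le> R" for t
  proof -
    have 1: "x t = z t" "x (t - \<tau>\<^sub>1) = z (t - \<tau>\<^sub>1)" using \<phi>_0 t \<tau> by (auto simp: x_def)
    have 2: "g (z (t - \<tau>\<^sub>1)) = G (z (t - \<tau>\<^sub>1))" using bd \<tau> by (intro G(5)[symmetric]) auto
    \<comment> \<open>At each time one summand is zero: up to \<sigma> the delayed \<open>z\<close>
      still vanishes, afterwards the bump does. As \<open>G 0 = 0\<close>, both cases fit one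
      formula. Truncation is invisible because d \<beta> and \<open>z\<close> stay within R.\<close>
    have 3: "g (x (t - \<sigma>)) = G (z (t - \<sigma>)) + G (d * \<beta> t)"
    proof (cases "t \<le> \<sigma>")
      case True
      then have "x (t - \<sigma>) = d * \<beta> t" "z (t - \<sigma>) = 0" using z(1) by (auto simp: x_def \<phi>_def causal_def)
      then show ?thesis using G(1) G(5)[of "d * \<beta> t"] d\<beta>[of t] dN by simp
    next
      case False
      then have "\<beta> t = 0" "x (t - \<sigma>) = z (t - \<sigma>)" using \<beta>(5)[of t] \<tau> by (auto simp: \<sigma>_def x_def \<phi>_def)
      then show ?thesis using G(1) G(5)[of "z (t - \<sigma>)"] bd \<sigma> by simp
    qed
    have 4: "t - \<tau>\<^sub>1 - \<tau>\<^sub>2 = t - \<sigma>" by (simp add: \<sigma>_def)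
    show ?thesis
      unfolding rhs_def dde_rhs_def 1 2 3 4 p_def c_def[symmetric] by (simp add: algebra_simps)
  qed
  \<comment> \<open>As long as \<open>z\<close> stays within R it solves the original equation, and
    stability then confines it to R / 2.\<close>
  have z_bound: "\<bar>z t\<bar> \<le> R" for t
  proof (rule first_exit_bound[OF z_cont z(1) R])
    fix T t assume T: "0 < T" "\<And>t. t < T \<Longrightarrow> \<bar>z t\<bar> \<le> R" and t: "0 \<le> t" "t < T"
    have "dde_solution \<alpha> \<gamma> \<tau>\<^sub>1 \<tau>\<^sub>2 g \<phi> T x"
      unfolding dde_solution_def
    proof (intro conjI ballI)
      show "continuous_on {- (\<tau>\<^sub>1 + \<tau>\<^sub>2)..<T} x"
        unfolding x_def by (intro continuous_intros continuous_on_subset[OF z_cont] continuous_on_subset[OF \<phi>_cont]) auto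
      show "x t = \<phi> t" if "t \<in> {- (\<tau>\<^sub>1 + \<tau>\<^sub>2)..0}" for t using that z(1) by (simp add: x_def causal_def)
      fix t assume "t \<in> {0<..<T}"
      then show "caputo_exists \<alpha> x t" "caputo_deriv \<alpha> x t = dde_rhs \<gamma> \<tau>\<^sub>1 \<tau>\<^sub>2 g x t"
        using caputo[of t] rhs_eq[of t] T(2) by auto
    qed
    moreover have "history_norm (\<tau>\<^sub>1 + \<tau>\<^sub>2) (\<lambda>t. \<phi> t - 0) < \<delta>"
    proof -
      have "history_norm (\<tau>\<^sub>1 + \<tau>\<^sub>2) (\<lambda>t. \<phi> t - 0) \<le> d * N"
        unfolding history_norm_def using \<sigma> d\<beta> by (intro cSUP_least) (auto simp: \<phi>_def \<sigma>_def)
      then show ?thesis using dN by linarith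
    qed
    ultimately have "\<bar>x t - 0\<bar> < R / 2"
      using t by (intro escape[of \<phi> T x] T continuous_on_subset[OF \<phi>_cont]) auto
    then show "\<bar>z t\<bar> < R / 2" using \<phi>_0[of t] t \<tau> by (simp add: x_def)
  qed
  \<comment> \<open>Everything in \<open>rhs z\<close> beyond its linear part: the forcing by the
    history and the deviation of \<open>G\<close> from k u.\<close>
  define r where "r t = p t + (G (z (t - \<tau>\<^sub>1)) - k * z (t - \<tau>\<^sub>1)) - c * (G (z (t - \<sigma>)) - k * z (t - \<sigma>))" for t
  have r_cont: "continuous_on UNIV r"
    unfolding r_def
    by (intro continuous_on_add continuous_on_diff continuous_on_mult continuous_on_const p_cont
        continuous_on_compose2[OF G_cont continuous_shift] continuous_shift z_cont subset_UNIV)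
  have r_causal: "causal r"
    using p_causal(1) z(1) G(1) \<tau> \<sigma> by (simp add: causal_def r_def)
  have r_le: "\<bar>r t\<bar> \<le> c * K * d * \<beta> t + e * \<bar>z (t - \<tau>\<^sub>1)\<bar> + c * e * \<bar>z (t - \<sigma>)\<bar>" for t
  proof -
    have "\<bar>c * (G (z (t - \<sigma>)) - k * z (t - \<sigma>))\<bar> \<le> c * e * \<bar>z (t - \<sigma>)\<bar>"
      using mult_left_mono[OF G_lin[of "z (t - \<sigma>)"], of c] c by (simp add: abs_mult mult.assoc)
    then show ?thesis
      using p_le[of t] G_lin[of "z (t - \<tau>\<^sub>1)"] unfolding r_def by linarith
  qed
  have r_bound: "\<bar>r t\<bar> \<le> c * K * d * N + e * R + c * e * R" for t
  proof -
    have "c * K * d * \<beta> t + e * \<bar>z (t - \<tau>\<^sub>1)\<bar> + c * e * \<bar>z (t - \<sigma>)\<bar> \<le> c * K * d * N + e * R + c * e * R"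
      using c k d e \<beta>(3)[of t] z_bound by (intro add_mono mult_left_mono) (auto simp: K_def)
    then show ?thesis using r_le[of t] by linarith
  qed
  have z_lin: "z = frac_int \<alpha> (\<lambda>t. - \<gamma> * z t + k * z (t - \<tau>\<^sub>1) - k * c * z (t - \<sigma>) + r t)"
  proof -
    have "rhs z = (\<lambda>t. - \<gamma> * z t + k * z (t - \<tau>\<^sub>1) - k * c * z (t - \<sigma>) + r t)"
      by (simp add: fun_eq_iff rhs_def r_def algebra_simps)
    with z_eq show ?thesis by simp
  qed
  note laplace_eq = laplace_bounded_solution[OF \<alpha>(1) \<tau>(1) \<sigma>(1) z_cont z(1) z_bound r_cont r_causal r_bound z_lin]
  have line: "m\<^sup>2 * (LINT t|lborel. (exp (- (s * t)) * z t)\<^sup>2) \<le> (LINT t|lborel. (exp (- (s * t)) * r t)\<^sup>2)"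
    by (rule laplace_line_estimate[OF z_cont z(1) z_bound r_cont r_causal r_bound s(1) less_imp_le[OF m(1)] m(2) laplace_eq])
  have J: "(LINT t|lborel. (exp (- (s * t)) * z t)\<^sup>2) \<le> 6 * (c * K * d)\<^sup>2 / m\<^sup>2 * S"
    unfolding S_def
    by (rule weighted_square_estimate[OF z_cont z(1) z_bound r_cont r_causal r_bound \<beta>(1,2,3) s(1) \<tau>(1) \<sigma>(1) r_le m(1) line e(3)])
  define Y where "Y = (LINT t|lborel. exp (- (l * t)) * \<bar>z t\<bar>)"
  have "Y \<le> (LINT t|lborel. (exp (- (s * t)) * z t)\<^sup>2) / (2 * d) + d / (4 * (l - s))"
    unfolding Y_def by (rule weighted_abs_estimate[OF z_cont z(1) z_bound s d])
  also have "\<dots> \<le> 6 * (c * K * d)\<^sup>2 / m\<^sup>2 * S / (2 * d) + d / (4 * (l - s))"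
    using J d by (intro add_right_mono divide_right_mono) auto
  also have "\<dots> = d * C"
    using d by (simp add: C_def power_mult_distrib power2_eq_square field_simps)
  finally have Y: "Y \<le> d * C" .
  have iz: "integrable lborel (\<lambda>t. exp (- (l * t)) * \<bar>z (t - q)\<bar>)" if "0 \<le> q" for q
    by (rule integrable_exp_causal[where B = R])
       (use z(1) z_bound l that in \<open>auto intro!: continuous_intros continuous_shift z_cont simp: causal_def\<close>)
  have i\<beta>: "integrable lborel (\<lambda>t. exp (- (l * t)) * \<beta> t)"
    by (rule integrable_exp_causal[OF \<beta>(1,2,3) l(1)])
  have "laplace r (of_real l) = 0"
    using laplace_eq[of "of_real l"] l by simp
  then have "0 = (LINT t|lborel. exp (- (l * t)) * r t)"
    by (simp add: laplace_of_real)
  also have "\<dots> \<le> (LINT t|lborel. - (c * k / 2 * d) * (exp (- (l * t)) * \<beta> t)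
      + (e * (exp (- (l * t)) * \<bar>z (t - \<tau>\<^sub>1)\<bar>) + c * e * (exp (- (l * t)) * \<bar>z (t - \<sigma>)\<bar>)))"
  proof (rule integral_mono)
    show "integrable lborel (\<lambda>t. exp (- (l * t)) * r t)"
      by (rule integrable_exp_causal[OF r_cont r_causal r_bound l(1)])
    show "integrable lborel (\<lambda>t. - (c * k / 2 * d) * (exp (- (l * t)) * \<beta> t)
      + (e * (exp (- (l * t)) * \<bar>z (t - \<tau>\<^sub>1)\<bar>) + c * e * (exp (- (l * t)) * \<bar>z (t - \<sigma>)\<bar>)))"
      by (intro Bochner_Integration.integrable_add integrable_mult_right iz i\<beta> \<tau> \<sigma>)
    fix t
    \<comment> \<open>The argument is nonnegative, so closeness of \<open>G\<close> to k u bounds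
      \<open>G\<close> from below; hence \<open>p\<close> lies below a fixed negative multiple of d
      \<beta>, linear in d.\<close>
    have "k / 2 * (d * \<beta> t) \<le> G (d * \<beta> t)"
    proof -
      have "\<bar>d * \<beta> t\<bar> = d * \<beta> t" using d \<beta>(4)[of t] by simp
      then have "k * (d * \<beta> t) - G (d * \<beta> t) \<le> e * (d * \<beta> t)"
        using abs_le_D2[OF G_lin[of "d * \<beta> t"]] by (simp only: minus_diff_eq)
      moreover have "e * (d * \<beta> t) \<le> k / 2 * (d * \<beta> t)"
        using e(2) d \<beta>(4)[of t] by (intro mult_right_mono) auto
      moreover have "k * (d * \<beta> t) = k / 2 * (d * \<beta> t) + k / 2 * (d * \<beta> t)" by simp
      ultimately show ?thesis by linarith
    qed
    from mult_left_mono[OF this less_imp_le[OF c]] have "p t \<le> - (c * k / 2 * d) * \<beta> t"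
      by (simp add: p_def mult_ac)
    moreover have "\<bar>c * (G (z (t - \<sigma>)) - k * z (t - \<sigma>))\<bar> \<le> c * e * \<bar>z (t - \<sigma>)\<bar>"
      using mult_left_mono[OF G_lin[of "z (t - \<sigma>)"], of c] c by (simp add: abs_mult mult.assoc)
    ultimately have "r t \<le> - (c * k / 2 * d) * \<beta> t + (e * \<bar>z (t - \<tau>\<^sub>1)\<bar> + c * e * \<bar>z (t - \<sigma>)\<bar>)"
      using G_lin[of "z (t - \<tau>\<^sub>1)"] unfolding r_def by linarith
    then have "exp (- (l * t)) * r t \<le> exp (- (l * t)) * (- (c * k / 2 * d) * \<beta> t + (e * \<bar>z (t - \<tau>\<^sub>1)\<bar> + c * e * \<bar>z (t - \<sigma>)\<bar>))"
      by (intro mult_left_mono) auto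
    also have "\<dots> = - (c * k / 2 * d) * (exp (- (l * t)) * \<beta> t)
      + (e * (exp (- (l * t)) * \<bar>z (t - \<tau>\<^sub>1)\<bar>) + c * e * (exp (- (l * t)) * \<bar>z (t - \<sigma>)\<bar>))"
      by (simp add: algebra_simps)
    finally show "exp (- (l * t)) * r t \<le> - (c * k / 2 * d) * (exp (- (l * t)) * \<beta> t)
      + (e * (exp (- (l * t)) * \<bar>z (t - \<tau>\<^sub>1)\<bar>) + c * e * (exp (- (l * t)) * \<bar>z (t - \<sigma>)\<bar>))" .
  qed
  also have "\<dots> = - (c * k / 2 * d) * A + (e * (LINT t|lborel. exp (- (l * t)) * \<bar>z (t - \<tau>\<^sub>1)\<bar>)
      + c * e * (LINT t|lborel. exp (- (l * t)) * \<bar>z (t - \<sigma>)\<bar>))"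
    unfolding A_def integral_mult_right_zero[symmetric]
    by (subst Bochner_Integration.integral_add,
        (intro Bochner_Integration.integrable_add integrable_mult_right iz i\<beta> \<tau> \<sigma>)+)+ (rule refl)
  also have "\<dots> \<le> - (c * k / 2 * d) * A + (e * Y + c * e * Y)"
  proof -
    have "(LINT t|lborel. exp (- (l * t)) * \<bar>z (t - q)\<bar>) \<le> Y" if "0 \<le> q" for q
      unfolding Y_def using weighted_integral_shift[OF that l(1), of "\<lambda>t. \<bar>z t\<bar>"] by simp
    then show ?thesis using e c \<tau> \<sigma> by (intro add_left_mono add_mono mult_left_mono) auto
  qed
  also have "\<dots> = e * (1 + c) * Y - c * k / 2 * d * A" by (simp add: algebra_simps)
  also have "\<dots> \<le> e * (1 + c) * (d * C) - c * k / 2 * d * A"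
    using Y e c by (intro diff_right_mono mult_left_mono) auto
  \<comment> \<open>The amplitude factors out, leaving the sign condition by which \<open>e\<close>
    was chosen.\<close>
  also have "\<dots> = d * (e * (1 + c) * C - c * k / 2 * A)" by (simp add: algebra_simps)
  also have "\<dots> < 0" using d e(4) by (simp add: mult_less_0_iff)
  finally show False by simp
qed

section \<open>Instability without second delay\<close>

text \<open>The continuous analogue of v^n / n! <= e^v: the kernel of order a + 1 is increasing, so
  its exponentially weighted integral, which is 1, is at least its value at v times the integral of
  exp(-u) beyond v.\<close>

lemma Gamma_lower_bound:
  fixes a v :: real
  assumes "0 \<le> a" "0 < v"
  shows "v powr a / Gamma (a + 1) \<le> exp v"
proof -
  define C where "C = v powr a / Gamma (a + 1)"
  have G: "0 < Gamma (a + 1)" using assms by (simp add: add_nonneg_pos)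
  have C: "0 \<le> C" using G by (simp add: C_def)
  have i: "integrable lborel (\<lambda>u. C * exp (- v) * (frac_kernel 1 (u - v) * exp (- (1 * (u - v)))))"
    using lborel_integrable_real_affine[OF integrable_frac_kernel_exp[of 1 1], of 1 "- v"]
    by (intro integrable_mult_right) (simp add: algebra_simps)
  have "C * exp (- v) = C * exp (- v) * (LINT u|lborel. frac_kernel 1 (u - v) * exp (- (1 * (u - v))))"
    using integral_frac_kernel_exp[of 1 1]
    by (subst lborel_integral_real_affine[of 1 _ v]) auto
  also have "\<dots> = (LINT u|lborel. C * exp (- v) * (frac_kernel 1 (u - v) * exp (- (1 * (u - v)))))"
    by (simp only: integral_mult_right_zero)
  also have "\<dots> \<le> (LINT u|lborel. frac_kernel (a + 1) u * exp (- (1 * u)))"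
  proof (rule integral_mono[OF i integrable_frac_kernel_exp])
    fix u
    show "C * exp (- v) * (frac_kernel 1 (u - v) * exp (- (1 * (u - v)))) \<le> frac_kernel (a + 1) u * exp (- (1 * u))"
    proof (cases "v < u")
      case True
      then have "C \<le> frac_kernel (a + 1) u"
        using assms G by (auto simp: C_def frac_kernel_def intro!: divide_right_mono powr_mono2)
      then have "C * exp (- (1 * u)) \<le> frac_kernel (a + 1) u * exp (- (1 * u))"
        by (intro mult_right_mono) auto
      moreover have "exp (- v) * exp (- (1 * (u - v))) = exp (- (1 * u))"
        by (simp add: exp_add[symmetric])
      ultimately show ?thesis using True by (simp add: frac_kernel_def[of 1] mult.assoc)
    next
      case False
      then show ?thesis using assms frac_kernel_nonneg[of "a + 1" u] by (simp add: frac_kernel_def[of 1])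
    qed
  qed (use assms in auto)
  also have "\<dots> = 1" using assms integral_frac_kernel_exp[of "a + 1" 1] by simp
  finally have "C * exp (- v) * exp v \<le> 1 * exp v" by (intro mult_right_mono) auto
  moreover have "exp (- v) * exp v = 1" by (simp add: exp_add[symmetric])
  ultimately show ?thesis by (simp add: C_def mult.assoc)
qed

section \<open>The Mittag-Leffler function and its Caputo derivative\<close>

definition ml_coeff :: "real \<Rightarrow> nat \<Rightarrow> real" where
  "ml_coeff a n = 1 / Gamma (a * real n + 1)"

definition mittag_leffler :: "real \<Rightarrow> real \<Rightarrow> real" where
  "mittag_leffler a w = (\<Sum>n. ml_coeff a n * w ^ n)"

lemma ml_coeff_pos: "0 < a \<Longrightarrow> 0 < ml_coeff a n"
  by (simp add: ml_coeff_def add_nonneg_pos)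

lemma summable_mittag_leffler:
  assumes "0 < a"
  shows "summable (\<lambda>n. ml_coeff a n * w ^ n)"
proof (cases "w = 0")
  case True
  then show ?thesis by (simp add: summable_0_powser)
next
  case False
  \<comment> \<open>With v^a = 2 |w| the bound on the Gamma function makes the terms at most exp(v)
    2^(-n).\<close>
  define v where "v = (2 * \<bar>w\<bar>) powr (1 / a)"
  have v: "0 < v" "v powr a = 2 * \<bar>w\<bar>" using False assms by (auto simp: v_def powr_powr)
  show ?thesis
  proof (rule summable_comparison_test')
    show "summable (\<lambda>n. exp v * (1 / 2) ^ n :: real)" by (intro summable_mult summable_geometric) simp
    fix n :: nat
    have "v powr (a * real n) = (2 * \<bar>w\<bar>) ^ n"
      using v False by (simp add: powr_powr[symmetric] powr_realpow)
    then have "(2 * \<bar>w\<bar>) ^ n * ml_coeff a n \<le> exp v"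
      using Gamma_lower_bound[OF _ v(1), of "a * real n"] assms by (simp add: ml_coeff_def)
    then show "norm (ml_coeff a n * w ^ n) \<le> exp v * (1 / 2) ^ n"
      using ml_coeff_pos[OF assms, of n] by (simp add: abs_mult power_abs power_mult_distrib power_divide field_simps)
  qed
qed

lemma mittag_leffler_deriv:
  assumes "0 < a"
  shows "(mittag_leffler a has_real_derivative (\<Sum>n. diffs (ml_coeff a) n * w ^ n)) (at w)"
  unfolding mittag_leffler_def[abs_def]
  by (rule termdiffs_strong_converges_everywhere) (rule summable_mittag_leffler[OF assms])

lemma mittag_leffler_0: "mittag_leffler a 0 = 1"
  using powser_zero[of "ml_coeff a"] by (simp add: mittag_leffler_def ml_coeff_def)

lemma mittag_leffler_lower:
  assumes "0 < a" "0 \<le> w"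
  shows "w * ml_coeff a 1 \<le> mittag_leffler a w"
proof -
  have "(\<Sum>n\<in>{1}. ml_coeff a n * w ^ n) \<le> mittag_leffler a w"
    unfolding mittag_leffler_def
    by (rule sum_le_suminf[OF summable_mittag_leffler[OF assms(1)]])
       (use assms in \<open>auto intro!: mult_nonneg_nonneg less_imp_le[OF ml_coeff_pos]\<close>)
  then show ?thesis by (simp add: mult.commute)
qed

text \<open>
  Differentiating \<open>E(\<mu> t\<^sup>\<alpha>)\<close> termwise gives kernels, whose fractional integrals are again kernels.
\<close>

lemma mittag_leffler_powr_deriv:
  assumes "0 < a" "0 < t"
  shows "((\<lambda>t. mittag_leffler a (\<mu> * t powr a)) has_real_derivative (\<Sum>n. \<mu> ^ Suc n * frac_kernel (a * real (Suc n)) t)) (at t)"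
    and "summable (\<lambda>n. \<mu> ^ Suc n * frac_kernel (a * real (Suc n)) t)"
proof -
  have summand: "diffs (ml_coeff a) n * (\<mu> * t powr a) ^ n * (\<mu> * (a * t powr (a - 1))) = \<mu> ^ Suc n * frac_kernel (a * real (Suc n)) t" for n
  proof -
    have p: "0 < a * real (Suc n)" using assms(1) by simp
    have G: "Gamma (a * real (Suc n) + 1) = a * real (Suc n) * Gamma (a * real (Suc n))"
    proof (rule Gamma_plus1)
      show "a * real (Suc n) \<notin> \<int>\<^sub>\<le>\<^sub>0"
        using p nonpos_Ints_nonpos[of "a * real (Suc n)"] by linarith
    qed
    have "(t powr a) ^ n * t powr (a - 1) = t powr (a * real n + (a - 1))"
      using assms(2) by (simp add: powr_powr[symmetric] powr_realpow powr_add)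
    also have "a * real n + (a - 1) = a * real (Suc n) - 1" by (simp add: algebra_simps)
    finally have pw: "(t powr a) ^ n * t powr (a - 1) = t powr (a * real (Suc n) - 1)" .
    have "diffs (ml_coeff a) n * (\<mu> * t powr a) ^ n * (\<mu> * (a * t powr (a - 1))) =
        \<mu> ^ Suc n * ((t powr a) ^ n * t powr (a - 1)) * (a * real (Suc n) / Gamma (a * real (Suc n) + 1))"
      by (simp add: diffs_def ml_coeff_def power_mult_distrib del: of_nat_Suc)
    also have "\<dots> = \<mu> ^ Suc n * frac_kernel (a * real (Suc n)) t"
      unfolding pw G using assms p Gamma_real_pos[OF p] by (simp add: frac_kernel_def del: of_nat_Suc)
    finally show ?thesis .
  qed
  have "summable (\<lambda>n. diffs (ml_coeff a) n * (\<mu> * t powr a) ^ n)"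
    by (rule termdiff_converges_all) (rule summable_mittag_leffler[OF assms(1)])
  then have s: "(\<lambda>n. \<mu> ^ Suc n * frac_kernel (a * real (Suc n)) t) sums
      ((\<Sum>n. diffs (ml_coeff a) n * (\<mu> * t powr a) ^ n) * (\<mu> * (a * t powr (a - 1))))"
    unfolding summand[symmetric] by (intro sums_mult2 summable_sums)
  then show "summable (\<lambda>n. \<mu> ^ Suc n * frac_kernel (a * real (Suc n)) t)" by (rule sums_summable)
  have "((\<lambda>t. \<mu> * t powr a) has_real_derivative \<mu> * (a * t powr (a - 1))) (at t)"
    using assms(2) by (auto intro!: derivative_eq_intros)
  from DERIV_chain2[OF mittag_leffler_deriv[OF assms(1)] this]
  show "((\<lambda>t. mittag_leffler a (\<mu> * t powr a)) has_real_derivative (\<Sum>n. \<mu> ^ Suc n * frac_kernel (a * real (Suc n)) t)) (at t)"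
    using sums_unique[OF s] by simp
qed

text \<open>For \<alpha> < 1 and \<mu> > 0 the derivative behaves like s^(\<alpha>-1) at 0, so the
  theory for continuously differentiable solutions does not cover this function. The Caputo integral
  is taken term by term; since \<mu> >= 0 all terms are nonnegative and the series of integrals is
  its own majorant.\<close>

lemma caputo_mittag_leffler:
  fixes x :: "real \<Rightarrow> real"
  assumes \<alpha>: "0 < \<alpha>" "\<alpha> \<le> 1" and \<mu>: "0 \<le> \<mu>" and t: "0 < t"
    and x: "\<And>s. 0 < s \<Longrightarrow> x s = mittag_leffler \<alpha> (\<mu> * s powr \<alpha>)"
  shows "caputo_exists \<alpha> x t \<and> caputo_deriv \<alpha> x t = \<mu> * x t"
proof -
  define h where "h s = (\<Sum>n. \<mu> ^ Suc n * frac_kernel (\<alpha> * real (Suc n)) s)" for s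
  have der: "(x has_real_derivative h s) (at s)" if "0 < s" for s
    using mittag_leffler_powr_deriv(1)[OF \<alpha>(1) that, of \<mu>] unfolding h_def
    by (rule has_field_derivative_transform_within_open[of _ _ _ "{0<..}"]) (use that x in auto)
  have diff: "\<forall>s\<in>{0<..t}. x differentiable (at s)"
    using der unfolding real_differentiable_def by (meson greaterThanAtMost_iff)
  have deriv: "deriv x s = h s" if "0 < s" for s
    using der[OF that] by (rule DERIV_imp_deriv)
  \<comment> \<open>The orders add up to \<alpha> n + 1, so the series reproduces itself with one
    extra factor \<mu>.\<close>
  have powers: "\<mu> ^ Suc n * frac_kernel (1 - \<alpha> + \<alpha> * real (Suc n)) t = \<mu> * (ml_coeff \<alpha> n * (\<mu> * t powr \<alpha>) ^ n)" for n
  proof -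
    have "(t powr \<alpha>) ^ n = t powr (\<alpha> * real n)"
      using t by (simp add: powr_powr[symmetric] powr_realpow)
    moreover have e: "1 - \<alpha> + \<alpha> * real (Suc n) = \<alpha> * real n + 1" by (simp add: algebra_simps)
    ultimately show ?thesis
      unfolding e using t by (simp add: frac_kernel_def ml_coeff_def power_mult_distrib)
  qed
  have "(\<lambda>n. ml_coeff \<alpha> n * (\<mu> * t powr \<alpha>) ^ n) sums x t"
    using summable_mittag_leffler[OF \<alpha>(1), THEN summable_sums] x[OF t] by (simp add: mittag_leffler_def)
  then have total: "(\<lambda>n. \<mu> ^ Suc n * frac_kernel (1 - \<alpha> + \<alpha> * real (Suc n)) t) sums (\<mu> * x t)"
    unfolding powers by (rule sums_mult)
  show ?thesis
  proof (cases "\<alpha> = 1")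
    case True
    then have "h t = \<mu> * x t" using sums_unique[OF total] by (simp add: h_def)
    with True diff deriv[OF t] show ?thesis by (simp add: caputo_exists_def caputo_deriv_def)
  next
    case False
    with \<alpha> have \<beta>: "0 < 1 - \<alpha>" by simp
    have G: "0 < Gamma (1 - \<alpha>)" using \<beta> by (rule Gamma_real_pos)
    define f where "f n s = \<mu> ^ Suc n * (frac_kernel (\<alpha> * real (Suc n)) s * frac_kernel (1 - \<alpha>) (t - s))" for n s
    have f: "has_bochner_integral lborel (f n) (\<mu> ^ Suc n * frac_kernel (1 - \<alpha> + \<alpha> * real (Suc n)) t)" for n
      unfolding f_def
      using frac_kernel_Beta[of "\<alpha> * real (Suc n)" "1 - \<alpha>" t] \<alpha>(1) \<beta>
      by (intro has_bochner_integral_mult_right) (simp add: add.commute del: of_nat_Suc)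
    have fi: "integrable lborel (f n)" "(LINT s|lborel. f n s) = \<mu> ^ Suc n * frac_kernel (1 - \<alpha> + \<alpha> * real (Suc n)) t" for n
      using f[of n] by (auto simp: has_bochner_integral_iff)
    have f0: "0 \<le> f n s" for n s
      unfolding f_def using \<mu> \<alpha>(1) \<beta> frac_kernel_nonneg[of "\<alpha> * real (Suc n)" s] frac_kernel_nonneg[of "1 - \<alpha>" "t - s"]
      by (simp del: of_nat_Suc)
    have fs: "summable (\<lambda>n. f n s)" for s
    proof (cases "0 < s")
      case True
      then show ?thesis
        unfolding f_def mult.assoc[symmetric]
        by (intro summable_mult2 mittag_leffler_powr_deriv(2) \<alpha>)
    qed (simp add: f_def frac_kernel_def)
    have fsum: "(\<Sum>n. f n s) = h s * frac_kernel (1 - \<alpha>) (t - s)" if "0 < s" for s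
      unfolding f_def h_def mult.assoc[symmetric]
      by (rule suminf_mult2[symmetric]) (rule mittag_leffler_powr_deriv(2)[OF \<alpha>(1) that])
    have norms: "AE s in lborel. summable (\<lambda>n. norm (f n s))" "summable (\<lambda>n. LINT s|lborel. norm (f n s))"
      using fs f0 fi(2) sums_summable[OF total] by auto
    have int: "integrable lborel (\<lambda>s. \<Sum>n. f n s)"
      by (rule integrable_suminf[OF fi(1) norms])
    have val: "(LINT s|lborel. (\<Sum>n. f n s)) = \<mu> * x t"
      using sums_unique2[OF sums_integral[OF fi(1) norms]] total unfolding fi(2) by blast
    define q where "q s = (t - s) powr (- \<alpha>) * deriv x s" for s
    \<comment> \<open>At s = 0 the value of \<open>deriv\<close> is unknown; this null set is
      excluded here and restored as a single point for measurability.\<close>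
    have q: "indicator {0..t} s *\<^sub>R q s = Gamma (1 - \<alpha>) * (\<Sum>n. f n s)" if "s \<noteq> 0" for s
    proof (cases "0 < s")
      case True
      then show ?thesis
        unfolding fsum[OF True] using G deriv[OF True] by (auto simp: q_def indicator_def frac_kernel_def)
    next
      case False
      then have "f n s = 0" for n by (simp add: f_def frac_kernel_def)
      then show ?thesis using False that by simp
    qed
    have AEq: "AE s in lborel. Gamma (1 - \<alpha>) * (\<Sum>n. f n s) = indicator {0..t} s *\<^sub>R q s"
      using AE_lborel_singleton[of 0] by eventually_elim (rule q[symmetric])
    have "(\<lambda>s. indicator {0..t} s *\<^sub>R q s) = (\<lambda>s. Gamma (1 - \<alpha>) * (\<Sum>n. f n s) + indicator {0} s *\<^sub>R q 0)"
    proof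
      fix s show "indicator {0..t} s *\<^sub>R q s = Gamma (1 - \<alpha>) * (\<Sum>n. f n s) + indicator {0} s *\<^sub>R q 0"
        using q[of s] t by (cases "s = 0") (auto simp: f_def frac_kernel_def)
    qed
    then have meas: "(\<lambda>s. indicator {0..t} s *\<^sub>R q s) \<in> borel_measurable lborel"
      using borel_measurable_integrable[OF int] by simp
    have qi: "integrable lborel (\<lambda>s. indicator {0..t} s *\<^sub>R q s)"
      by (rule integrable_cong_AE_imp[OF integrable_mult_right[OF int] meas AEq])
    then have qs: "set_integrable lborel {0..t} q" by (simp add: set_integrable_def)
    have abs: "q absolutely_integrable_on {0..t}"
      unfolding set_integrable_def using qi by (subst integrable_completion) (auto dest: borel_measurable_integrable)
    have "integral {0..t} q = (LINT s|lborel. indicator {0..t} s *\<^sub>R q s)"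
      using set_borel_integral_eq_integral(2)[OF qs] by (simp add: set_lebesgue_integral_def)
    also have "\<dots> = (LINT s|lborel. Gamma (1 - \<alpha>) * (\<Sum>n. f n s))"
      by (rule integral_cong_AE[OF borel_measurable_integrable[OF integrable_mult_right[OF int]] meas AEq, symmetric])
    also have "\<dots> = Gamma (1 - \<alpha>) * (\<mu> * x t)" by (simp only: integral_mult_right_zero val)
    finally show ?thesis
      using False diff abs G by (simp add: caputo_exists_def caputo_deriv_def q_def[abs_def])
  qed
qed

text \<open>Both delayed terms are evaluated at the same time with opposite coefficients, so
  \<open>g\<close> cancels and D^\<alpha> x = -\<gamma> x remains. A small constant history then
  grows at least like t^\<alpha>.\<close>

lemma unstable_zero_delay:
  assumes \<alpha>: "0 < \<alpha>" "\<alpha> \<le> 1" and "0 \<le> \<tau>\<^sub>1" and \<gamma>: "\<gamma> < 0"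
  shows "\<not> dde_stable \<alpha> \<gamma> \<tau>\<^sub>1 0 g 0"
proof
  assume "dde_stable \<alpha> \<gamma> \<tau>\<^sub>1 0 g 0"
  then obtain \<delta> where \<delta>: "0 < \<delta>" and escape: "\<And>\<phi> T x t. continuous_on {- (\<tau>\<^sub>1 + 0)..0} \<phi> \<Longrightarrow>
      history_norm (\<tau>\<^sub>1 + 0) (\<lambda>t. \<phi> t - 0) < \<delta> \<Longrightarrow> 0 < T \<Longrightarrow> dde_solution \<alpha> \<gamma> \<tau>\<^sub>1 0 g \<phi> T x \<Longrightarrow>
      t \<in> {0..<T} \<Longrightarrow> \<bar>x t - 0\<bar> < 1"
    unfolding dde_stable_def by (metis zero_less_one)
  define d where "d = \<delta> / 2"
  have d: "0 < d" "d < \<delta>" using \<delta> by (auto simp: d_def)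
  define \<mu> where "\<mu> = - \<gamma>"
  have \<mu>: "0 < \<mu>" using \<gamma> by (simp add: \<mu>_def)
  \<comment> \<open>Replacing t by its positive part extends the solution by the constant 1 over the
    history.\<close>
  define y where "y t = mittag_leffler \<alpha> (\<mu> * max 0 t powr \<alpha>)" for t
  define x where "x t = d * y t" for t
  define c where "c = d * (\<mu> * ml_coeff \<alpha> 1)"
  have c: "0 < c" using d \<mu> ml_coeff_pos[OF \<alpha>(1), of 1] by (simp add: c_def)
  \<comment> \<open>The time at which the linear term of the series alone reaches 1, the \<epsilon>
    for which stability was assumed.\<close>
  define t where "t = (1 / c) powr (1 / \<alpha>)"
  have t: "0 < t" "t powr \<alpha> = 1 / c" using c \<alpha> by (auto simp: t_def powr_powr)
  have x_0: "x s = d" if "s \<le> 0" for s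
    using that by (simp add: x_def y_def max_absorb1 mittag_leffler_0)
  have caputo: "caputo_exists \<alpha> x s \<and> caputo_deriv \<alpha> x s = \<mu> * x s" if s: "0 < s" for s
  proof -
    have y: "caputo_exists \<alpha> y s \<and> caputo_deriv \<alpha> y s = \<mu> * y s"
      by (rule caputo_mittag_leffler) (use \<alpha> \<mu> s in \<open>auto simp: y_def\<close>)
    have dy: "y differentiable (at u)" if "0 < u" "u \<le> s" for u
      using y that by (auto simp: caputo_exists_def)
    have dx: "x differentiable (at u)" "deriv x u = d * deriv y u" if "0 < u" "u \<le> s" for u
    proof -
      have "(y has_real_derivative deriv y u) (at u)"
        using dy[OF that] by (simp add: DERIV_deriv_iff_real_differentiable)
      from DERIV_cmult[OF this, of d] have "(x has_real_derivative d * deriv y u) (at u)"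
        unfolding x_def .
      then show "x differentiable (at u)" "deriv x u = d * deriv y u"
        by (auto simp: real_differentiable_def DERIV_imp_deriv)
    qed
    show ?thesis
    proof (cases "\<alpha> = 1")
      case True
      then show ?thesis using y dx s by (simp add: caputo_exists_def caputo_deriv_def x_def)
    next
      case False
      \<comment> \<open>Differentiability is known only for u > 0, so the integrands are compared
        off the null set {0}.\<close>
      have eq: "d * ((s - u) powr (- \<alpha>) * deriv y u) = (s - u) powr (- \<alpha>) * deriv x u" if "u \<in> {0..s} - {0}" for u
        using dx(2)[of u] that by auto
      have "(\<lambda>u. (s - u) powr (- \<alpha>) * deriv y u) absolutely_integrable_on {0..s}"
        using y False \<alpha> by (simp add: caputo_exists_def)
      then have "(\<lambda>u. d * ((s - u) powr (- \<alpha>) * deriv y u)) absolutely_integrable_on {0..s}"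
        by (rule set_integrable_mult_right)
      then have "(\<lambda>u. (s - u) powr (- \<alpha>) * deriv x u) absolutely_integrable_on {0..s}"
      proof (rule absolutely_integrable_spike[where S = "{0}"])
        show "(s - u) powr (- \<alpha>) * deriv x u = d * ((s - u) powr (- \<alpha>) * deriv y u)" if "u \<in> {0..s} - {0}" for u
          using eq[OF that] by (rule sym)
      qed simp
      moreover have "integral {0..s} (\<lambda>u. (s - u) powr (- \<alpha>) * deriv x u) =
          integral {0..s} (\<lambda>u. d * ((s - u) powr (- \<alpha>) * deriv y u))"
        by (rule integral_spike[of "{0}", OF _ eq]) simp_all
      then have "caputo_deriv \<alpha> x s = d * caputo_deriv \<alpha> y s"
        using False by (simp add: caputo_deriv_def)
      ultimately show ?thesis
        using y dx by (simp add: caputo_exists_def x_def)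
    qed
  qed
  have x_cont: "continuous_on UNIV x"
  proof -
    have "continuous_on UNIV (mittag_leffler \<alpha>)"
      using mittag_leffler_deriv[OF \<alpha>(1)] by (rule DERIV_imp_continuous_on_UNIV)
    moreover have "continuous_on UNIV (\<lambda>t. \<mu> * max 0 t powr \<alpha>)"
      using \<alpha> by (intro continuous_on_mult continuous_on_powr') (auto intro!: continuous_intros)
    ultimately show ?thesis
      unfolding x_def y_def by (intro continuous_on_mult continuous_on_const, rule continuous_on_compose2[of UNIV "mittag_leffler \<alpha>"]) auto
  qed
  have "dde_solution \<alpha> \<gamma> \<tau>\<^sub>1 0 g (\<lambda>t. d) (t + 1) x"
    unfolding dde_solution_def dde_rhs_def
    using x_0 caputo continuous_on_subset[OF x_cont] by (auto simp: \<mu>_def)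
  moreover have "history_norm (\<tau>\<^sub>1 + 0) (\<lambda>t. d - 0) < \<delta>"
    using d assms(3) by (simp add: history_norm_def)
  ultimately have "\<bar>x t - 0\<bar> < 1"
    using t by (intro escape[of "\<lambda>t. d" "t + 1" x]) auto
  moreover have "1 \<le> x t"
  proof -
    have "d * ((\<mu> * t powr \<alpha>) * ml_coeff \<alpha> 1) \<le> x t"
      using mittag_leffler_lower[of \<alpha> "\<mu> * t powr \<alpha>"] t(1) \<mu> d \<alpha>
      by (auto simp: x_def y_def intro!: mult_left_mono)
    moreover have "d * ((\<mu> * t powr \<alpha>) * ml_coeff \<alpha> 1) = c * t powr \<alpha>" by (simp add: c_def)
    moreover have "c * t powr \<alpha> = 1" using c t(2) by simp
    ultimately show ?thesis by linarith
  qed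
  ultimately show False by simp
qed

section \<open>The equilibrium and the reduction of both parameter regimes to one inequality\<close>

lemma zero_equilibrium:
  assumes "g 0 = 0"
  shows "dde_equilibrium \<alpha> \<gamma> \<tau>\<^sub>1 \<tau>\<^sub>2 g 0"
  using assms
  by (auto simp: dde_equilibrium_def dde_solution_def dde_rhs_def caputo_exists_def caputo_deriv_def)

theorem theorem5p1:
  fixes \<gamma> k \<alpha> \<tau>\<^sub>1 \<tau>\<^sub>2 :: real and g :: "real \<Rightarrow> real"
  assumes "g C1_differentiable_on UNIV" and "g 0 = 0" and "deriv g 0 = k"
    and "0 < \<alpha>" and "\<alpha> \<le> 1" and "0 \<le> \<tau>\<^sub>1" and "0 \<le> \<tau>\<^sub>2"
  shows "(0 < \<gamma> \<and> \<gamma> < k \<and> \<tau>\<^sub>2 > - (1 / \<gamma>) * ln ((k - \<gamma>) / k)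
            \<longrightarrow> dde_unstable \<alpha> \<gamma> \<tau>\<^sub>1 \<tau>\<^sub>2 g 0) \<and>
         (\<gamma> < 0 \<and> 0 < k \<and> \<tau>\<^sub>2 < - (1 / \<gamma>) * ln ((k - \<gamma>) / k)
            \<longrightarrow> dde_unstable \<alpha> \<gamma> \<tau>\<^sub>1 \<tau>\<^sub>2 g 0)"
proof -
  obtain D where D: "\<And>u. (g has_real_derivative D u) (at u)" "continuous_on UNIV D"
    using assms(1) by (auto simp: C1_differentiable_on_def has_real_derivative_iff_has_vector_derivative)
  have D0: "D 0 = k" using DERIV_imp_deriv[OF D(1)] assms(3) by simp
  \<comment> \<open>The regimes differ in the sign of \<gamma>, by which the condition on
    \<open>\<tau>\<^sub>2\<close> is multiplied; in both of them -\<gamma>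
    \<open>\<tau>\<^sub>2\<close> lies below the logarithm. Exponentiating makes the characteristic
    function negative at 0.\<close>
  have gap: "0 < - \<gamma> + k - k * exp (- \<gamma> * \<tau>\<^sub>2)"
    if k: "0 < k" "\<gamma> < k" and ln: "- \<gamma> * \<tau>\<^sub>2 < ln ((k - \<gamma>) / k)"
  proof -
    have "exp (- \<gamma> * \<tau>\<^sub>2) < exp (ln ((k - \<gamma>) / k))"
      using ln by (simp only: exp_less_cancel_iff)
    then have "exp (- \<gamma> * \<tau>\<^sub>2) < (k - \<gamma>) / k" using k by simp
    then show ?thesis using k by (simp add: field_simps)
  qed
  have equilibrium: "dde_equilibrium \<alpha> \<gamma> \<tau>\<^sub>1 \<tau>\<^sub>2 g 0"
    using assms(2) by (rule zero_equilibrium)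
  have unstable: "dde_unstable \<alpha> \<gamma> \<tau>\<^sub>1 \<tau>\<^sub>2 g 0"
    if k: "0 < k" "\<gamma> < k" and ln: "- \<gamma> * \<tau>\<^sub>2 < ln ((k - \<gamma>) / k)"
  proof (cases "\<tau>\<^sub>2 = 0")
    case True
    \<comment> \<open>For a vanishing second delay the gap is -\<gamma> itself, so only the regime
      \<gamma> < 0 can occur.\<close>
    with gap[OF that] have "\<gamma> < 0" by simp
    then show ?thesis
      using unstable_zero_delay[OF assms(4,5,6)] equilibrium True
      by (simp add: dde_unstable_def)
  next
    case False
    with assms(7) have "0 < \<tau>\<^sub>2" by simp
    from unstable_positive_delay[OF assms(2) D D0 assms(4-6) this k(1) gap[OF that]] show ?thesis
      using equilibrium by (simp add: dde_unstable_def)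
  qed
  have "- \<gamma> * \<tau>\<^sub>2 < ln ((k - \<gamma>) / k)" if "0 < \<gamma>" "\<tau>\<^sub>2 > - (1 / \<gamma>) * ln ((k - \<gamma>) / k)"
    using mult_strict_left_mono[OF that(2,1)] that(1) by simp
  moreover have "- \<gamma> * \<tau>\<^sub>2 < ln ((k - \<gamma>) / k)" if "\<gamma> < 0" "\<tau>\<^sub>2 < - (1 / \<gamma>) * ln ((k - \<gamma>) / k)"
    using mult_strict_left_mono[OF that(2), of "- \<gamma>"] that(1) by simp
  ultimately show ?thesis using unstable by auto
qed

end
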